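(* Consider the saddle-point problem $$\min_{x\in Q_x}\Big\{ g(x):=r(x)+\max_{y\in Q_y}S(x,y)\Big\},\qquad S(x,y):=F(x,y)-h(y),$$ where: (i) $Q_x\subseteq\mathbb{R}^n$ is a convex compact set with nonempty interior, the dimension $n$ is relatively small (at most a hundred), and $Q_y=\mathbb{R}^m$; (ii) $r:Q_x\to\mathbb{R}$ is $\mu_x$-strongly convex ($\mu_x>0$), and $h:Q_y\to\mathbb{R}$ is continuous and $\mu_y$-strongly convex ($\mu_y>0$); (iii) $F$ is defined in a neighbourhood of $Q_x\times Q_y$, is convex in $x$ and concave in $y$, is differentiable in $y$, and for some $L_{yy}\ge 0$ $$\|\nabla_yF(x,y)-\nabla_yF(x,y')\|_2\le L_{yy}\|y-y'\|_2\qquad\forall x\in Q_x,\ y,y'\in Q_y;$$ (iv) $S$ is continuous, strongly convex in $x$ and strongly concave in $y$. Suppose moreover that one of the following holds: (a) $h$ is proximal-friendly, i.e. the problem $$\min_{y\in Q_y}\{\langle c_1,y\rangle+h(y)+c_2\|y\|_2^2\},\qquad c_1\in Q_y,\ c_2>0, \tag{P}$$ can be solved explicitly; (b) $h$ has an $L_h$-Lipschitz gradient. Then an $\varepsilon$-solution of the saddle-point problem can be attained using $$O\!\left(n\ln\frac n\varepsilon\right)\ \text{computations of } \nabla_xF \text{ and } \nabla r,$$ and - in case (a): $O\!\left(n\sqrt{\frac{L_{yy}}{\mu_y}}\,\ln\frac n\varepsilon\,\ln\frac1\varepsilon\right)$ computations of $\nabla_yF$ and solutions of problems (P); - in case (b):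 $O\!\left(n\sqrt{\frac{L_{yy}}{\mu_y}}\,\ln\frac n\varepsilon\,\ln\frac1\varepsilon\right)$ computations of $\nabla_yF$ and $O\!\left(n\sqrt{\frac{L_h}{\mu_y}}\,\ln\frac n\varepsilon\,\ln\frac1\varepsilon\right)$ computations of $\nabla h$.
   Context: An $\varepsilon$-solution is a pair $(\tilde x,\tilde y)\in Q_x\times Q_y$ with $\max\{\|\tilde x-x_*\|_2,\|\tilde y-y_*\|_2\}\le\varepsilon$, where $(x_*,y_* )$ is the exact solution of the saddle-point problem. Here $\nabla_xF$ and $\nabla r$ denote arbitrary finite subgradients (of $F$ in $x$, and of $r$) at the query point. The bounds are asymptotic as $\varepsilon\to0$. They are obtained by minimizing $g$ with Vaidya's cutting-plane method using $\delta$-subgradients of $g$ (vectors $\nu$ with $g(x')\ge g(x)+\langle\nu,x'-x\rangle-\delta$ for all $x'\in Q_x$), where the $\delta$-subgradient is computed from an approximate solution of the inner maximization in $y$ found by a restarted accelerated gradient method. The outer method makes $$\left\lceil \frac{2n}{\gamma}\ln\frac{2n^{1.5}B\mathcal R}{\gamma\rho\varepsilon}+\frac{\ln\pi}{\gamma}\right\rceil$$ iterations, where $\gamma>0$ is a parameter of Vaidya's method, $Q_x$ lies in a Euclidean ball of radius $\mathcal R$ and contains a Euclidean ball of radius $\rho>0$, $g$ is continuous, and $|g(x)-g(x')|\le B$ on $Q_x$. Each inner problem takes $O\big(\sqrt{L_{yy}/\mu_y}\,\ln(\mu_yR_y^2/\varepsilon)\big)$ computations of $\nabla_yF$ (with as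 many solutions of (P) in case (a)) and, in case (b), $O\big(\sqrt{L_h/\mu_y}\,\ln(\mu_yR_y^2/\varepsilon)\big)$ computations of $\nabla h$, where $R_y$ is the diameter of $\{\arg\max_{y\in Q_y}S(x,y): x\in Q_x\}$. In these counts $\varepsilon$ is the accuracy in the value of $g$; passing to accuracy $\varepsilon$ in the arguments replaces $\varepsilon$ by a constant multiple of $\varepsilon^2$ under the logarithms. The theorem's $O(\cdot)$ suppresses $\gamma$ and the constants appearing under these logarithms.
   Formalization: In the bounds on computations of ∇_yF and solutions of (P), √(L_yy/μ_y) is replaced by √(max{1, L_yy/μ_y}); the literal bound fails for L_yy = 0, where it would allow no computation of ∇_yF at all. *)

theory Defs
  imports "HOL-Analysis.Analysis"
begin

section \<open>All Euclidean spaces inside one type\<close>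

text \<open>
  The hidden constant of an \<open>O\<close>-bound that mentions the dimension must be chosen before the
  dimension, so the dimension has to be a natural number rather than a type. The type \<open>rvec\<close>
  consists of the finitely supported real sequences with the inner product
  \<open>\<Sum>i. x i * y i\<close>; the subspace \<open>Rn n\<close> of the sequences supported on \<open>{..<n}\<close> is
  \<open>n\<close>-dimensional Euclidean space.
\<close>

typedef rvec = "{f :: nat \<Rightarrow> real. finite {i. f i \<noteq> 0}}"
  morphisms coord Abs_rvec
  by (rule exI[of _ "\<lambda>_. 0"]) simp

setup_lifting type_definition_rvec

lemma rvec_eqI: "(\<And>i. coord x i = coord y i) \<Longrightarrow> x = y"
  by (simp add: coord_inject[symmetric] fun_eq_iff)

definition support :: "rvec \<Rightarrow> nat set" where
  "support x = {i. coord x i \<noteq> 0}"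

lemma finite_support [simp]: "finite (support x)"
  using coord[of x] by (simp add: support_def)

instantiation rvec :: real_vector
begin

lift_definition zero_rvec :: rvec is "\<lambda>_. 0"
  by simp

lift_definition plus_rvec :: "rvec \<Rightarrow> rvec \<Rightarrow> rvec" is "\<lambda>f g i. f i + g i"
  subgoal for f g by (rule finite_subset[of _ "{i. f i \<noteq> 0} \<union> {i. g i \<noteq> 0}"]) auto
  done

lift_definition uminus_rvec :: "rvec \<Rightarrow> rvec" is "\<lambda>f i. - f i"
  by simp

lift_definition minus_rvec :: "rvec \<Rightarrow> rvec \<Rightarrow> rvec" is "\<lambda>f g i. f i - g i"
  subgoal for f g by (rule finite_subset[of _ "{i. f i \<noteq> 0} \<union> {i. g i \<noteq> 0}"]) auto
  done

lift_definition scaleR_rvec :: "real \<Rightarrow> rvec \<Rightarrow> rvec" is "\<lambda>c f i. c * f i"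
  by (rule finite_subset[rotated]) auto

instance
  by standard (transfer; simp add: fun_eq_iff algebra_simps)+

end

lemma coord_simps [simp]:
  "coord 0 i = 0"
  "coord (x + y) i = coord x i + coord y i"
  "coord (- x) i = - coord x i"
  "coord (x - y) i = coord x i - coord y i"
  "coord (c *\<^sub>R x) i = c * coord x i"
  by (transfer; simp)+

definition rvec_dot :: "rvec \<Rightarrow> rvec \<Rightarrow> real" where
  "rvec_dot x y = (\<Sum>i\<in>support x \<inter> support y. coord x i * coord y i)"

lemma rvec_dot_eq:
  assumes "finite A" and "support x \<subseteq> A \<or> support y \<subseteq> A"
  shows "rvec_dot x y = (\<Sum>i\<in>A. coord x i * coord y i)"
  unfolding rvec_dot_def using assms
  by (intro sum.mono_neutral_left) (auto simp: support_def)

instantiation rvec :: real_inner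
begin

definition inner_rvec :: "rvec \<Rightarrow> rvec \<Rightarrow> real" where
  "inner_rvec = rvec_dot"

definition norm_rvec :: "rvec \<Rightarrow> real" where
  "norm_rvec x = sqrt (x \<bullet> x)"

definition dist_rvec :: "rvec \<Rightarrow> rvec \<Rightarrow> real" where
  "dist_rvec x y = norm (x - y)"

definition sgn_rvec :: "rvec \<Rightarrow> rvec" where
  "sgn_rvec x = x /\<^sub>R norm x"

definition uniformity_rvec :: "(rvec \<times> rvec) filter" where
  "uniformity_rvec = (INF e\<in>{0<..}. principal {(x, y). dist x y < e})"

definition open_rvec :: "rvec set \<Rightarrow> bool" where
  "open_rvec U \<longleftrightarrow> (\<forall>x\<in>U. \<forall>\<^sub>F (x', y) in uniformity. x' = x \<longrightarrow> y \<in> U)"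

instance
proof
  fix x y z :: rvec and c :: real and U :: "rvec set"
  show "dist x y = norm (x - y)"
    by (simp add: dist_rvec_def)
  show "sgn x = x /\<^sub>R norm x"
    by (simp add: sgn_rvec_def)
  show "(uniformity :: (rvec \<times> rvec) filter) = (INF e\<in>{0<..}. principal {(x, y). dist x y < e})"
    by (simp add: uniformity_rvec_def)
  show "open U = (\<forall>x\<in>U. \<forall>\<^sub>F (x', y) in uniformity. x' = x \<longrightarrow> y \<in> U)"
    by (simp add: open_rvec_def)
  show "x \<bullet> y = y \<bullet> x"
    unfolding inner_rvec_def rvec_dot_def by (simp only: Int_commute mult.commute)
  define A where "A = support x \<union> support y \<union> support z"
  have fin: "finite A"
    by (simp add: A_def)
  have eq: "u \<bullet> v = (\<Sum>i\<in>A. coord u i * coord v i)" if "support v \<subseteq> A" for u v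
    unfolding inner_rvec_def using that fin by (intro rvec_dot_eq) auto
  have sub: "support x \<subseteq> A" "support y \<subseteq> A" "support z \<subseteq> A"
    by (auto simp: A_def)
  show "(x + y) \<bullet> z = x \<bullet> z + y \<bullet> z"
    unfolding eq[OF sub(3)] by (simp add: sum.distrib distrib_right)
  show "(c *\<^sub>R x) \<bullet> y = c * (x \<bullet> y)"
    unfolding eq[OF sub(2)] by (simp add: sum_distrib_left mult.assoc)
  show "0 \<le> x \<bullet> x"
    unfolding eq[OF sub(1)] by (simp add: sum_nonneg)
  show "(x \<bullet> x = 0) = (x = 0)"
  proof
    assume "x \<bullet> x = 0"
    then have "(\<Sum>i\<in>A. coord x i * coord x i) = 0"
      unfolding eq[OF sub(1)] .
    then have "\<forall>i\<in>A. coord x i = 0"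
      using fin by (subst (asm) sum_nonneg_eq_0_iff) simp_all
    then show "x = 0"
      using sub(1) by (intro rvec_eqI) (auto simp: support_def)
  next
    assume "x = 0"
    then show "x \<bullet> x = 0"
      unfolding eq[OF sub(1)] by simp
  qed
  show "norm x = sqrt (x \<bullet> x)"
    by (simp add: norm_rvec_def)
qed

end

definition Rn :: "nat \<Rightarrow> rvec set" where
  "Rn n = {x. support x \<subseteq> {..<n}}"

lemma Rn_iff: "x \<in> Rn n \<longleftrightarrow> (\<forall>i\<ge>n. coord x i = 0)"
  by (simp add: Rn_def support_def subset_iff) (metis not_le)

lemma subspace_Rn: "subspace (Rn n)"
  by (simp add: subspace_def Rn_iff)

lemma bij_betw_coord_Rn: "bij_betw coord (Rn n) {f. \<forall>i\<ge>n. f i = 0}"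
proof -
  have inv: "coord (Abs_rvec f) = f" if "\<forall>i\<ge>n. f i = 0" for f :: "nat \<Rightarrow> real"
  proof (rule Abs_rvec_inverse)
    have "{i. f i \<noteq> 0} \<subseteq> {..<n}"
      using that by (metis (mono_tags) lessThan_iff mem_Collect_eq not_le subsetI)
    then show "f \<in> {f. finite {i. f i \<noteq> 0}}"
      by (simp add: finite_subset)
  qed
  show ?thesis
    by (rule bij_betwI[where g = Abs_rvec]) (simp_all add: Rn_iff inv coord_inverse)
qed

lemma inner_Rn: "x \<in> Rn n \<Longrightarrow> x \<bullet> y = (\<Sum>i<n. coord x i * coord y i)"
  unfolding inner_rvec_def by (rule rvec_dot_eq) (auto simp: Rn_def)

lemma norm_Rn: "x \<in> Rn n \<Longrightarrow> norm x = sqrt (\<Sum>i<n. (coord x i)\<^sup>2)"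
  by (simp add: norm_rvec_def inner_Rn power2_eq_square)


section \<open>Convex analysis\<close>

definition strongly_convex_on :: "'a::real_inner set \<Rightarrow> real \<Rightarrow> ('a \<Rightarrow> real) \<Rightarrow> bool" where
  "strongly_convex_on A \<mu> f \<longleftrightarrow> convex A \<and>
     (\<forall>x\<in>A. \<forall>y\<in>A. \<forall>t\<in>{0..1}.
        f ((1 - t) *\<^sub>R x + t *\<^sub>R y)
          \<le> (1 - t) * f x + t * f y - \<mu> / 2 * t * (1 - t) * (norm (x - y))\<^sup>2)"

definition subgradients_on :: "nat \<Rightarrow> rvec set \<Rightarrow> (rvec \<Rightarrow> real) \<Rightarrow> rvec \<Rightarrow> rvec set" where
  "subgradients_on n A f x = {\<nu> \<in> Rn n. x \<in> A \<and> (\<forall>x'\<in>A. f x' \<ge> f x + \<nu> \<bullet> (x' - x))}"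

text \<open>
  A derivative within \<open>Rn m\<close> is not unique on all of \<open>rvec\<close>, but its representing vector in
  \<open>Rn m\<close> is; \<open>grad m f y\<close> is meaningful only where \<open>f\<close> is differentiable within \<open>Rn m\<close>.
\<close>

definition grad :: "nat \<Rightarrow> (rvec \<Rightarrow> real) \<Rightarrow> rvec \<Rightarrow> rvec" where
  "grad m f y = (THE G. G \<in> Rn m \<and> (f has_derivative (\<lambda>v. G \<bullet> v)) (at y within Rn m))"


section \<open>The saddle-point problem\<close>

definition outer_objective ::
  "nat \<Rightarrow> (rvec \<Rightarrow> real) \<Rightarrow> (rvec \<Rightarrow> rvec \<Rightarrow> real) \<Rightarrow> (rvec \<Rightarrow> real) \<Rightarrow> rvec \<Rightarrow> real" where
  "outer_objective m r F h x = r x + (SUP y\<in>Rn m. F x y - h y)"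

text \<open>
  \<open>F\<close> is a total function here, but only its values on the neighbourhood \<open>U\<close> matter. The sections
  of \<open>U\<close> need not be convex, so convexity in \<open>x\<close> and concavity in \<open>y\<close> are required on every convex
  subset of a section. Continuity of the outer objective (of \<open>r\<close>, equivalently) is what makes the
  outer minimum exist: a finite convex function on a compact convex set can be discontinuous, and
  even unbounded, at the boundary.
\<close>

locale saddle_problem =
  fixes n m :: nat
    and Qx :: "rvec set"
    and r :: "rvec \<Rightarrow> real" and F :: "rvec \<Rightarrow> rvec \<Rightarrow> real" and h :: "rvec \<Rightarrow> real"
    and \<mu>x \<mu>y Lyy :: real
  assumes dims: "n \<ge> 1" "m \<ge> 1"
    and Qx_subset: "Qx \<subseteq> Rn n"
    and Qx_convex: "convex Qx"
    and Qx_compact: "compact Qx"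
    and Qx_interior: "top_of_set (Rn n) interior_of Qx \<noteq> {}"
    and mu_pos: "\<mu>x > 0" "\<mu>y > 0"
    and r_strongly_convex: "strongly_convex_on Qx \<mu>x r"
    and h_continuous: "continuous_on (Rn m) h"
    and h_strongly_convex: "strongly_convex_on (Rn m) \<mu>y h"
    and F_neighbourhood:
      "\<exists>U. openin (top_of_set (Rn n \<times> Rn m)) U \<and> Qx \<times> Rn m \<subseteq> U \<and>
         (\<forall>y A. convex A \<and> A \<times> {y} \<subseteq> U \<longrightarrow> convex_on A (\<lambda>x. F x y)) \<and>
         (\<forall>x B. convex B \<and> {x} \<times> B \<subseteq> U \<longrightarrow> concave_on B (\<lambda>y. F x y)) \<and>
         (\<forall>(x, y)\<in>U. F x differentiable (at y within Rn m))"
    and F_grad_lipschitz: "\<And>x. x \<in> Qx \<Longrightarrow> Lyy-lipschitz_on (Rn m) (grad m (F x))"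
    and S_continuous: "continuous_on (Qx \<times> Rn m) (\<lambda>(x, y). F x y - h y)"
    and S_strongly_convex: "\<exists>\<mu>>0. \<forall>y\<in>Rn m. strongly_convex_on Qx \<mu> (\<lambda>x. F x y - h y)"
    and S_strongly_concave: "\<exists>\<mu>>0. \<forall>x\<in>Qx. strongly_convex_on (Rn m) \<mu> (\<lambda>y. - (F x y - h y))"
    and g_continuous: "continuous_on Qx (outer_objective m r F h)"

definition lipschitz_gradient :: "nat \<Rightarrow> real \<Rightarrow> (rvec \<Rightarrow> real) \<Rightarrow> bool" where
  "lipschitz_gradient m L f \<longleftrightarrow>
     (\<forall>y\<in>Rn m. f differentiable (at y within Rn m)) \<and> L-lipschitz_on (Rn m) (grad m f)"

definition exact_solution ::
  "nat \<Rightarrow> rvec set \<Rightarrow> (rvec \<Rightarrow> real) \<Rightarrow> (rvec \<Rightarrow> rvec \<Rightarrow> real) \<Rightarrow> (rvec \<Rightarrow> real)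
    \<Rightarrow> rvec \<Rightarrow> rvec \<Rightarrow> bool" where
  "exact_solution m Qx r F h x y \<longleftrightarrow>
     is_arg_min (outer_objective m r F h) (\<lambda>x. x \<in> Qx) x \<and>
     is_arg_max (\<lambda>y. F x y - h y) (\<lambda>y. y \<in> Rn m) y"

definition eps_solution ::
  "nat \<Rightarrow> rvec set \<Rightarrow> (rvec \<Rightarrow> real) \<Rightarrow> (rvec \<Rightarrow> rvec \<Rightarrow> real) \<Rightarrow> (rvec \<Rightarrow> real)
    \<Rightarrow> real \<Rightarrow> rvec \<Rightarrow> rvec \<Rightarrow> bool" where
  "eps_solution m Qx r F h \<epsilon> x y \<longleftrightarrow> x \<in> Qx \<and> y \<in> Rn m \<and>
     (\<exists>x' y'. exact_solution m Qx r F h x' y' \<and> max (norm (x - x')) (norm (y - y')) \<le> \<epsilon>)"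


section \<open>Black-box algorithms\<close>

text \<open>
  An algorithm sees \<open>r\<close>, \<open>F\<close> and \<open>h\<close> only through the answers to its queries; function values are
  not available. It is deterministic and adaptive: the next action is a function of the answers
  received so far (the queries themselves can be recomputed from these).
\<close>

datatype query =
    Sub_xF rvec rvec
  | Sub_r rvec
  | Grad_yF rvec rvec
  | Prox_h rvec real
  | Grad_h rvec

datatype query_kind = K_Sub_xF | K_Sub_r | K_Grad_yF | K_Prox_h | K_Grad_h

primrec kind :: "query \<Rightarrow> query_kind" where
  "kind (Sub_xF x y) = K_Sub_xF"
| "kind (Sub_r x) = K_Sub_r"
| "kind (Grad_yF x y) = K_Grad_yF"
| "kind (Prox_h c1 c2) = K_Prox_h"
| "kind (Grad_h y) = K_Grad_h"

datatype action = Ask query | Return rvec rvec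

type_synonym algorithm = "rvec list \<Rightarrow> action"

primrec correct_answers ::
  "nat \<Rightarrow> nat \<Rightarrow> rvec set \<Rightarrow> (rvec \<Rightarrow> real) \<Rightarrow> (rvec \<Rightarrow> rvec \<Rightarrow> real) \<Rightarrow> (rvec \<Rightarrow> real)
    \<Rightarrow> query \<Rightarrow> rvec set" where
  "correct_answers n m Qx r F h (Sub_xF x y) =
     (if y \<in> Rn m then subgradients_on n Qx (\<lambda>x. F x y) x else {})"
| "correct_answers n m Qx r F h (Sub_r x) = subgradients_on n Qx r x"
| "correct_answers n m Qx r F h (Grad_yF x y) =
     (if x \<in> Qx \<and> y \<in> Rn m then {grad m (F x) y} else {})"
| "correct_answers n m Qx r F h (Prox_h c1 c2) =
     (if c1 \<in> Rn m \<and> c2 > 0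
      then {y. is_arg_min (\<lambda>y. c1 \<bullet> y + h y + c2 * (norm y)\<^sup>2) (\<lambda>y. y \<in> Rn m) y} else {})"
| "correct_answers n m Qx r F h (Grad_h y) =
     (if y \<in> Rn m \<and> h differentiable (at y within Rn m) then {grad m h y} else {})"

text \<open>
  \<open>a\<close> is the sequence of answers. A query without a correct answer (for instance for a
  subgradient of \<open>r\<close> at a boundary point where there is none) may be answered by any vector, so
  that an algorithm gains nothing by asking it.
\<close>

definition answered_by :: "(query \<Rightarrow> rvec set) \<Rightarrow> algorithm \<Rightarrow> (nat \<Rightarrow> rvec) \<Rightarrow> bool" where
  "answered_by \<O> \<A> a \<longleftrightarrow>
     (\<forall>k q. \<A> (map a [0..<k]) = Ask q \<and> \<O> q \<noteq> {} \<longrightarrow> a k \<in> \<O> q)"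

definition attains_within ::
  "(query \<Rightarrow> rvec set) \<Rightarrow> algorithm \<Rightarrow> (rvec \<Rightarrow> rvec \<Rightarrow> bool) \<Rightarrow> (query_kind \<Rightarrow> real) \<Rightarrow> bool" where
  "attains_within \<O> \<A> good N \<longleftrightarrow>
     (\<forall>a. answered_by \<O> \<A> a \<longrightarrow>
        (\<exists>K x y. (\<forall>k<K. \<exists>q. \<A> (map a [0..<k]) = Ask q) \<and>
           \<A> (map a [0..<K]) = Return x y \<and> good x y \<and>
           (\<forall>\<kappa>. real (card {k. k < K \<and> (\<exists>q. \<A> (map a [0..<k]) = Ask q \<and> kind q = \<kappa>)}) \<le> N \<kappa>)))"

end

theory Submission
  imports Defs
begin

text \<open>
  Only queries are counted, so Vaidya's method can be replaced by the center-of-gravity method: each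
  query point is the centroid of what is left of \<open>Q\<^sub>x\<close>, and by log-concavity of volumes
  (Prekopa--Leindler) every cut through the centroid removes at least a tenth of it. A cut at
  \<open>x\<^sub>i\<close> is \<open>\<nu>\<^sub>i \<in> \<partial>(r + F(\<cdot>, y\<^sub>i))(x\<^sub>i)\<close> with \<open>y\<^sub>i\<close> nearly maximising \<open>S(x\<^sub>i, \<cdot>)\<close>. Once the volume has
  shrunk by more than \<open>\<theta>\<^sup>n\<close>, no \<open>z\<close> in \<open>Q\<^sub>x\<close> makes all \<open>\<langle>\<nu>\<^sub>i, x\<^sub>i - z\<rangle>\<close> large, and hence
  there are convex weights \<open>w\<close> with \<open>\<Sum> w\<^sub>i \<langle>\<nu>\<^sub>i, x\<^sub>i - z\<rangle> \<le> \<eta>\<close> for all \<open>z\<close>. Then \<open>(\<Sum> w\<^sub>i x\<^sub>i, \<Sum> w\<^sub>i y\<^sub>i)\<close>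
  is an approximate saddle point. This needs no function values and no modulus of continuity of \<open>g\<close>.
  The \<open>y\<^sub>i\<close> come from restarted accelerated gradient methods: with exact proximal steps in case (a), and
  with gradient sliding, which separates the numbers of gradients of \<open>F\<close> and \<open>h\<close>, in case (b).
\<close>

section \<open>Brunn--Minkowski and Prekopa--Leindler inequalities\<close>

text \<open>The algorithm is fixed before \<open>r\<close>, \<open>F\<close> and \<open>h\<close>
  and sees no function value, so it can neither pick its best query point nor estimate constants;
  its output must be good for a reason visible in the cuts alone. The weights are this reason. With
  xh and yh the weighted means and (xs, ys) the saddle point, Jensen in both variables turns the
  certificate into g(xh) \<le> r(xs) + S(xs, yh) + \<delta> + \<eta>. Quadratic growth of g at xs
  and of - S(xs, .) at ys makes this single inequality bound both distances. The weights exist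
  because z + \<theta> (Q - z) has more volume than the last localizer: some point z + \<theta> (w -
  z) of it was cut off, and a cut is affine, so its value at z is controlled by its value at w. The
  oscillation of g enters only there, multiplied by \<theta>, and an extra power of \<epsilon> in
  \<theta> beats it once \<epsilon> is small. All dimensions live in one infinite-dimensional,
  incomplete space, so compactness, separation and volume have to be established on the subspaces
  Rn.\<close>

lemma lborel_inner_compact:
  fixes A :: "real set"
  assumes A: "A \<in> sets borel" and r: "r < emeasure lborel A"
  obtains K where "compact K" "K \<subseteq> A" "r < emeasure lborel K"
proof -
  \<comment> \<open>The set may have infinite measure. Cutting it to [-N, N] gives a piece of finite
    measure that still exceeds \<open>r\<close>, and there closed inner approximation up to
    \<open>e'\<close> applies.\<close>
  define AN where "AN = (\<lambda>N::nat. A \<inter> {- real N..real N})"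
  have AN: "AN N \<in> sets lborel" for N
    using A by (simp add: AN_def)
  have "(\<Union>N. AN N) = A"
  proof -
    have "\<exists>N::nat. - real N \<le> x \<and> x \<le> real N" for x
      using real_arch_simple[of "\<bar>x\<bar>"] by (metis abs_le_iff minus_le_iff)
    then show ?thesis by (auto simp: AN_def)
  qed
  moreover have "(SUP N. emeasure lborel (AN N)) = emeasure lborel (\<Union>N. AN N)"
    using AN by (intro SUP_emeasure_incseq) (auto simp: AN_def incseq_def)
  ultimately have "r < (SUP N. emeasure lborel (AN N))"
    using r by simp
  then obtain N where N: "r < emeasure lborel (AN N)"
    by (auto simp: less_SUP_iff)
  have fin: "emeasure lborel (AN N) < \<infinity>"
  proof -
    have "emeasure lborel (AN N) \<le> emeasure lborel {- real N..real N}"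
      by (intro emeasure_mono) (auto simp: AN_def)
    also have "\<dots> < \<infinity>" by simp
    finally show ?thesis .
  qed
  obtain q where q: "r < q" "q < emeasure lborel (AN N)"
    using dense[OF N] by auto
  have "0 < emeasure lborel (AN N) - q"
    using q(2) by (simp add: diff_gr0_ennreal)
  then obtain w where w: "0 < w" "w < emeasure lborel (AN N) - q"
    using dense by blast
  then obtain e' where e': "w = ennreal e'" "0 \<le> e'"
    by (cases w) auto
  with w have e: "0 < ennreal e'" "ennreal e' < emeasure lborel (AN N) - q" "0 < e'"
    by auto
  have "AN N \<in> sets lebesgue"
    using AN by (simp add: AN_def)
  from sets_lebesgue_inner_closed[OF this e(3)] obtain T where
    T: "closed T" "T \<subseteq> AN N" "AN N - T \<in> lmeasurable" "emeasure lebesgue (AN N - T) < ennreal e'"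
    by blast
  have T': "T \<in> sets lborel" using T(1) by simp
  have "compact T"
    using T(1,2) by (metis AN_def Int_lower2 bounded_closed_interval bounded_subset compact_eq_bounded_closed subset_trans)
  moreover have "T \<subseteq> A" using T(2) by (auto simp: AN_def)
  moreover have "r < emeasure lborel T"
  proof -
    have d: "emeasure lborel (AN N - T) < ennreal e'"
      using T(4) AN[of N] T' by (simp add: emeasure_completion)
    have "emeasure lborel (AN N) = emeasure lborel T + emeasure lborel (AN N - T)"
      using T(2) AN[of N] T' by (subst plus_emeasure) (auto simp: Un_absorb1)
    also have "\<dots> \<le> emeasure lborel T + ennreal e'"
      using d by (intro add_left_mono) auto
    finally have 1: "emeasure lborel (AN N) \<le> emeasure lborel T + ennreal e'" .
    have "ennreal e' + q \<le> emeasure lborel (AN N)"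
      using e(2) q(2) by (metis add.commute add_left_mono diff_add_cancel_ennreal less_imp_le)
    with 1 have "ennreal e' + q \<le> ennreal e' + emeasure lborel T"
      by (metis add.commute order_trans)
    then have "q \<le> emeasure lborel T"
      by (simp add: ennreal_add_left_cancel_le)
    with q(1) show ?thesis by simp
  qed
  ultimately show ?thesis using that by blast
qed

text \<open>Averaging all of A with the least point of B, and all of B with the greatest point of A,
  gives half-size copies of A and B inside H. They meet in at most the point (a0 + b0) / 2, so their
  measures add up.\<close>

lemma Brunn_Minkowski_real_compact:
  fixes A B H :: "real set"
  assumes A: "compact A" "A \<noteq> {}" and B: "compact B" "B \<noteq> {}" and H: "H \<in> sets borel"
    and mid: "\<And>a b. a \<in> A \<Longrightarrow> b \<in> B \<Longrightarrow> (a + b) / 2 \<in> H"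
  shows "emeasure lborel A + emeasure lborel B \<le> 2 * emeasure lborel H"
proof -
  define a0 b0 where "a0 = Sup A" and "b0 = Inf B"
  have a0: "a0 \<in> A" "\<And>a. a \<in> A \<Longrightarrow> a \<le> a0"
    using A closed_contains_Sup[of A] cSup_upper[of _ A] bounded_imp_bdd_above[of A]
    by (auto simp: a0_def compact_eq_bounded_closed)
  have b0: "b0 \<in> B" "\<And>b. b \<in> B \<Longrightarrow> b0 \<le> b"
    using B closed_contains_Inf[of B] cInf_lower[of _ B] bounded_imp_bdd_below[of B]
    by (auto simp: b0_def compact_eq_bounded_closed)
  have Am: "A \<in> sets borel" and Bm: "B \<in> sets borel"
    using A B by (auto intro: borel_compact)
  have i1: "emeasure lborel (S::real set) = ennreal (1/2) * (\<integral>\<^sup>+x. indicator S (t + (1/2) * x) \<partial>lborel)"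
    if "S \<in> sets borel" for S t
    using nn_integral_real_affine[of "indicator S" "1/2" t] that by simp
  define C where "C = {x. 2 * x - b0 \<in> A}"
  define D where "D = {x. 2 * x - a0 \<in> B}"
  have Cm: "C \<in> sets borel"
    unfolding C_def using Am by measurable
  have Dm: "D \<in> sets borel"
    unfolding D_def using Bm by measurable
  have eC: "2 * emeasure lborel C = emeasure lborel A"
  proof -
    have "emeasure lborel C = ennreal (1/2) * (\<integral>\<^sup>+x. indicator A x \<partial>lborel)"
      unfolding i1[OF Cm, of "b0/2"]
      by (intro arg_cong[where f="\<lambda>x. _ * x"] nn_integral_cong) (auto simp: C_def split: split_indicator)
    moreover have "2 * ennreal (1/2) = 1"
      by (metis ennreal_1 ennreal_mult ennreal_numeral mult_2 field_sum_of_halves zero_le_numeral zero_le_divide_1_iff)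
    ultimately show ?thesis using Am by (simp flip: mult.assoc)
  qed
  have eD: "2 * emeasure lborel D = emeasure lborel B"
  proof -
    have "emeasure lborel D = ennreal (1/2) * (\<integral>\<^sup>+x. indicator B x \<partial>lborel)"
      unfolding i1[OF Dm, of "a0/2"]
      by (intro arg_cong[where f="\<lambda>x. _ * x"] nn_integral_cong) (auto simp: D_def split: split_indicator)
    moreover have "2 * ennreal (1/2) = 1"
      by (metis ennreal_1 ennreal_mult ennreal_numeral mult_2 field_sum_of_halves zero_le_numeral zero_le_divide_1_iff)
    ultimately show ?thesis using Bm by (simp flip: mult.assoc)
  qed
  have CH: "C \<subseteq> H" using mid[OF _ b0(1)] by (force simp: C_def)
  have DH: "D \<subseteq> H" using mid[OF a0(1)] by (force simp: D_def)
  have CD: "C \<inter> D \<subseteq> {(a0 + b0) / 2}"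
  proof
    fix x assume x: "x \<in> C \<inter> D"
    then have "2 * x - b0 \<le> a0" "b0 \<le> 2 * x - a0"
      using a0(2) b0(2) by (auto simp: C_def D_def)
    then show "x \<in> {(a0 + b0) / 2}" by auto
  qed
  have "emeasure lborel C + emeasure lborel D = emeasure lborel (C \<union> D) + emeasure lborel (C \<inter> D)"
    using Cm Dm by (intro emeasure_Un_Int) auto
  moreover have "emeasure lborel (C \<inter> D) = 0"
    using emeasure_mono[OF CD, of lborel] by simp
  moreover have "emeasure lborel (C \<union> D) \<le> emeasure lborel H"
    using CH DH H by (intro emeasure_mono) auto
  ultimately have "emeasure lborel C + emeasure lborel D \<le> emeasure lborel H" by simp
  then have "2 * (emeasure lborel C + emeasure lborel D) \<le> 2 * emeasure lborel H"
    by (rule mult_left_mono) simp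
  then show ?thesis by (simp add: eC eD distrib_left)
qed

text \<open>Inner approximation by compact sets reduces this to the compact case. Nonemptiness is
  essential: for empty A there are no midpoints and H could be null.\<close>

lemma Brunn_Minkowski_real:
  fixes A B H :: "real set"
  assumes A: "A \<in> sets borel" "A \<noteq> {}" and B: "B \<in> sets borel" "B \<noteq> {}" and H: "H \<in> sets borel"
    and mid: "\<And>a b. a \<in> A \<Longrightarrow> b \<in> B \<Longrightarrow> (a + b) / 2 \<in> H"
  shows "emeasure lborel A + emeasure lborel B \<le> 2 * emeasure lborel H"
proof -
  \<comment> \<open>The alternative \<open>r = 0\<close> serves a nonempty null set, which has no
    value below its measure; a single point is then the required compact subset.\<close>
  have *: "\<exists>K. compact K \<and> K \<noteq> {} \<and> K \<subseteq> S \<and> r \<le> emeasure lborel K"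
    if "S \<in> sets borel" "S \<noteq> {}" "r < emeasure lborel S \<or> r = 0" for S :: "real set" and r
  proof (cases "r < emeasure lborel S")
    case True
    from lborel_inner_compact[OF that(1) this] obtain K
      where "compact K" "K \<subseteq> S" "r < emeasure lborel K" .
    moreover from this have "K \<noteq> {}" by auto
    ultimately show ?thesis by (auto intro: less_imp_le)
  next
    case False
    with that obtain x where "x \<in> S" "r = 0" by auto
    then show ?thesis by (intro exI[of _ "{x}"]) auto
  qed
  have "r + s \<le> 2 * emeasure lborel H"
    if rs: "r < emeasure lborel A \<or> r = 0" "s < emeasure lborel B \<or> s = 0" for r s
  proof -
    obtain K L where "compact K" "K \<noteq> {}" "K \<subseteq> A" "r \<le> emeasure lborel K"
      "compact L" "L \<noteq> {}" "L \<subseteq> B" "s \<le> emeasure lborel L"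
      using *[OF A rs(1)] *[OF B rs(2)] by blast
    moreover from this have "emeasure lborel K + emeasure lborel L \<le> 2 * emeasure lborel H"
      using mid by (intro Brunn_Minkowski_real_compact H) auto
    ultimately show ?thesis by (meson add_mono order_trans)
  qed note ** = this
  have approx: "b = (SUP s\<in>{s. s < b \<or> s = 0}. s)" for b :: ennreal
  proof (rule antisym)
    show "b \<le> (SUP s\<in>{s. s < b \<or> s = 0}. s)"
      by (rule dense_le) (auto intro: Sup_upper)
  qed (auto intro!: Sup_least)
  have ***: "r + emeasure lborel B \<le> 2 * emeasure lborel H" if "r < emeasure lborel A \<or> r = 0" for r
  proof -
    have "emeasure lborel B = (SUP s\<in>{s. s < emeasure lborel B \<or> s = 0}. s)"
      by (rule approx)
    moreover have "r + (SUP s\<in>{s. s < emeasure lborel B \<or> s = 0}. s) =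
       (SUP s\<in>{s. s < emeasure lborel B \<or> s = 0}. r + s)"
      by (rule ennreal_SUP_add_right) auto
    ultimately show ?thesis using **[OF that] by (metis (mono_tags, lifting) SUP_least mem_Collect_eq)
  qed
  have "emeasure lborel A = (SUP s\<in>{s. s < emeasure lborel A \<or> s = 0}. s)"
    by (rule approx)
  moreover have "(SUP s\<in>{s. s < emeasure lborel A \<or> s = 0}. s) + emeasure lborel B =
     (SUP s\<in>{s. s < emeasure lborel A \<or> s = 0}. s + emeasure lborel B)"
    by (rule ennreal_SUP_add_left[symmetric]) auto
  ultimately show ?thesis using *** by (metis (mono_tags, lifting) SUP_least mem_Collect_eq)
qed

text \<open>The layer-cake formula with levels measured as fractions \<open>t\<close> of the cap
  \<open>c\<close>. Functions with different suprema can then be compared level by level over the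
  same range of \<open>t\<close>.\<close>

lemma nn_integral_min_const_layer_cake:
  fixes f :: "real \<Rightarrow> ennreal"
  assumes [measurable]: "f \<in> borel_measurable borel" and c: "0 < c"
  shows "(\<integral>\<^sup>+x. min (f x) (ennreal c) \<partial>lborel) =
    ennreal c * (\<integral>\<^sup>+t. indicator {0<..<1} t * emeasure lborel {x. ennreal (t * c) < f x} \<partial>lborel)"
proof -
  define S where "S = (\<lambda>t x. indicator {0<..<1} t * indicator {x. ennreal (t * c) < f x} x :: ennreal)"
  have [measurable]: "(\<lambda>(t, x). S t x) \<in> borel_measurable (lborel \<Otimes>\<^sub>M lborel)"
    unfolding S_def by measurable
  have pt: "min (f x) (ennreal c) = ennreal c * (\<integral>\<^sup>+t. S t x \<partial>lborel)" for x
  proof (cases "ennreal c \<le> f x")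
    case True
    have "ennreal (t * c) < f x" if "0 < t" "t < 1" for t
    proof -
      have "ennreal (t * c) < ennreal c" using that c by (intro ennreal_lessI) auto
      with True show ?thesis by simp
    qed
    then have "S t x = indicator {0<..<1} t" for t
      by (auto simp: S_def split: split_indicator)
    then show ?thesis using True by (simp add: min_absorb2)
  next
    case False
    then obtain y where y: "f x = ennreal y" "0 \<le> y" "y < c"
      by (cases "f x") (auto simp: not_le ennreal_less_iff)
    have "S t x = indicator {0<..<y / c} t" for t
    proof -
      have "t < 1" if "t * c < y"
        using that y c by (metis less_trans mult_less_cancel_right_pos mult_1)
      then show ?thesis
        using y c by (auto simp: S_def ennreal_less_iff pos_less_divide_eq split: split_indicator)
    qed
    then have "(\<integral>\<^sup>+t. S t x \<partial>lborel) = ennreal (y / c)"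
      using y c by simp
    moreover have "min (f x) (ennreal c) = ennreal y"
      using y by (simp add: min_absorb1)
    ultimately show ?thesis
      using y c by (simp flip: ennreal_mult)
  qed
  have "(\<integral>\<^sup>+x. min (f x) (ennreal c) \<partial>lborel) = ennreal c * (\<integral>\<^sup>+x. (\<integral>\<^sup>+t. S t x \<partial>lborel) \<partial>lborel)"
    unfolding pt by (rule nn_integral_cmult) measurable
  also have "(\<integral>\<^sup>+x. (\<integral>\<^sup>+t. S t x \<partial>lborel) \<partial>lborel) = (\<integral>\<^sup>+t. (\<integral>\<^sup>+x. S t x \<partial>lborel) \<partial>lborel)"
    by (rule lborel_pair.Fubini') measurable
  also have "\<dots> = (\<integral>\<^sup>+t. indicator {0<..<1} t * emeasure lborel {x. ennreal (t * c) < f x} \<partial>lborel)"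
    unfolding S_def by (intro nn_integral_cong) (simp add: nn_integral_cmult)
  finally show ?thesis .
qed

lemma ennreal_four_mult_le_square_add: "4 * (a * b) \<le> (a + b)\<^sup>2" for a b :: ennreal
proof (cases a; cases b)
  fix x y assume "0 \<le> x" "a = ennreal x" "0 \<le> y" "b = ennreal y"
  moreover have "4 * (x * y) \<le> (x + y)\<^sup>2"
    using sum_squares_bound[of x y] by (simp add: power2_sum)
  then have "ennreal (4 * (x * y)) \<le> ennreal ((x + y)\<^sup>2)"
    by (rule ennreal_leI)
  ultimately show ?thesis
    by (simp add: ennreal_mult ennreal_power flip: ennreal_plus)
qed (auto simp: power2_eq_square ennreal_mult_top ennreal_top_mult)

lemma ennreal_mult_strict_mono':
  fixes a b c d :: ennreal
  assumes "a < c" "b < d"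
  shows "a * b < c * d"
proof -
  have ab: "a < top" "b < top"
    using assms by (auto intro: less_le_trans)
  show ?thesis
  proof (cases "c = top \<or> d = top")
    case True
    then have "c * d = top"
      using assms by (auto simp: ennreal_mult_top ennreal_top_mult)
    then show ?thesis using ab by (simp add: ennreal_mult_less_top)
  next
    case False
    then obtain w x y z where "a = ennreal w" "b = ennreal x" "c = ennreal y" "d = ennreal z"
      "0 \<le> w" "0 \<le> x" "0 \<le> y" "0 \<le> z"
      using ab by (metis ennreal_cases less_irrefl)
    then show ?thesis
      using assms by (simp add: ennreal_less_iff mult_strict_mono' flip: ennreal_mult)
  qed
qed

text \<open>At each relative height t < 1 the superlevel sets of f and g at t F and t G are nonempty
  and average into that of h at t sqrt (F G). Brunn--Minkowski holds at each height; integrating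
  over t and using a b \<le> ((a + b) / 2)^2 gives the product form.\<close>

lemma Prekopa_Leindler_real_bounded:
  fixes f g h :: "real \<Rightarrow> ennreal"
  assumes [measurable]: "f \<in> borel_measurable borel" "g \<in> borel_measurable borel" "h \<in> borel_measurable borel"
    and le: "\<And>x y. f x * g y \<le> (h ((x + y) / 2))\<^sup>2"
    and bnd: "(SUP x. f x) < \<infinity>" "(SUP x. g x) < \<infinity>"
  shows "(\<integral>\<^sup>+x. f x \<partial>lborel) * (\<integral>\<^sup>+x. g x \<partial>lborel) \<le> (\<integral>\<^sup>+x. h x \<partial>lborel)\<^sup>2"
proof (cases "(SUP x. f x) = 0 \<or> (SUP x. g x) = 0")
  case True
  then have "(\<forall>x. f x = 0) \<or> (\<forall>x. g x = 0)"
    by (simp add: SUP_eq_iff bot_ennreal[symmetric])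
  then show ?thesis by auto
next
  case False
  obtain F where F: "(SUP x. f x) = ennreal F" "0 < F"
    using False bnd by (cases "SUP x. f x") auto
  obtain G where G: "(SUP x. g x) = ennreal G" "0 < G"
    using False bnd by (cases "SUP x. g x") auto
  define R where "R = sqrt (F * G)"
  have R: "0 < R" "R\<^sup>2 = F * G"
    using F G by (auto simp: R_def)
  define \<alpha> where "\<alpha> = (\<lambda>t. emeasure lborel {x. ennreal (t * F) < f x})"
  define \<beta> where "\<beta> = (\<lambda>t. emeasure lborel {x. ennreal (t * G) < g x})"
  define \<omega> where "\<omega> = (\<lambda>t. emeasure lborel {x. ennreal (t * R) < h x})"
  have [measurable]: "\<alpha> \<in> borel_measurable borel" "\<beta> \<in> borel_measurable borel" "\<omega> \<in> borel_measurable borel"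
    unfolding \<alpha>_def \<beta>_def \<omega>_def by measurable
  have level: "\<alpha> t + \<beta> t \<le> 2 * \<omega> t" if t: "0 < t" "t < 1" for t
    unfolding \<alpha>_def \<beta>_def \<omega>_def
  proof (rule Brunn_Minkowski_real)
    have "ennreal (t * F) < (SUP x. f x)" "ennreal (t * G) < (SUP x. g x)"
      using F G t by (auto intro!: ennreal_lessI)
    then show "{x. ennreal (t * F) < f x} \<noteq> {}" "{x. ennreal (t * G) < g x} \<noteq> {}"
      by (auto simp: less_SUP_iff)
  next
    fix x y assume xy: "x \<in> {x. ennreal (t * F) < f x}" "y \<in> {x. ennreal (t * G) < g x}"
    have "ennreal ((t * R)\<^sup>2) = ennreal (t * F) * ennreal (t * G)"
      using t F G R by (simp add: power_mult_distrib ennreal_mult[symmetric] mult_ac power2_eq_square)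
    also have "\<dots> < f x * g y"
      using xy by (intro ennreal_mult_strict_mono') auto
    also have "\<dots> \<le> (h ((x + y) / 2))\<^sup>2" by (rule le)
    finally have "(ennreal (t * R))\<^sup>2 < (h ((x + y) / 2))\<^sup>2"
      using t R by (simp add: ennreal_power)
    then show "(x + y) / 2 \<in> {x. ennreal (t * R) < h x}"
      by (simp add: power_mono not_le[symmetric]) (meson not_le power_mono zero_le)
  qed measurable
  have *: "(\<integral>\<^sup>+x. f x \<partial>lborel) = ennreal F * (\<integral>\<^sup>+t. indicator {0<..<1} t * \<alpha> t \<partial>lborel)"
  proof -
    have "f x \<le> ennreal F" for x unfolding F(1)[symmetric] by (rule SUP_upper) simp
    then show ?thesis
      using nn_integral_min_const_layer_cake[of f F] F by (simp add: \<alpha>_def min_absorb1)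
  qed
  have **: "(\<integral>\<^sup>+x. g x \<partial>lborel) = ennreal G * (\<integral>\<^sup>+t. indicator {0<..<1} t * \<beta> t \<partial>lborel)"
  proof -
    have "g x \<le> ennreal G" for x unfolding G(1)[symmetric] by (rule SUP_upper) simp
    then show ?thesis
      using nn_integral_min_const_layer_cake[of g G] G by (simp add: \<beta>_def min_absorb1)
  qed
  have ***: "ennreal R * (\<integral>\<^sup>+t. indicator {0<..<1} t * \<omega> t \<partial>lborel) \<le> (\<integral>\<^sup>+x. h x \<partial>lborel)"
    using nn_integral_min_const_layer_cake[of h R] R unfolding \<omega>_def
    by (metis (no_types, lifting) assms(3) min.cobounded1 nn_integral_mono)
  define a where "a = (\<integral>\<^sup>+t. indicator {0<..<1} t * \<alpha> t \<partial>lborel)"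
  define b where "b = (\<integral>\<^sup>+t. indicator {0<..<1} t * \<beta> t \<partial>lborel)"
  define c where "c = (\<integral>\<^sup>+t. indicator {0<..<1} t * \<omega> t \<partial>lborel)"
  have "a + b = (\<integral>\<^sup>+t. indicator {0<..<1} t * (\<alpha> t + \<beta> t) \<partial>lborel)"
    unfolding a_def b_def by (subst nn_integral_add[symmetric]) (auto simp: distrib_left)
  also have "\<dots> \<le> (\<integral>\<^sup>+t. 2 * (indicator {0<..<1} t * \<omega> t) \<partial>lborel)"
    using level by (intro nn_integral_mono) (auto split: split_indicator)
  also have "\<dots> = 2 * c"
    unfolding c_def by (rule nn_integral_cmult) measurable
  finally have ab: "a + b \<le> 2 * c" .
  have "4 * (a * b) \<le> (a + b)\<^sup>2" by (rule ennreal_four_mult_le_square_add)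
  also have "\<dots> \<le> (2 * c)\<^sup>2" using ab by (rule power_mono) simp
  also have "\<dots> = 4 * c\<^sup>2" by (simp add: power_mult_distrib)
  finally have abc: "a * b \<le> c\<^sup>2" by (subst (asm) ennreal_mult_le_mult_iff) auto
  have "(\<integral>\<^sup>+x. f x \<partial>lborel) * (\<integral>\<^sup>+x. g x \<partial>lborel) = ennreal (F * G) * (a * b)"
    unfolding * ** a_def b_def using F G by (simp add: ennreal_mult mult_ac)
  also have "\<dots> \<le> ennreal (F * G) * c\<^sup>2"
    using abc by (rule mult_left_mono) simp
  also have "\<dots> = (ennreal R * c)\<^sup>2"
    using R by (simp add: power_mult_distrib ennreal_power)
  also have "\<dots> \<le> (\<integral>\<^sup>+x. h x \<partial>lborel)\<^sup>2"
    using *** unfolding c_def by (rule power_mono) simp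
  finally show ?thesis .
qed

text \<open>Truncating f and g only decreases the left side of the hypothesis, so the bounded case
  applies to all truncations and monotone convergence removes them.\<close>

lemma Prekopa_Leindler_real:
  fixes f g h :: "real \<Rightarrow> ennreal"
  assumes [measurable]: "f \<in> borel_measurable borel" "g \<in> borel_measurable borel" "h \<in> borel_measurable borel"
    and le: "\<And>x y. f x * g y \<le> (h ((x + y) / 2))\<^sup>2"
  shows "(\<integral>\<^sup>+x. f x \<partial>lborel) * (\<integral>\<^sup>+x. g x \<partial>lborel) \<le> (\<integral>\<^sup>+x. h x \<partial>lborel)\<^sup>2"
proof -
  have trunc: "(\<integral>\<^sup>+x. u x \<partial>lborel) = (SUP N::nat. \<integral>\<^sup>+x. min (u x) (of_nat N) \<partial>lborel)"
    if [measurable]: "u \<in> borel_measurable borel" for u :: "real \<Rightarrow> ennreal"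
  proof -
    have "u x = (SUP N::nat. min (u x) (of_nat N))" for x
      using inf_SUP[of "u x" "of_nat :: nat \<Rightarrow> ennreal" UNIV]
      by (simp add: inf_min ennreal_SUP_of_nat_eq_top)
    then have "(\<integral>\<^sup>+x. u x \<partial>lborel) = (\<integral>\<^sup>+x. (SUP N::nat. min (u x) (of_nat N)) \<partial>lborel)"
      by simp
    also have "\<dots> = (SUP N::nat. \<integral>\<^sup>+x. min (u x) (of_nat N) \<partial>lborel)"
    proof (rule nn_integral_monotone_convergence_SUP)
      have "min (u x) (of_nat M) \<le> min (u x) (of_nat N)" if "M \<le> N" for x and M N :: nat
        by (rule min.mono) (use that in auto)
      then show "incseq (\<lambda>N x. min (u x) (of_nat N :: ennreal))"
        by (simp add: incseq_def le_fun_def)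
    qed measurable
    finally show ?thesis .
  qed
  have fin: "(SUP x. min (u x) (of_nat N)) < \<infinity>" for u :: "real \<Rightarrow> ennreal" and N
  proof -
    have "(SUP x. min (u x) (of_nat N)) \<le> of_nat N" by (rule SUP_least) simp
    also have "\<dots> < \<infinity>" by (simp add: of_nat_less_top)
    finally show ?thesis .
  qed
  have "(\<integral>\<^sup>+x. min (f x) (of_nat M) \<partial>lborel) * (\<integral>\<^sup>+x. min (g x) (of_nat N) \<partial>lborel)
      \<le> (\<integral>\<^sup>+x. h x \<partial>lborel)\<^sup>2" for M N :: nat
    by (rule Prekopa_Leindler_real_bounded[OF _ _ _ _ fin fin])
       (auto intro!: order_trans[OF mult_mono le])
  then show ?thesis
    unfolding trunc[OF assms(1)] trunc[OF assms(2)] SUP_mult_left_ennreal SUP_mult_right_ennreal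
    by (intro SUP_least)
qed

text \<open>Tensorisation: integrating out coordinate i leaves marginals over I that again satisfy
  the hypothesis, by the one-dimensional inequality on the fibres over x, x' and their midpoint.
  Only extensional functions are points of the product space, so nothing is asked elsewhere.\<close>

lemma Prekopa_Leindler_PiM:
  fixes f g h :: "('i \<Rightarrow> real) \<Rightarrow> ennreal"
  assumes "finite I"
    and "f \<in> borel_measurable (PiM I (\<lambda>_. lborel))" "g \<in> borel_measurable (PiM I (\<lambda>_. lborel))"
      "h \<in> borel_measurable (PiM I (\<lambda>_. lborel))"
    and "\<And>x y. x \<in> extensional I \<Longrightarrow> y \<in> extensional I \<Longrightarrow> f x * g y \<le> (h (\<lambda>i\<in>I. (x i + y i) / 2))\<^sup>2"
  shows "(\<integral>\<^sup>+x. f x \<partial>PiM I (\<lambda>_. lborel)) * (\<integral>\<^sup>+x. g x \<partial>PiM I (\<lambda>_. lborel))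
    \<le> (\<integral>\<^sup>+x. h x \<partial>PiM I (\<lambda>_. lborel))\<^sup>2"
  using assms
proof (induction I arbitrary: f g h rule: finite_induct)
  case empty
  then show ?case
    using empty(4)[of "\<lambda>_. undefined" "\<lambda>_. undefined"]
    by (simp add: nn_integral_count_space_finite PiM_empty)
next
  case (insert i I)
  interpret product_sigma_finite "\<lambda>_::'i. lborel :: real measure" by standard
  note [measurable] = insert.prems(1-3)
  have up: "(\<lambda>y. u (x(i := y))) \<in> borel_measurable borel"
    if "u \<in> borel_measurable (PiM (insert i I) (\<lambda>_. lborel))" "x \<in> extensional I" for u :: "('i \<Rightarrow> real) \<Rightarrow> ennreal" and x
  proof -
    have "x \<in> space (PiM I (\<lambda>_. lborel :: real measure))"
      using that(2) by (simp add: space_PiM PiE_def)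
    from measurable_comp[OF measurable_component_update[OF this insert.hyps(2)] that(1)]
    show ?thesis by (simp add: comp_def)
  qed
  have marg: "(\<lambda>x. \<integral>\<^sup>+y. u (x(i := y)) \<partial>lborel) \<in> borel_measurable (PiM I (\<lambda>_. lborel))"
    if [measurable]: "u \<in> borel_measurable (PiM (insert i I) (\<lambda>_. lborel))" for u :: "_ \<Rightarrow> ennreal"
    by measurable
  show ?case
    unfolding insert.prems(1-3)[THEN product_nn_integral_insert[OF insert.hyps(1,2)]]
  proof (rule insert.IH)
    fix x x' :: "'i \<Rightarrow> real" assume x: "x \<in> extensional I" "x' \<in> extensional I"
    define m where "m = (\<lambda>j\<in>I. (x j + x' j) / 2)"
    have m: "m \<in> extensional I" by (simp add: m_def)
    have "f (x(i := y)) * g (x'(i := y')) \<le> (h (m(i := (y + y') / 2)))\<^sup>2" for y y'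
    proof -
      have "m(i := (y + y') / 2) = (\<lambda>j\<in>insert i I. ((x(i := y)) j + (x'(i := y')) j) / 2)"
        using insert.hyps by (auto simp: m_def fun_eq_iff)
      moreover have "x(i := y) \<in> extensional (insert i I)" "x'(i := y') \<in> extensional (insert i I)"
        using x by (auto simp: extensional_def)
      ultimately show ?thesis
        using insert.prems(4)[of "x(i := y)" "x'(i := y')"] by (simp only:)
    qed
    then show "(\<integral>\<^sup>+y. f (x(i := y)) \<partial>lborel) * (\<integral>\<^sup>+y. g (x'(i := y)) \<partial>lborel)
        \<le> (\<integral>\<^sup>+y. h ((\<lambda>j\<in>I. (x j + x' j) / 2)(i := y)) \<partial>lborel)\<^sup>2"
      unfolding m_def[symmetric]
      by (intro Prekopa_Leindler_real up insert.prems x m)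
  qed (intro marg insert.prems)+
qed

section \<open>Geometry and Lebesgue measure of the spaces Rn\<close>

definition ev :: "nat \<Rightarrow> rvec" where
  "ev i = Abs_rvec (\<lambda>j. if j = i then 1 else 0)"

lemma coord_ev [simp]: "coord (ev i) j = (if j = i then 1 else 0)"
  unfolding ev_def by (subst Abs_rvec_inverse) auto

lemma ev_in_Rn: "i < n \<Longrightarrow> ev i \<in> Rn n"
  by (auto simp: Rn_iff)

lemma inner_ev: "x \<bullet> ev i = coord x i"
proof -
  have "x \<bullet> ev i = rvec_dot x (ev i)" by (simp add: inner_rvec_def)
  also have "\<dots> = (\<Sum>j\<in>{i}. coord x j * coord (ev i) j)"
    by (rule rvec_dot_eq) (auto simp: support_def)
  finally show ?thesis by simp
qed

lemma norm_ev [simp]: "norm (ev i) = 1"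
  by (simp add: norm_eq_sqrt_inner inner_ev)

lemma abs_coord_le_norm: "\<bar>coord x i\<bar> \<le> norm x"
  using Cauchy_Schwarz_ineq2[of x "ev i"] by (simp add: inner_ev)

lemma coord_sum [simp]: "coord (sum f A) i = (\<Sum>a\<in>A. coord (f a) i)"
  by (induction A rule: infinite_finite_induct) auto

lemma continuous_on_coord [continuous_intros]:
  "continuous_on S f \<Longrightarrow> continuous_on S (\<lambda>x. coord (f x) i)"
  unfolding inner_ev[symmetric] by (intro continuous_intros)

definition rvec_of :: "nat \<Rightarrow> (nat \<Rightarrow> real) \<Rightarrow> rvec" where
  "rvec_of n f = (\<Sum>i<n. f i *\<^sub>R ev i)"

lemma coord_rvec_of [simp]: "coord (rvec_of n f) i = (if i < n then f i else 0)"
  by (simp add: rvec_of_def if_distrib[of "\<lambda>x. _ * x"] cong: if_cong)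

lemma rvec_of_in_Rn [simp]: "rvec_of n f \<in> Rn n"
  by (simp add: Rn_iff)

lemma rvec_of_coord: "x \<in> Rn n \<Longrightarrow> rvec_of n (coord x) = x"
  by (intro rvec_eqI) (auto simp: Rn_iff)

lemmas Rn_closed [simp] =
  subspace_0[OF subspace_Rn] subspace_add[OF subspace_Rn] subspace_diff[OF subspace_Rn]
  subspace_scale[OF subspace_Rn] subspace_neg[OF subspace_Rn]

lemma Rn_sum [simp]: "(\<And>i. i \<in> A \<Longrightarrow> f i \<in> Rn n) \<Longrightarrow> sum f A \<in> Rn n"
  using subspace_sum[OF subspace_Rn] by blast

lemma convex_Rn [simp]: "convex (Rn n)"
  by (rule subspace_imp_convex[OF subspace_Rn])

lemma closed_Rn [simp]: "closed (Rn n)"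
proof -
  have "Rn n = (\<Inter>i\<in>{n..}. {x. coord x i = 0})"
    by (auto simp: Rn_iff)
  then show ?thesis
    by (auto intro!: closed_INT closed_Collect_eq continuous_intros)
qed

lemma Rn_mono: "x \<in> Rn n \<Longrightarrow> n \<le> k \<Longrightarrow> x \<in> Rn k"
  by (auto simp: Rn_iff)

text \<open>The whole type is infinite-dimensional and its closed balls of positive radius are not
  compact. Compactness is therefore built one dimension at a time: a box is the continuous image of
  a lower box times an interval.\<close>

lemma compact_box_Rn: "compact {x \<in> Rn n. \<forall>i<n. \<bar>coord x i\<bar> \<le> b}"
proof (induction n)
  case 0
  have "{x \<in> Rn 0. \<forall>i<0. \<bar>coord x i\<bar> \<le> b} = {0}"
    by (auto simp: Rn_iff intro: rvec_eqI)
  then show ?case by simp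
next
  case (Suc n)
  let ?B = "\<lambda>n. {x \<in> Rn n. \<forall>i<n. \<bar>coord x i\<bar> \<le> b}"
  have "?B (Suc n) \<subseteq> (\<lambda>(x, t). x + t *\<^sub>R ev n) ` (?B n \<times> {-b..b})"
  proof
    fix x assume x: "x \<in> ?B (Suc n)"
    have "x = rvec_of n (coord x) + coord x n *\<^sub>R ev n"
      using x by (intro rvec_eqI) (auto simp: Rn_iff not_less less_Suc_eq)
    moreover have "rvec_of n (coord x) \<in> ?B n" "coord x n \<in> {-b..b}"
      using x by (auto simp: abs_le_iff)
    ultimately show "x \<in> (\<lambda>(x, t). x + t *\<^sub>R ev n) ` (?B n \<times> {-b..b})"
      by (intro rev_image_eqI[of "(rvec_of n (coord x), coord x n)"] SigmaI) (simp_all only: prod.case)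
  qed
  moreover have "(\<lambda>(x, t). x + t *\<^sub>R ev n) ` (?B n \<times> {-b..b}) \<subseteq> ?B (Suc n)"
    by (auto simp: Rn_iff less_Suc_eq abs_le_iff)
  ultimately have eq: "?B (Suc n) = (\<lambda>(x, t). x + t *\<^sub>R ev n) ` (?B n \<times> {-b..b})"
    by blast
  have "continuous_on (?B n \<times> {-b..b}) (\<lambda>(x, t). x + t *\<^sub>R ev n)"
    unfolding case_prod_beta by (intro continuous_intros)
  from compact_continuous_image[OF this compact_Times[OF Suc compact_Icc]]
  show ?case by (simp only: eq)
qed

lemma compact_Rn:
  assumes "closed S" "bounded S" "S \<subseteq> Rn n"
  shows "compact S"
proof -
  obtain b where b: "\<And>x. x \<in> S \<Longrightarrow> norm x \<le> b"
    using assms(2) by (auto simp: bounded_iff)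
  then have "S \<inter> {x \<in> Rn n. \<forall>i<n. \<bar>coord x i\<bar> \<le> b} = S"
    using assms(3) abs_coord_le_norm order_trans by blast
  then show ?thesis
    using closed_Int_compact[OF assms(1) compact_box_Rn, of n b] by (simp only:)
qed

text \<open>The point of S nearest to 0 is itself a normal vector. A normal taken from S stays in Rn
  whenever S does.\<close>

lemma separating_hyperplane_compact_0:
  fixes S :: "'a::real_inner set"
  assumes "convex S" "compact S" "0 \<notin> S" "S \<noteq> {}"
  shows "\<exists>a\<in>S. \<forall>x\<in>S. 0 < a \<bullet> x"
proof -
  obtain a where a: "a \<in> S" "\<And>x. x \<in> S \<Longrightarrow> dist 0 a \<le> dist 0 x"
    using continuous_attains_inf[OF assms(2,4), of "dist 0"] by (auto intro: continuous_intros)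
  have "0 < a \<bullet> x" if "x \<in> S" for x
  proof -
    have "(0 - a) \<bullet> (x - a) \<le> 0"
      using a that assms by (intro any_closest_point_dot[of S]) (auto simp: compact_imp_closed)
    moreover have "0 < a \<bullet> a" using a assms by auto
    ultimately show ?thesis by (simp add: inner_diff_right del: inner_gt_zero_iff)
  qed
  with a show ?thesis by blast
qed

text \<open>S need not be closed. Finitely many of its points have a compact hull, which the
  nearest-point argument separates from 0. The unit sphere of Rn is compact, so the closed
  conditions \<open>0 \<le> a \<bullet> x\<close> have a common solution as soon as every finite
  family has one; \<open>1 \<le> n\<close> makes the sphere nonempty.\<close>

lemma separating_hyperplane_Rn_0:
  assumes S: "convex S" "S \<subseteq> Rn n" "0 \<notin> S" "1 \<le> n"
  shows "\<exists>a\<in>Rn n. a \<noteq> 0 \<and> (\<forall>x\<in>S. 0 \<le> a \<bullet> x)"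
proof -
  let ?U = "{a \<in> Rn n. norm a = 1}"
  let ?k = "\<lambda>x. {a. 0 \<le> a \<bullet> x}"
  have U: "compact ?U"
  proof (rule compact_Rn)
    have "?U = Rn n \<inter> {a. norm a = 1}" by auto
    then show "closed ?U"
      by (auto intro!: closed_Int closed_Collect_eq continuous_intros)
  qed (auto simp: bounded_iff)
  have "?U \<inter> \<Inter>f \<noteq> {}" if f: "f \<subseteq> ?k ` S" "finite f" for f
  proof -
    obtain c where c: "f = ?k ` c" "c \<subseteq> S" "finite c"
      using finite_subset_image[OF f(2,1)] by auto
    show ?thesis
    proof (cases "c = {}")
      case True
      then show ?thesis using c \<open>1 \<le> n\<close> ev_in_Rn[of 0 n] by (auto intro!: exI[of _ "ev 0"])
    next
      case False
      have hull: "convex hull c \<subseteq> S" using c(2) S(1) by (simp add: hull_minimal)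
      then obtain a where a: "a \<in> convex hull c" "\<forall>x\<in>convex hull c. 0 < a \<bullet> x"
        using separating_hyperplane_compact_0[of "convex hull c"] S False
          finite_imp_compact_convex_hull[OF c(3)] by auto
      have an: "a \<noteq> 0" using a by force
      have "a /\<^sub>R norm a \<in> ?U"
        using a hull S an by auto
      moreover have "a /\<^sub>R norm a \<in> ?k x" if "x \<in> c" for x
        using a(2) hull_inc[OF that, of convex] by (auto intro!: mult_nonneg_nonneg simp: less_imp_le)
      ultimately show ?thesis unfolding c(1) by blast
    qed
  qed
  note fip = this
  have "?U \<inter> \<Inter>(?k ` S) \<noteq> {}"
  proof (rule compact_imp_fip[OF U])
    fix T assume "T \<in> ?k ` S"
    then show "closed T" by (auto intro!: closed_Collect_le continuous_intros)
  qed (rule fip)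
  then show ?thesis by force
qed

section \<open>Relative interior and subgradients\<close>

definition rint :: "nat \<Rightarrow> rvec set \<Rightarrow> rvec set" where
  "rint n Q = {x \<in> Rn n. \<exists>e>0. Rn n \<inter> ball x e \<subseteq> Q}"

lemma rint_subset: "rint n Q \<subseteq> Q"
  by (force simp: rint_def)

lemma interior_of_subset_rint: "top_of_set (Rn n) interior_of Q \<subseteq> rint n Q"
proof
  fix x assume "x \<in> top_of_set (Rn n) interior_of Q"
  then obtain T where T: "openin (top_of_set (Rn n)) T" "T \<subseteq> Q" "x \<in> T"
    by (auto simp: interior_of_def)
  then obtain U where U: "open U" "T = Rn n \<inter> U"
    by (auto simp: openin_open)
  then obtain e where "e > 0" "ball x e \<subseteq> U"
    using T(3) by (meson IntE openE)
  with T U show "x \<in> rint n Q"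
    by (auto simp: rint_def intro!: exI[of _ e])
qed

text \<open>Contracting the ball of radius \<open>e\<close> around y towards x by the factor
  \<open>t\<close> yields the ball of radius \<open>t * e\<close> around the mixture, and convexity
  keeps it in Q.\<close>

lemma rint_mix:
  assumes Q: "convex Q" "Q \<subseteq> Rn n" and x: "x \<in> Q" and y: "y \<in> rint n Q" and t: "0 < t" "t \<le> 1"
  shows "(1 - t) *\<^sub>R x + t *\<^sub>R y \<in> rint n Q"
proof -
  define p where "p = (1 - t) *\<^sub>R x + t *\<^sub>R y"
  obtain e where e: "e > 0" "Rn n \<inter> ball y e \<subseteq> Q" and yR: "y \<in> Rn n"
    using y by (auto simp: rint_def)
  have pR: "p \<in> Rn n" using Q(2) x yR by (auto simp: p_def)
  have "z \<in> Q" if z: "z \<in> Rn n" "dist p z < t * e" for z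
  proof -
    define w where "w = y + (1 / t) *\<^sub>R (z - p)"
    have "norm (z - p) / t < e"
      using z(2) t by (simp add: dist_norm norm_minus_commute divide_less_eq mult.commute)
    then have "w \<in> Q"
      using e z pR yR t by (intro subsetD[OF e(2)]) (auto simp: w_def dist_norm)
    moreover have "z = (1 - t) *\<^sub>R x + t *\<^sub>R w"
      using t by (simp add: w_def p_def algebra_simps)
    ultimately show ?thesis
      using Q(1) x t by (simp add: convex_alt)
  qed
  then show ?thesis
    using pR e t unfolding p_def[symmetric] by (auto simp: rint_def intro!: exI[of _ "t * e"])
qed

lemma convex_rint:
  assumes "convex Q" "Q \<subseteq> Rn n"
  shows "convex (rint n Q)"
  unfolding convex_alt
proof (intro ballI allI impI)
  fix x y and u :: real assume "x \<in> rint n Q" "y \<in> rint n Q" "0 \<le> u \<and> u \<le> 1"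
  then show "(1 - u) *\<^sub>R x + u *\<^sub>R y \<in> rint n Q"
    using rint_mix[OF assms, of x y u] rint_subset by (cases "u = 0") auto
qed

text \<open>The strict epigraph, moved so that (x, f x) becomes the origin and embedded with
  \<open>ev n\<close> as vertical axis, is convex and misses 0. At an interior x a separating vector
  has positive vertical part, and dividing by it gives the subgradient.\<close>

lemma subgradients_on_rint_nonempty:
  assumes f: "convex_on Q f" and Q: "Q \<subseteq> Rn n" and x: "x \<in> rint n Q"
  shows "subgradients_on n Q f x \<noteq> {}"
proof -
  have cQ: "convex Q" using f by (rule convex_on_imp_convex)
  have xQ: "x \<in> Q" using x rint_subset by blast
  have xR: "x \<in> Rn n" using xQ Q by blast
  define S where "S = {(y - x) + s *\<^sub>R ev n | y s. y \<in> Q \<and> f y - f x < s}"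
  have "convex S"
    unfolding convex_alt
  proof (intro ballI allI impI)
    fix p p' and u :: real assume "p \<in> S" "p' \<in> S" and u: "0 \<le> u \<and> u \<le> 1"
    then obtain y s y' s' where p: "p = (y - x) + s *\<^sub>R ev n" "y \<in> Q" "f y - f x < s"
      and p': "p' = (y' - x) + s' *\<^sub>R ev n" "y' \<in> Q" "f y' - f x < s'"
      by (auto simp: S_def)
    let ?y = "(1 - u) *\<^sub>R y + u *\<^sub>R y'" and ?s = "(1 - u) * s + u * s'"
    have "f ?y \<le> (1 - u) * f y + u * f y'"
      using u p p' by (intro convex_onD[OF f]) auto
    also have "\<dots> - f x = (1 - u) * (f y - f x) + u * (f y' - f x)"
      by (simp add: algebra_simps)
    also have "\<dots> < ?s"
    proof (cases "u = 0")
      case False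
      then show ?thesis
        using u p p' by (intro add_le_less_mono mult_left_mono mult_strict_left_mono) auto
    qed (use p in auto)
    finally have "f ?y - f x < ?s" by simp
    moreover have "?y \<in> Q" using cQ p p' u by (simp add: convex_alt)
    moreover have "(1 - u) *\<^sub>R p + u *\<^sub>R p' = (?y - x) + ?s *\<^sub>R ev n"
      by (simp add: p p' algebra_simps)
    ultimately show "(1 - u) *\<^sub>R p + u *\<^sub>R p' \<in> S"
      by (auto simp: S_def)
  qed
  moreover have "S \<subseteq> Rn (Suc n)"
    using Q xQ by (auto simp: S_def intro!: Rn_closed ev_in_Rn intro: Rn_mono[of _ n])
  moreover have "0 \<notin> S"
  proof
    assume "0 \<in> S"
    then obtain y s where y: "0 = (y - x) + s *\<^sub>R ev n" "y \<in> Q" "f y - f x < s"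
      by (auto simp: S_def)
    have "coord 0 n = coord ((y - x) + s *\<^sub>R ev n) n" using y(1) by simp
    moreover have "coord y n = 0" "coord x n = 0"
      using y(2) xQ Q by (auto simp: Rn_iff subset_iff)
    ultimately have "s = 0" by simp
    with y show False by auto
  qed
  ultimately obtain a where a: "a \<in> Rn (Suc n)" "a \<noteq> 0" "\<And>p. p \<in> S \<Longrightarrow> 0 \<le> a \<bullet> p"
    using separating_hyperplane_Rn_0[of S "Suc n"] by auto
  define b where "b = rvec_of n (coord a)"
  have ab: "a \<bullet> z = b \<bullet> z" if "z \<in> Rn n" for z
    using that by (simp add: inner_commute[of _ z] inner_Rn b_def)
  have sup: "0 \<le> b \<bullet> (y - x) + coord a n * s" if "y \<in> Q" "f y - f x < s" for y s
  proof -
    have "0 \<le> a \<bullet> ((y - x) + s *\<^sub>R ev n)"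
      using that by (intro a(3)) (auto simp: S_def)
    moreover have "y - x \<in> Rn n" using that Q xR by (auto simp: subset_iff)
    ultimately show ?thesis by (simp add: inner_add_right inner_ev ab mult.commute)
  qed
  \<comment> \<open>A vertical hyperplane is excluded: a small step from x against \<open>b\<close>
    stays in Q and would give \<open>0 \<le> - (t * (b \<bullet> b))\<close>, so that b, and with it
    a, would vanish.\<close>
  have an: "0 < coord a n"
  proof (rule ccontr)
    assume neg: "\<not> 0 < coord a n"
    have "0 \<le> coord a n" using sup[OF xQ, of 1] by simp
    with neg have a0: "coord a n = 0" by simp
    obtain e where e: "e > 0" "Rn n \<inter> ball x e \<subseteq> Q" using x by (auto simp: rint_def)
    \<comment> \<open>The \<open>+ 1\<close> keeps the denominator positive when
      \<open>b = 0\<close>; the step \<open>t *\<^sub>R b\<close> is shorter than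
      \<open>e\<close>.\<close>
    define t where "t = e / 2 / (norm b + 1)"
    have t: "t > 0" "t * norm b < e"
    proof -
      show "t > 0" using e by (simp add: t_def add_nonneg_pos)
      have "t * norm b \<le> t * (norm b + 1)" using \<open>t > 0\<close> by simp
      also have "\<dots> = e / 2" 
      proof -
        have "norm b + 1 \<noteq> 0" using norm_ge_zero[of b] by linarith
        then show ?thesis using nonzero_eq_divide_eq[of "norm b + 1" t "e / 2"] t_def by blast
      qed
      finally show "t * norm b < e" using e by simp
    qed
    have "x - t *\<^sub>R b \<in> Q"
      using t e xR by (intro subsetD[OF e(2)]) (auto simp: dist_norm b_def)
    from sup[OF this, of "f (x - t *\<^sub>R b) - f x + 1"] have "0 \<le> - (t * (b \<bullet> b))"
      by (simp add: a0)
    then have "b \<bullet> b \<le> 0" using t(1) by (metis neg_le_0_iff_le neg_0_le_iff_le mult_le_0_iff not_less)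
    then have "b = 0" by (metis inner_eq_zero_iff inner_ge_zero order_antisym)
    have "a = 0"
    proof (rule rvec_eqI)
      fix i show "coord a i = coord 0 i"
        using \<open>b = 0\<close> a(1) a0 coord_rvec_of[of n "coord a" i]
        by (cases "i < n"; cases "i = n") (auto simp: b_def Rn_iff)
    qed
    with a(2) show False by simp
  qed
  \<comment> \<open>The epigraph is strict, so the bound at the height \<open>f y - f x\<close>
    itself is the limit of the bounds at heights \<open>s\<close> above it.\<close>
  have le: "- (b \<bullet> (y - x)) / coord a n \<le> f y - f x" if "y \<in> Q" for y
  proof (rule dense_ge)
    fix s assume "f y - f x < s"
    from sup[OF that this] have "- (b \<bullet> (y - x)) \<le> s * coord a n"
      by (simp add: mult.commute)
    with an show "- (b \<bullet> (y - x)) / coord a n \<le> s"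
      by (simp only: pos_divide_le_eq)
  qed
  have "(- 1 / coord a n) *\<^sub>R b \<in> subgradients_on n Q f x"
    using le xQ by (auto simp: subgradients_on_def b_def dest!: le)
  then show ?thesis by blast
qed

section \<open>Lebesgue measure carried over to Rn\<close>

definition leb :: "nat \<Rightarrow> rvec measure" where
  "leb n = distr (PiM {..<n} (\<lambda>_. lborel)) borel (rvec_of n)"

lemma sets_leb [simp, measurable_cong]: "sets (leb n) = sets borel"
  by (simp add: leb_def)

lemma space_leb [simp]: "space (leb n) = UNIV"
  by (simp add: leb_def)

text \<open>Extending a function on {..<n} by zero is measurable into the product over all indices,
  whose sigma-algebra is the Borel one; there \<open>rvec_of n\<close> is a continuous function of
  finitely many coordinates.\<close>

lemma measurable_rvec_of [measurable]: "rvec_of n \<in> measurable (PiM {..<n} (\<lambda>_. lborel)) borel"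
proof -
  define ext where "ext = (\<lambda>(f::nat \<Rightarrow> real) i. if i < n then f i else 0)"
  have "ext \<in> measurable (PiM {..<n} (\<lambda>_. lborel)) (PiM UNIV (\<lambda>_. borel))"
  proof (rule measurable_PiM_single')
    fix i :: nat
    show "(\<lambda>f. ext f i) \<in> measurable (PiM {..<n} (\<lambda>_. lborel)) borel"
      by (cases "i < n") (auto simp: ext_def)
  qed auto
  then have "ext \<in> measurable (PiM {..<n} (\<lambda>_. lborel)) borel"
    by (simp cong: measurable_cong_sets add: sets_PiM_equal_borel)
  moreover have "continuous_on UNIV (rvec_of n)"
    unfolding rvec_of_def by (intro continuous_intros continuous_on_product_coordinates)
  then have "rvec_of n \<in> borel_measurable borel"
    by (rule borel_measurable_continuous_onI)
  ultimately have "rvec_of n \<circ> ext \<in> measurable (PiM {..<n} (\<lambda>_. lborel)) borel"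
    by (rule measurable_comp)
  moreover have "rvec_of n \<circ> ext = rvec_of n"
    by (simp add: fun_eq_iff ext_def rvec_of_def)
  ultimately show ?thesis by simp
qed

lemma emeasure_leb:
  "S \<in> sets borel \<Longrightarrow> emeasure (leb n) S = (\<integral>\<^sup>+f. indicator S (rvec_of n f) \<partial>PiM {..<n} (\<lambda>_. lborel))"
  using nn_integral_distr[OF measurable_rvec_of, of "indicator S" n] by (simp add: leb_def)

text \<open>Prekopa--Leindler for three indicator functions. The product form contains no n-th roots
  and says directly that volumes of caps are midpoint log-concave.\<close>

lemma emeasure_leb_Brunn_Minkowski:
  assumes [measurable]: "A \<in> sets borel" "B \<in> sets borel" "H \<in> sets borel"
    and mid: "\<And>a b. a \<in> A \<Longrightarrow> b \<in> B \<Longrightarrow> a \<in> Rn n \<Longrightarrow> b \<in> Rn n \<Longrightarrow> (1 / 2) *\<^sub>R (a + b) \<in> H"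
  shows "emeasure (leb n) A * emeasure (leb n) B \<le> (emeasure (leb n) H)\<^sup>2"
  unfolding emeasure_leb[OF assms(1)] emeasure_leb[OF assms(2)] emeasure_leb[OF assms(3)]
proof (rule Prekopa_Leindler_PiM)
  fix x y :: "nat \<Rightarrow> real"
  have "rvec_of n (\<lambda>i\<in>{..<n}. (x i + y i) / 2) = (1 / 2) *\<^sub>R (rvec_of n x + rvec_of n y)"
    by (intro rvec_eqI) auto
  then show "indicator A (rvec_of n x) * indicator B (rvec_of n y)
      \<le> (indicator H (rvec_of n (\<lambda>i\<in>{..<n}. (x i + y i) / 2)) :: ennreal)\<^sup>2"
    using mid[of "rvec_of n x" "rvec_of n y"] by (auto split: split_indicator)
qed auto

lemma emeasure_lborel_affine_vimage:
  assumes "A \<in> sets borel" "0 < (c::real)"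
  shows "ennreal c * emeasure lborel {x. t + c * x \<in> A} = emeasure lborel A"
proof -
  have [measurable]: "{x. t + c * x \<in> A} \<in> sets borel"
    using assms(1) by measurable
  have "emeasure lborel A = (\<integral>\<^sup>+x. indicator A x \<partial>lborel)"
    using assms by simp
  also have "\<dots> = ennreal c * (\<integral>\<^sup>+x. indicator A (t + c * x) \<partial>lborel)"
    using assms by (subst nn_integral_real_affine[of _ c t]) auto
  also have "(\<integral>\<^sup>+x. indicator A (t + c * x) \<partial>lborel) = (\<integral>\<^sup>+x. indicator {x. t + c * x \<in> A} x \<partial>lborel)"
    by (intro nn_integral_cong) (auto split: split_indicator)
  finally show ?thesis by simp
qed

text \<open>The two measures agree on boxes with measurable sides; the density collects one factor
  \<open>c\<close> per coordinate.\<close>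

lemma PiM_lborel_affine:
  fixes t :: "'i \<Rightarrow> real"
  assumes I: "finite I" and c: "0 < c"
  shows "density (distr (PiM I (\<lambda>_. lborel)) (PiM I (\<lambda>_. lborel)) (\<lambda>x. \<lambda>i\<in>I. t i + c * x i)) (\<lambda>_. ennreal (c ^ card I))
    = PiM I (\<lambda>_. lborel)" (is "density (distr ?P ?P ?T) _ = _")
proof -
  interpret product_sigma_finite "\<lambda>_::'i. lborel :: real measure" by standard
  have T [measurable]: "?T \<in> measurable ?P ?P"
    by measurable
  show ?thesis
  proof (rule PiM_eqI[OF I])
    fix A :: "'i \<Rightarrow> real set" assume A: "\<And>i. i \<in> I \<Longrightarrow> A i \<in> sets lborel"
    let ?B = "\<lambda>i. {x. t i + c * x \<in> A i}"
    have B: "?B i \<in> sets lborel" if "i \<in> I" for i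
      using A[OF that] by measurable
    have AI: "PiE I A \<in> sets ?P"
      using A I by (intro sets_PiM_I_finite) auto
    have "emeasure (distr ?P ?P ?T) (PiE I A) = emeasure ?P (?T -` PiE I A \<inter> space ?P)"
      using AI by (simp add: emeasure_distr)
    also have "?T -` PiE I A \<inter> space ?P = PiE I ?B"
      by (auto simp: space_PiM PiE_def Pi_def extensional_def)
    also have "emeasure ?P \<dots> = (\<Prod>i\<in>I. emeasure lborel (?B i))"
      using B I by (intro emeasure_PiM) auto
    finally have "emeasure (density (distr ?P ?P ?T) (\<lambda>_. ennreal (c ^ card I))) (PiE I A) =
        ennreal (c ^ card I) * (\<Prod>i\<in>I. emeasure lborel (?B i))"
      using AI by (subst emeasure_density_const) (simp_all only: sets_distr)
    also have "\<dots> = (\<Prod>i\<in>I. ennreal c * emeasure lborel (?B i))"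
      using c by (simp add: prod.distrib ennreal_power)
    also have "\<dots> = (\<Prod>i\<in>I. emeasure lborel (A i))"
      using A c by (intro prod.cong emeasure_lborel_affine_vimage) auto
    finally show "emeasure (density (distr ?P ?P ?T) (\<lambda>_. ennreal (c ^ card I))) (PiE I A) =
        (\<Prod>i\<in>I. emeasure lborel (A i))" .
  qed simp
qed

lemma emeasure_leb_affine_vimage:
  assumes [measurable]: "S \<in> sets borel" and c: "0 < c" and z: "z \<in> Rn n"
  shows "ennreal (c ^ n) * emeasure (leb n) {x. z + c *\<^sub>R x \<in> S} = emeasure (leb n) S"
proof -
  have "continuous_on UNIV (\<lambda>x. z + c *\<^sub>R x)"
    by (intro continuous_intros)
  then have [measurable]: "(\<lambda>x. z + c *\<^sub>R x) \<in> borel_measurable borel"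
    by (rule borel_measurable_continuous_onI)
  have m: "{x. z + c *\<^sub>R x \<in> S} \<in> sets borel"
    using measurable_sets_borel[of "\<lambda>x. z + c *\<^sub>R x" borel S] assms(1) by (simp add: vimage_def)
  let ?P = "PiM {..<n} (\<lambda>_. lborel :: real measure)"
  let ?T = "\<lambda>x. \<lambda>i\<in>{..<n}. coord z i + c * x i"
  have [measurable]: "?T \<in> measurable ?P ?P"
    by measurable
  have "emeasure (leb n) S = (\<integral>\<^sup>+f. indicator S (rvec_of n f) \<partial>?P)"
    by (simp add: emeasure_leb)
  also have "\<dots> = (\<integral>\<^sup>+f. indicator S (rvec_of n f) \<partial>density (distr ?P ?P ?T) (\<lambda>_. ennreal (c ^ n)))"
    using PiM_lborel_affine[of "{..<n}" c "coord z"] c by simp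
  also have "\<dots> = ennreal (c ^ n) * (\<integral>\<^sup>+f. indicator S (rvec_of n (?T f)) \<partial>?P)"
    by (subst nn_integral_density) (auto simp: nn_integral_cmult nn_integral_distr)
  also have "(\<integral>\<^sup>+f. indicator S (rvec_of n (?T f)) \<partial>?P) = (\<integral>\<^sup>+f. indicator {x. z + c *\<^sub>R x \<in> S} (rvec_of n f) \<partial>?P)"
  proof (rule nn_integral_cong)
    fix f :: "nat \<Rightarrow> real"
    have "rvec_of n (?T f) = z + c *\<^sub>R rvec_of n f"
      using z by (intro rvec_eqI) (auto simp: Rn_iff)
    then show "indicator S (rvec_of n (?T f)) = (indicator {x. z + c *\<^sub>R x \<in> S} (rvec_of n f) :: ennreal)"
      by (auto split: split_indicator)
  qed
  also have "\<dots> = emeasure (leb n) {x. z + c *\<^sub>R x \<in> S}"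
    using m by (simp add: emeasure_leb)
  finally show ?thesis by simp
qed

lemma borel_box: "{x. \<forall>i<n. \<bar>coord x i - coord z i\<bar> \<le> d} \<in> sets borel"
proof -
  have "{x. \<forall>i<n. \<bar>coord x i - coord z i\<bar> \<le> d} = (\<Inter>i\<in>{..<n}. {x. \<bar>coord x i - coord z i\<bar> \<le> d})"
    by auto
  also have "closed \<dots>"
    by (intro closed_INT ballI closed_Collect_le continuous_intros)
  finally show ?thesis
    by (rule borel_closed)
qed

lemma emeasure_leb_box:
  assumes "0 \<le> d"
  shows "emeasure (leb n) {x. \<forall>i<n. \<bar>coord x i - coord z i\<bar> \<le> d} = ennreal ((2 * d) ^ n)"
proof -
  interpret product_sigma_finite "\<lambda>_::nat. lborel :: real measure" by standard
  let ?P = "PiM {..<n} (\<lambda>_. lborel :: real measure)"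
  have "rvec_of n -` {x. \<forall>i<n. \<bar>coord x i - coord z i\<bar> \<le> d} \<inter> space ?P = PiE {..<n} (\<lambda>i. {coord z i - d..coord z i + d})"
    by (auto simp: space_PiM PiE_def Pi_def abs_le_iff algebra_simps)
  moreover have "emeasure (leb n) {x. \<forall>i<n. \<bar>coord x i - coord z i\<bar> \<le> d} =
      emeasure ?P (rvec_of n -` {x. \<forall>i<n. \<bar>coord x i - coord z i\<bar> \<le> d} \<inter> space ?P)"
    unfolding leb_def by (rule emeasure_distr[OF measurable_rvec_of borel_box])
  ultimately have "emeasure (leb n) {x. \<forall>i<n. \<bar>coord x i - coord z i\<bar> \<le> d} =
      emeasure ?P (PiE {..<n} (\<lambda>i. {coord z i - d..coord z i + d}))"
    by (simp only:)
  also have "\<dots> = (\<Prod>i<n. emeasure lborel {coord z i - d..coord z i + d})"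
    by (intro emeasure_PiM) auto
  also have "\<dots> = ennreal ((2 * d) ^ n)"
    using assms by (simp add: ennreal_power)
  finally show ?thesis .
qed

lemma emeasure_leb_bounded:
  assumes "bounded S"
  shows "emeasure (leb n) S < \<infinity>"
proof -
  obtain b where b: "\<And>x. x \<in> S \<Longrightarrow> norm x \<le> b" "0 \<le> b"
    using assms by (meson bounded_pos less_imp_le)
  have "emeasure (leb n) S \<le> emeasure (leb n) {x. \<forall>i<n. \<bar>coord x i - coord 0 i\<bar> \<le> b}"
  proof (cases "S \<in> sets borel")
    case True
    have "S \<subseteq> {x. \<forall>i<n. \<bar>coord x i - coord 0 i\<bar> \<le> b}"
    proof (intro subsetI CollectI allI impI)
      fix x i assume "x \<in> S"
      then show "\<bar>coord x i - coord 0 i\<bar> \<le> b"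
        using b(1)[of x] abs_coord_le_norm[of x i] by simp
    qed
    then show ?thesis
      by (intro emeasure_mono) (simp_all only: sets_leb borel_box)
  next
    \<comment> \<open>A set outside the sigma-algebra gets measure 0 by convention.\<close>
    case False
    then have "emeasure (leb n) S = 0"
      by (intro emeasure_notin_sets) (simp only: sets_leb not_False_eq_True)
    then show ?thesis by (simp only: zero_le)
  qed
  also have "\<dots> = ennreal ((2 * b) ^ n)"
    by (rule emeasure_leb_box[OF b(2)])
  also have "\<dots> < \<infinity>" by simp
  finally show ?thesis .
qed

lemma emeasure_leb_Rn: "S \<in> sets borel \<Longrightarrow> emeasure (leb n) (S \<inter> Rn n) = emeasure (leb n) S"
  by (subst (1 2) emeasure_leb) (auto intro!: nn_integral_cong split: split_indicator)

lemma emeasure_leb_pos: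
  assumes S: "S \<in> sets borel" and x: "x \<in> rint n S"
  shows "0 < emeasure (leb n) S"
proof -
  obtain e where e: "e > 0" "Rn n \<inter> ball x e \<subseteq> S" "x \<in> Rn n"
    using x by (auto simp: rint_def)
  \<comment> \<open>A box of half-side \<open>d\<close> lies in the ball of radius \<open>e\<close>
    because the norm is at most the sum of the n coordinate sizes; \<open>n + 1\<close> avoids
    division by zero.\<close>
  define d where "d = e / (2 * (real n + 1))"
  have d: "0 < d" "real n * d < e"
  proof -
    show "0 < d" using e by (simp add: d_def)
    have "real n * d \<le> (real n + 1) * d" using \<open>0 < d\<close> by simp
    also have "\<dots> = e / 2" by (simp add: d_def field_simps)
    finally show "real n * d < e" using e by simp
  qed
  let ?B = "{y. \<forall>i<n. \<bar>coord y i - coord x i\<bar> \<le> d}"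
  have B: "?B \<in> sets borel" by (rule borel_box)
  have "?B \<inter> Rn n \<subseteq> S"
  proof
    fix y assume y: "y \<in> ?B \<inter> Rn n"
    have "norm (y - x) = norm (rvec_of n (coord (y - x)))"
      using y e by (simp add: rvec_of_coord)
    also have "\<dots> \<le> (\<Sum>i<n. norm (coord (y - x) i *\<^sub>R ev i))"
      unfolding rvec_of_def by (rule norm_sum)
    also have "\<dots> \<le> (\<Sum>i<n. d)"
      using y by (intro sum_mono) auto
    also have "\<dots> < e" using d by simp
    finally show "y \<in> S" using y e(2) by (auto simp: dist_norm norm_minus_commute)
  qed
  then have "emeasure (leb n) (?B \<inter> Rn n) \<le> emeasure (leb n) S"
    using S by (intro emeasure_mono) auto
  moreover have "0 < emeasure (leb n) ?B"
    using d by (subst emeasure_leb_box) (auto simp: ennreal_zero_less_mult_iff)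
  ultimately show ?thesis using emeasure_leb_Rn[OF B] by simp
qed

section \<open>Cuts through the centroid\<close>

text \<open>
  Suppose that the tail \<open>T\<close> has \<open>T 0 < v / 10\<close>, and let \<open>s\<close> be nearly minimal with \<open>T (- s) \<ge> v / 2\<close>.
  Log-concavity makes \<open>T (j * s)\<close> decay by a factor \<open>5\<close> from each \<open>j\<close> to the next, so the positive part
  of \<open>X\<close> has integral at most \<open>s * v / 8\<close>, too little to balance the negative part, which has
  integral at least \<open>s * v / 4\<close>.
\<close>

lemma log_concave_tail_at_mean:
  fixes X :: "'a \<Rightarrow> real"
  assumes fin: "finite_measure M" and X [measurable]: "X \<in> borel_measurable M"
    and bnd: "\<And>x. x \<in> space M \<Longrightarrow> \<bar>X x\<bar> \<le> R"
    and mean: "(\<integral>x. X x \<partial>M) = 0"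
    and lc: "\<And>s t. measure M {x \<in> space M. s \<le> X x} * measure M {x \<in> space M. t \<le> X x}
      \<le> (measure M {x \<in> space M. (s + t) / 2 \<le> X x})\<^sup>2"
  shows "measure M (space M) / 10 \<le> measure M {x \<in> space M. 0 \<le> X x}"
proof (rule ccontr)
  interpret finite_measure M by (rule fin)
  define v where "v = measure M (space M)"
  define T where "T = (\<lambda>t. measure M {x \<in> space M. t \<le> X x})"
  assume "\<not> ?thesis"
  then have T0: "T 0 < v / 10" by (simp add: T_def v_def)
  have T_nonneg: "0 \<le> T t" for t by (simp add: T_def)
  have v: "0 < v" using T0 T_nonneg[of 0] by linarith
  have T_mono: "T t \<le> T s" if "s \<le> t" for s t
    unfolding T_def using that by (intro finite_measure_mono) auto
  have T_lc: "T s * T t \<le> (T ((s + t) / 2))\<^sup>2" for s t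
    using lc by (simp add: T_def)
  \<comment> \<open>Continuity of the measure from above at level 0. It keeps the levels
    \<open>- s\<close> that have half of the mass above them away from 0, so that the infimum of
    these \<open>s\<close> is positive.\<close>
  have "(\<lambda>k::nat. T (- 1 / real (Suc k))) \<longlonglongrightarrow> measure M (\<Inter>k::nat. {x \<in> space M. - 1 / real (Suc k) \<le> X x})"
    unfolding T_def
  proof (rule finite_Lim_measure_decseq)
    show "decseq (\<lambda>k::nat. {x \<in> space M. - 1 / real (Suc k) \<le> X x})"
      unfolding decseq_def
    proof (intro allI impI subsetI CollectI conjI)
      fix k l :: nat and x assume "k \<le> l" "x \<in> {x \<in> space M. - 1 / real (Suc l) \<le> X x}"
      moreover have "1 / real (Suc l) \<le> 1 / real (Suc k)"
        using \<open>k \<le> l\<close> by (intro divide_left_mono) auto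
      ultimately show "- 1 / real (Suc k) \<le> X x" by simp
    qed auto
  qed auto
  also have "(\<Inter>k::nat. {x \<in> space M. - 1 / real (Suc k) \<le> X x}) = {x \<in> space M. 0 \<le> X x}"
  proof (intro set_eqI iffI)
    fix x assume x: "x \<in> (\<Inter>k::nat. {x \<in> space M. - 1 / real (Suc k) \<le> X x})"
    have "0 \<le> X x"
    proof (rule ccontr)
      assume "\<not> 0 \<le> X x"
      then obtain k where "1 / real (Suc k) < - X x"
        by (metis neg_0_less_iff_less not_le nat_approx_posE)
      moreover have "- 1 / real (Suc k) \<le> X x" using x by blast
      ultimately show False by simp
    qed
    with x show "x \<in> {x \<in> space M. 0 \<le> X x}" by auto
  next
    fix x assume "x \<in> {x \<in> space M. 0 \<le> X x}"
    then show "x \<in> (\<Inter>k::nat. {x \<in> space M. - 1 / real (Suc k) \<le> X x})"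
      by (auto intro: order_trans[of _ 0])
  qed
  finally have "(\<lambda>k::nat. T (- 1 / real (Suc k))) \<longlonglongrightarrow> T 0" by (simp add: T_def)
  then have "\<forall>\<^sub>F k in sequentially. T (- 1 / real (Suc k)) < v / 10"
    using T0 by (rule order_tendstoD)
  then obtain k where k: "T (- 1 / real (Suc k)) < v / 10"
    by (auto simp: eventually_sequentially)
  define D where "D = {s. 0 \<le> s \<and> v / 2 \<le> T (- s)}"
  have D_lower: "1 / real (Suc k) \<le> s" if "s \<in> D" for s
  proof (rule ccontr)
    assume "\<not> ?thesis"
    then have "T (- s) \<le> T (- 1 / real (Suc k))" by (intro T_mono) simp
    with k that v show False by (auto simp: D_def)
  qed
  have "\<bar>R\<bar> \<in> D"
  proof -
    have "{x \<in> space M. - \<bar>R\<bar> \<le> X x} = space M" using bnd by fastforce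
    then show ?thesis using v by (simp add: D_def T_def v_def)
  qed
  then have D_ne: "D \<noteq> {}" by blast
  have bdd: "bdd_below D" using D_lower by (auto simp: bdd_below_def)
  have k_pos: "0 < 1 / real (Suc k)" by (intro divide_pos_pos) simp_all
  have "1 / real (Suc k) \<le> Inf D" by (rule cInf_greatest[OF D_ne D_lower])
  with k_pos have inf_pos: "0 < Inf D" by (rule less_le_trans)
  \<comment> \<open>Below twice the infimum, \<open>s\<close> is in D while \<open>s / 2\<close> is
    not: at least half of the mass is at or above \<open>- s\<close>, but less than half at or above
    \<open>- s / 2\<close>.\<close>
  obtain s where s: "s \<in> D" "s < 2 * Inf D"
    using cInf_lessD[OF D_ne, of "2 * Inf D"] inf_pos by auto
  have s0: "0 < s" using s(1) D_lower[of s] k_pos by (meson less_le_trans)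
  have "s / 2 \<notin> D" using cInf_lower[OF _ bdd, of "s / 2"] s(2) by auto
  then have half: "T (- s / 2) < v / 2" using s0 by (auto simp: D_def)
  have Ts: "v / 2 \<le> T (- s)" using s(1) by (simp add: D_def)
  have step: "5 * T ((real j + 1) * s) \<le> T (real j * s)" for j
  proof (induction j)
    case 0
    \<comment> \<open>Level 0 is the midpoint of \<open>- s\<close> and \<open>s\<close>. Hence T s
      \<le> (T 0)^2 / T (- s) \<le> T 0 * (v / 10) / (v / 2), which is where the factor 5 comes
      from.\<close>
    have "T (- s) * T s \<le> (T 0)\<^sup>2" using T_lc[of "- s" s] by simp
    moreover have "v / 2 * T s \<le> T (- s) * T s" using Ts T_nonneg by (intro mult_right_mono)
    moreover have "(T 0)\<^sup>2 \<le> v / 10 * T 0"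
      unfolding power2_eq_square using T0 T_nonneg by (intro mult_right_mono) auto
    ultimately have "v / 2 * T s \<le> v / 10 * T 0" by linarith
    then have "v * (5 * T s) \<le> v * T 0" by simp
    then show ?case using v by simp
  next
    case (Suc j)
    define a where "a = T (real j * s)"
    define b where "b = T (real (Suc j) * s)"
    define c where "c = T ((real (Suc j) + 1) * s)"
    have "a * c \<le> b\<^sup>2"
    proof -
      have "(real j * s + (real (Suc j) + 1) * s) / 2 = real (Suc j) * s" by (simp add: field_simps)
      then show ?thesis
        using T_lc[of "real j * s" "(real (Suc j) + 1) * s"] by (simp only: a_def b_def c_def)
    qed
    moreover have "5 * b \<le> a" using Suc by (simp add: a_def b_def add.commute)
    moreover have "0 \<le> c" "c \<le> b" using T_nonneg s0 by (auto simp: b_def c_def intro!: T_mono)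
    ultimately have "5 * c \<le> b"
    proof -
      assume h: "a * c \<le> b\<^sup>2" "5 * b \<le> a" "0 \<le> c" "c \<le> b"
      show ?thesis
      proof (cases "b = 0")
        case False
        then have "0 < b" using h by linarith
        have "5 * b * c \<le> b * b"
          using h mult_right_mono[OF h(2,3)] by (simp add: power2_eq_square)
        then have "b * (5 * c) \<le> b * b" by (simp add: mult_ac)
        then show ?thesis using \<open>0 < b\<close> by simp
      qed (use h in auto)
    qed
    then show ?case by (simp add: b_def c_def)
  qed
  have geo: "T (real j * s) \<le> T 0 * (1 / 5) ^ j" for j
  proof (induction j)
    case (Suc j)
    have "5 * T (real (Suc j) * s) \<le> T 0 * (1 / 5) ^ j"
      using step[of j] Suc by (simp add: add.commute)
    then show ?case by simp
  qed simp
  obtain J where J: "R < real J * s" using s0 reals_Archimedean3 by blast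
  have int: "integrable M f" if "f \<in> borel_measurable M" "\<And>x. x \<in> space M \<Longrightarrow> \<bar>f x\<bar> \<le> B" for f :: "'a \<Rightarrow> real" and B
    by (rule integrable_const_bound[of _ B]) (use that in auto)
  let ?p = "\<lambda>x. max (X x) 0" and ?n = "\<lambda>x. max (- X x) 0"
  have ip: "integrable M ?p" "integrable M ?n"
    by (rule int[of _ "\<bar>R\<bar>"]; use bnd in fastforce)+
  have eq: "(\<integral>x. ?p x \<partial>M) = (\<integral>x. ?n x \<partial>M)"
  proof -
    have "(\<integral>x. ?p x \<partial>M) - (\<integral>x. ?n x \<partial>M) = (\<integral>x. ?p x - ?n x \<partial>M)"
      using ip by simp
    also have "\<dots> = (\<integral>x. X x \<partial>M)" by (intro Bochner_Integration.integral_cong) auto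
    finally show ?thesis using mean by simp
  qed
  have ind: "integrable M (\<lambda>x. indicator {x \<in> space M. t \<le> X x} x :: real)" for t
    by (rule int[of _ 1]) (auto split: split_indicator)
  \<comment> \<open>The levels j s, j = 0, 1, ..., that do not exceed a nonnegative value X x number
    floor (X x / s) + 1, so s times their number is at least X x. The integral becomes a sum of
    tails.\<close>
  have "(\<integral>x. ?p x \<partial>M) \<le> (\<integral>x. s * (\<Sum>j<J. indicator {x \<in> space M. real j * s \<le> X x} x) \<partial>M)"
  proof (rule integral_mono)
    fix x assume x: "x \<in> space M"
    show "?p x \<le> s * (\<Sum>j<J. indicator {x \<in> space M. real j * s \<le> X x} x)"
    proof (cases "0 \<le> X x")
      case False
      then show ?thesis using s0 by (auto intro!: mult_nonneg_nonneg sum_nonneg)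
    next
      case True
      define i where "i = nat \<lfloor>X x / s\<rfloor>"
      have i: "real i * s \<le> X x" "X x < (real i + 1) * s"
      proof -
        have "real i = of_int \<lfloor>X x / s\<rfloor>" using True s0 by (simp add: i_def)
        then have "real i \<le> X x / s" "X x / s < real i + 1" by linarith+
        then show "real i * s \<le> X x" "X x < (real i + 1) * s" using s0 by (simp_all add: field_simps)
      qed
      have "real i * s < real J * s" using i J bnd[OF x] by linarith
      then have iJ: "i < J" using s0 by simp
      have "(\<Sum>j<Suc i. 1) \<le> (\<Sum>j<J. indicator {x \<in> space M. real j * s \<le> X x} x :: real)"
      proof (rule sum_mono2[THEN order_trans[rotated], of _ "{..<Suc i}"])
        show "(\<Sum>j<Suc i. 1) \<le> (\<Sum>j<Suc i. indicator {x \<in> space M. real j * s \<le> X x} x :: real)"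
        proof (rule sum_mono)
          fix j assume "j \<in> {..<Suc i}"
          then have "real j * s \<le> real i * s" using s0 by simp
          then show "1 \<le> (indicator {x \<in> space M. real j * s \<le> X x} x :: real)"
            using i x by auto
        qed
      qed (use iJ in auto)
      then have "s * (real i + 1) \<le> s * (\<Sum>j<J. indicator {x \<in> space M. real j * s \<le> X x} x)"
        using s0 by simp
      then show ?thesis using i True by (simp add: mult.commute)
    qed
  qed (use ip ind in auto)
  also have "\<dots> = s * (\<Sum>j<J. T (real j * s))"
    using ind by (simp add: T_def)
  also have "\<dots> \<le> s * (\<Sum>j<J. T 0 * (1 / 5) ^ j)"
    using s0 geo by (intro mult_left_mono sum_mono) auto
  also have "\<dots> = s * (T 0 * (\<Sum>j<J. (1 / 5) ^ j))" by (simp add: sum_distrib_left)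
  also have "\<dots> \<le> s * (T 0 * (5 / 4))"
    using s0 T_nonneg by (intro mult_left_mono) (auto simp: sum_gp_strict)
  also have "\<dots> \<le> s * v / 8" using s0 T0 by simp
  finally have up: "(\<integral>x. ?p x \<partial>M) \<le> s * v / 8" .
  \<comment> \<open>On more than half of the mass X is below \<open>- s / 2\<close>, which gives the
    negative part an integral of at least \<open>s * v / 4\<close>.\<close>
  have "s / 2 * (v / 2) \<le> s / 2 * (v - T (- s / 2))"
    using half s0 by (intro mult_left_mono) auto
  also have "\<dots> = (\<integral>x. s / 2 * (1 - indicator {x \<in> space M. - s / 2 \<le> X x} x) \<partial>M)"
    using ind[of "- s / 2"] by (simp add: T_def v_def)
  also have "\<dots> \<le> (\<integral>x. ?n x \<partial>M)"
    using ip ind[of "- s / 2"] s0 by (intro integral_mono) (auto split: split_indicator)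
  finally have "s * v / 4 \<le> s * v / 8" using up eq by simp
  then show False using s0 v by (simp add: mult_less_0_iff field_simps)
qed

text \<open>The finitely supported sequences are not complete, so the mean is taken coordinate by
  coordinate rather than as a vector-valued integral.\<close>

definition centroid :: "nat \<Rightarrow> rvec set \<Rightarrow> rvec" where
  "centroid n K = rvec_of n (\<lambda>i. (\<integral>x. indicator K x * coord x i \<partial>leb n) / measure (leb n) K)"

lemma centroid_in_Rn [simp]: "centroid n K \<in> Rn n"
  by (simp add: centroid_def)

lemma borel_measurable_coord [measurable]: "(\<lambda>x. coord x i) \<in> borel_measurable (borel :: rvec measure)"
  by (intro borel_measurable_continuous_onI continuous_intros)

lemma borel_open_halfspace: "{x :: rvec. \<nu> \<bullet> (x - c) < 0} \<in> sets borel"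
  by (intro borel_open open_Collect_less continuous_intros)

lemma integrable_on_bounded_leb:
  assumes K: "K \<in> sets borel" "bounded K" and f: "f \<in> borel_measurable borel"
    and B: "\<And>x. x \<in> K \<Longrightarrow> \<bar>f x\<bar> \<le> B"
  shows "integrable (leb n) (\<lambda>x. indicator K x * f x :: real)"
proof (rule integrableI_bounded_set[of K])
  show "emeasure (leb n) K < \<infinity>" by (rule emeasure_leb_bounded[OF K(2)])
  show "AE x\<in>K in leb n. norm (indicator K x * f x) \<le> B"
    using B by (intro AE_I2) auto
qed (use K f in auto)

lemma integral_inner_centroid:
  assumes K: "K \<in> sets borel" "bounded K" "K \<subseteq> Rn n" and pos: "measure (leb n) K \<noteq> 0"
  shows "(\<integral>x. indicator K x * (\<nu> \<bullet> (x - centroid n K)) \<partial>leb n) = 0"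
proof -
  define v where "v = measure (leb n) K"
  obtain b where b: "\<And>x. x \<in> K \<Longrightarrow> norm x \<le> b" using K(2) by (auto simp: bounded_iff)
  have ic: "integrable (leb n) (\<lambda>x. indicator K x * coord x i)" for i
  proof (rule integrable_on_bounded_leb[OF K(1,2), where B=b])
    show "\<bar>coord x i\<bar> \<le> b" if "x \<in> K" for x
      using b[OF that] abs_coord_le_norm[of x i] by simp
  qed (rule borel_measurable_coord)
  have i1: "integrable (leb n) (\<lambda>x. indicator K x * (1::real))"
    by (rule integrable_on_bounded_leb[where B=1]) (use K in auto)
  have v: "(\<integral>x. indicator K x * (1::real) \<partial>leb n) = v"
    using K by (simp add: v_def)
  have "indicator K x * (\<nu> \<bullet> (x - centroid n K)) =
      (\<Sum>i<n. coord \<nu> i * (indicator K x * coord x i - coord (centroid n K) i * (indicator K x * 1)))" for x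
  proof (cases "x \<in> K")
    case True
    then have "x - centroid n K \<in> Rn n" using K(3) by (intro Rn_closed) auto
    then have "\<nu> \<bullet> (x - centroid n K) = (\<Sum>i<n. coord (x - centroid n K) i * coord \<nu> i)"
      by (subst inner_commute) (rule inner_Rn)
    then show ?thesis using True by (simp add: algebra_simps)
  qed simp
  then have "(\<integral>x. indicator K x * (\<nu> \<bullet> (x - centroid n K)) \<partial>leb n) =
      (\<integral>x. (\<Sum>i<n. coord \<nu> i * (indicator K x * coord x i - coord (centroid n K) i * (indicator K x * 1))) \<partial>leb n)"
    by (simp only:)
  also have "\<dots> = (\<Sum>i<n. \<integral>x. coord \<nu> i * (indicator K x * coord x i - coord (centroid n K) i * (indicator K x * 1)) \<partial>leb n)"
    using ic i1 by (intro Bochner_Integration.integral_sum integrable_mult_right Bochner_Integration.integrable_diff)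
  also have "\<dots> = (\<Sum>i<n. coord \<nu> i * ((\<integral>x. indicator K x * coord x i \<partial>leb n) - coord (centroid n K) i * v))"
  proof (rule sum.cong[OF refl])
    fix i
    have "(\<integral>x. coord \<nu> i * (indicator K x * coord x i - coord (centroid n K) i * (indicator K x * 1)) \<partial>leb n)
      = coord \<nu> i * (\<integral>x. (indicator K x * coord x i - coord (centroid n K) i * (indicator K x * 1)) \<partial>leb n)"
      by (rule integral_mult_right_zero)
    also have "(\<integral>x. (indicator K x * coord x i - coord (centroid n K) i * (indicator K x * 1)) \<partial>leb n) =
       (\<integral>x. indicator K x * coord x i \<partial>leb n) - (\<integral>x. coord (centroid n K) i * (indicator K x * 1) \<partial>leb n)"
      using ic i1 by (intro Bochner_Integration.integral_diff integrable_mult_right)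
    also have "(\<integral>x. coord (centroid n K) i * (indicator K x * 1) \<partial>leb n) = coord (centroid n K) i * v"
      unfolding v[symmetric] by (rule integral_mult_right_zero)
    finally show "(\<integral>x. coord \<nu> i * (indicator K x * coord x i - coord (centroid n K) i * (indicator K x * 1)) \<partial>leb n) =
      coord \<nu> i * ((\<integral>x. indicator K x * coord x i \<partial>leb n) - coord (centroid n K) i * v)" .
  qed
  also have "\<dots> = 0"
    using pos by (intro sum.neutral) (auto simp: centroid_def v_def)
  finally show ?thesis .
qed

text \<open>A weak form of Gruenbaum's inequality, whose constant would be \<open>1 - 1 / exp 1\<close>.\<close>

lemma measure_cut_at_centroid:
  assumes K: "K \<in> sets borel" "bounded K" "K \<subseteq> Rn n" "convex K"
  shows "measure (leb n) (K \<inter> {x. \<nu> \<bullet> (x - centroid n K) < 0}) \<le> 9 / 10 * measure (leb n) K"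
proof (cases "measure (leb n) K = 0")
  case True
  have "measure (leb n) (K \<inter> {x. \<nu> \<bullet> (x - centroid n K) < 0}) \<le> measure (leb n) K"
    using K emeasure_leb_bounded[OF K(2)] borel_open_halfspace
    by (intro measure_mono_fmeasurable) (auto simp: fmeasurable_def)
  with True show ?thesis by (simp add: measure_le_0_iff)
next
  case False
  define c where "c = centroid n K"
  define M where "M = density (leb n) (indicator K)"
  define X where "X = (\<lambda>x. \<nu> \<bullet> (x - c))"
  have Xm [measurable]: "X \<in> borel_measurable borel"
    unfolding X_def by (intro borel_measurable_continuous_onI continuous_intros)
  obtain b where b: "\<And>x. x \<in> K \<Longrightarrow> norm x \<le> b" using K(2) by (auto simp: bounded_iff)
  define R where "R = norm \<nu> * (b + norm c)"
  have R: "\<bar>X x\<bar> \<le> R" if "x \<in> K" for x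
  proof -
    have "\<bar>X x\<bar> \<le> norm \<nu> * norm (x - c)" unfolding X_def by (rule Cauchy_Schwarz_ineq2)
    also have "\<dots> \<le> R"
      unfolding R_def using b[OF that] norm_triangle_ineq4[of x c] by (intro mult_left_mono) auto
    finally show ?thesis .
  qed
  \<comment> \<open>\<open>X\<close> may be unbounded off K, while the tail estimate asks for a
    bound on the whole space. Setting it to 0 there changes nothing for \<open>M\<close>, which is
    concentrated on K.\<close>
  define Y where "Y = (\<lambda>x. indicator K x * X x)"
  have Ym [measurable]: "Y \<in> borel_measurable borel"
    unfolding Y_def using K(1) by measurable
  have fin: "emeasure (leb n) A < \<infinity>" if "A \<subseteq> K" for A
    using that K(2) by (intro emeasure_leb_bounded) (rule bounded_subset)
  have eM: "emeasure M A = emeasure (leb n) (K \<inter> A)" if "A \<in> sets borel" for A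
    unfolding M_def using K(1) that by (intro emeasure_restricted) auto
  have mM: "measure M A = measure (leb n) (K \<inter> A)" if "A \<in> sets borel" for A
    using eM[OF that] by (simp add: measure_def)
  have sp: "space M = UNIV" by (simp add: M_def)
  have XY: "K \<inter> {x \<in> space M. t \<le> Y x} = K \<inter> {x. t \<le> X x}" for t
    by (auto simp: Y_def sp)
  have tail: "measure M {x \<in> space M. t \<le> Y x} = measure (leb n) (K \<inter> {x. t \<le> X x})" for t
    unfolding XY[symmetric] by (rule mM) (use Ym in \<open>auto simp: sp\<close>)
  have "measure M (space M) / 10 \<le> measure M {x \<in> space M. 0 \<le> Y x}"
  proof (rule log_concave_tail_at_mean[where R="\<bar>R\<bar>"])
    show "finite_measure M"
      using fin[of K] eM[of UNIV] by (intro finite_measureI) (auto simp: sp)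
    show "Y \<in> borel_measurable M"
      using Ym by (simp add: M_def)
    show "\<bar>Y x\<bar> \<le> \<bar>R\<bar>" for x
      using R[of x] by (auto simp: Y_def split: split_indicator)
    have "(\<integral>x. Y x \<partial>M) = (\<integral>x. indicator K x * Y x \<partial>leb n)"
    proof -
      have "M = density (leb n) (\<lambda>x. ennreal (indicator K x))"
        by (simp add: M_def ennreal_indicator)
      then show ?thesis
        using K(1) by (simp add: integral_density)
    qed
    also have "\<dots> = (\<integral>x. indicator K x * (\<nu> \<bullet> (x - centroid n K)) \<partial>leb n)"
      by (intro Bochner_Integration.integral_cong) (auto simp: Y_def X_def c_def split: split_indicator)
    also have "\<dots> = 0" by (rule integral_inner_centroid[OF K(1-3) False])
    finally show "(\<integral>x. Y x \<partial>M) = 0" .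
    fix s t :: real
    \<comment> \<open>The caps of K above levels s and t average into the cap above (s + t) / 2,
      because K is convex and X is affine.\<close>
    let ?A = "\<lambda>t. K \<inter> {x. t \<le> X x}"
    have A: "?A t \<in> sets borel" for t using K(1) by measurable
    have "emeasure (leb n) (?A s) * emeasure (leb n) (?A t) \<le> (emeasure (leb n) (?A ((s + t) / 2)))\<^sup>2"
    proof (rule emeasure_leb_Brunn_Minkowski[OF A A A])
      fix x y assume x: "x \<in> ?A s" and y: "y \<in> ?A t"
      have "(1 / 2) *\<^sub>R x + (1 / 2) *\<^sub>R y \<in> K"
        using K(4) x y by (intro convexD) auto
      moreover have "X ((1 / 2) *\<^sub>R (x + y)) = (X x + X y) / 2"
        by (simp add: X_def inner_diff_right inner_add_right add_divide_distrib)
      ultimately show "(1 / 2) *\<^sub>R (x + y) \<in> ?A ((s + t) / 2)"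
        using x y by (auto simp: scaleR_add_right)
    qed
    moreover have "emeasure (leb n) (?A u) = ennreal (measure (leb n) (?A u))" for u
      using fin[of "?A u"] by (intro emeasure_eq_ennreal_measure) auto
    ultimately have "ennreal (measure (leb n) (?A s) * measure (leb n) (?A t)) \<le> ennreal ((measure (leb n) (?A ((s + t) / 2)))\<^sup>2)"
      by (simp only: ennreal_mult[OF measure_nonneg measure_nonneg] ennreal_power[OF measure_nonneg, symmetric])
    then have "measure (leb n) (?A s) * measure (leb n) (?A t) \<le> (measure (leb n) (?A ((s + t) / 2)))\<^sup>2"
      by (simp only: ennreal_le_iff zero_le_power2)
    then show "measure M {x \<in> space M. s \<le> Y x} * measure M {x \<in> space M. t \<le> Y x}
        \<le> (measure M {x \<in> space M. (s + t) / 2 \<le> Y x})\<^sup>2"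
      by (simp only: tail)
  qed
  then have d: "measure (leb n) K / 10 \<le> measure (leb n) (K \<inter> {x. 0 \<le> X x})"
    using mM[of UNIV] by (simp add: tail) (simp add: sp)
  have "measure (leb n) K = measure (leb n) (K \<inter> {x. X x < 0} \<union> K \<inter> {x. 0 \<le> X x})"
    by (intro arg_cong[where f="measure (leb n)"]) auto
  also have "\<dots> = measure (leb n) (K \<inter> {x. X x < 0}) + measure (leb n) (K \<inter> {x. 0 \<le> X x})"
  proof (rule measure_Union)
    show "K \<inter> {x. X x < 0} \<in> sets (leb n)" "K \<inter> {x. 0 \<le> X x} \<in> sets (leb n)"
      using K(1) by measurable
  qed (use fin[of "K \<inter> {x. X x < 0}"] fin[of "K \<inter> {x. 0 \<le> X x}"] in auto)
  finally show ?thesis using d by (simp add: X_def c_def)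
qed

section \<open>Homothetic copies and the position of the centroid\<close>

lemma measure_leb_homothety:
  assumes Q: "Q \<in> sets borel" "bounded Q" and z: "z \<in> Rn n" and t: "0 < t"
  shows "{y. z + (1 / t) *\<^sub>R (y - z) \<in> Q} \<in> sets borel"
    and "measure (leb n) {y. z + (1 / t) *\<^sub>R (y - z) \<in> Q} = t ^ n * measure (leb n) Q"
proof -
  let ?z = "z - (1 / t) *\<^sub>R z"
  have eq: "{y. z + (1 / t) *\<^sub>R (y - z) \<in> Q} = {y. ?z + (1 / t) *\<^sub>R y \<in> Q}"
    by (simp add: algebra_simps)
  have "(\<lambda>y. ?z + (1 / t) *\<^sub>R y) \<in> borel_measurable borel"
    by (intro borel_measurable_continuous_onI continuous_intros)
  from measurable_sets_borel[OF this Q(1)]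
  show "{y. z + (1 / t) *\<^sub>R (y - z) \<in> Q} \<in> sets borel"
    unfolding eq by (simp add: vimage_def)
  have "ennreal ((1 / t) ^ n) * emeasure (leb n) {y. ?z + (1 / t) *\<^sub>R y \<in> Q} = emeasure (leb n) Q"
    using z t by (intro emeasure_leb_affine_vimage Q) auto
  then have "enn2real (ennreal ((1 / t) ^ n) * emeasure (leb n) {y. ?z + (1 / t) *\<^sub>R y \<in> Q}) = measure (leb n) Q"
    by (simp add: measure_def)
  then have "(1 / t) ^ n * measure (leb n) {y. ?z + (1 / t) *\<^sub>R y \<in> Q} = measure (leb n) Q"
    using t by (simp add: enn2real_mult measure_def)
  then show "measure (leb n) {y. z + (1 / t) *\<^sub>R (y - z) \<in> Q} = t ^ n * measure (leb n) Q"
    unfolding eq using t by (simp add: power_divide field_simps)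
qed

text \<open>This provides the point that some cut must have removed: a localizer with less volume
  than the copy of Q shrunk by t towards z cannot contain that copy.\<close>

lemma small_set_misses_homothety:
  assumes Q: "Q \<in> sets borel" "bounded Q" and z: "z \<in> Rn n" and t: "0 < t"
    and L: "L \<in> sets borel" "bounded L" "measure (leb n) L < t ^ n * measure (leb n) Q"
  shows "\<exists>w\<in>Q. z + t *\<^sub>R (w - z) \<notin> L"
proof (rule ccontr)
  assume "\<not> ?thesis"
  then have *: "z + t *\<^sub>R (w - z) \<in> L" if "w \<in> Q" for w using that by blast
  have "{y. z + (1 / t) *\<^sub>R (y - z) \<in> Q} \<subseteq> L"
  proof
    fix y assume "y \<in> {y. z + (1 / t) *\<^sub>R (y - z) \<in> Q}"
    then have "z + t *\<^sub>R ((z + (1 / t) *\<^sub>R (y - z)) - z) \<in> L" by (intro *) simp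
    then show "y \<in> L" using t by simp
  qed
  then have "measure (leb n) {y. z + (1 / t) *\<^sub>R (y - z) \<in> Q} \<le> measure (leb n) L"
    using measure_leb_homothety(1)[OF Q z t] L(1) emeasure_leb_bounded[OF L(2)]
    by (intro measure_mono_fmeasurable) (auto simp: fmeasurable_def)
  then show False using measure_leb_homothety(2)[OF Q z t] L(3) by simp
qed

text \<open>Queries are made at centroids, and subgradients are guaranteed only in the relative
  interior. If c were outside it, a hyperplane through c would have Q weakly and rint Q strictly on
  one side; as \<open>a \<bullet> (x - c)\<close> has mean 0 over K, K would miss rint Q up to a
  null set. A slightly shrunken copy of Q lies in rint Q and has almost the volume of Q, so it must
  meet K; this avoids showing that the boundary of Q is null.\<close>

lemma centroid_in_rint:
  assumes Q: "Q \<in> sets borel" "bounded Q" "Q \<subseteq> Rn n" "convex Q" "rint n Q \<noteq> {}" and n: "1 \<le> n"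
    and K: "K \<in> sets borel" "K \<subseteq> Q" "0 < measure (leb n) K"
  shows "centroid n K \<in> rint n Q"
proof (rule ccontr)
  define c where "c = centroid n K"
  assume "\<not> ?thesis"
  then have c: "c \<notin> rint n Q" by (simp add: c_def)
  have cR: "c \<in> Rn n" by (simp add: c_def)
  have Kb: "bounded K" using Q(2) K(2) by (rule bounded_subset)
  have KR: "K \<subseteq> Rn n" using K(2) Q(3) by blast
  obtain x0 where x0: "x0 \<in> rint n Q" using Q(5) by blast
  then have x0R: "x0 \<in> Rn n" and x0Q: "x0 \<in> Q" using rint_subset by (auto simp: rint_def)
  have "\<exists>a\<in>Rn n. a \<noteq> 0 \<and> (\<forall>x\<in>(\<lambda>x. x - c) ` rint n Q. 0 \<le> a \<bullet> x)"
  proof (rule separating_hyperplane_Rn_0[OF _ _ _ n])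
    show "convex ((\<lambda>x. x - c) ` rint n Q)"
      using convex_rint[OF Q(4,3)] by (simp add: convex_translation_subtract)
    show "(\<lambda>x. x - c) ` rint n Q \<subseteq> Rn n" using cR by (auto simp: rint_def)
    show "0 \<notin> (\<lambda>x. x - c) ` rint n Q" using c by auto
  qed
  then obtain a where a: "a \<in> Rn n" "a \<noteq> 0" "\<And>x. x \<in> rint n Q \<Longrightarrow> 0 \<le> a \<bullet> (x - c)" by auto
  have pos: "0 < a \<bullet> (x - c)" if x: "x \<in> rint n Q" for x
  proof -
    obtain e where e: "e > 0" "Rn n \<inter> ball x e \<subseteq> Q" and xR: "x \<in> Rn n" using x by (auto simp: rint_def)
    \<comment> \<open>Moving x by \<open>e / 2\<close> against \<open>a\<close> stays in the
      relative interior and lowers the affine function, so weak separation becomes strict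
      there.\<close>
    define y where "y = x - (e / 2 / norm a) *\<^sub>R a"
    have "y \<in> rint n Q"
      unfolding rint_def
    proof (intro CollectI conjI exI[of _ "e / 2"] subsetI)
      fix w assume w: "w \<in> Rn n \<inter> ball y (e / 2)"
      have "dist x y = e / 2" using a(2) e(1) by (simp add: y_def dist_norm)
      then have "dist x w < e" using w dist_triangle[of x w y] by auto
      then show "w \<in> Q" using w e(2) by auto
    qed (use e xR a in \<open>auto simp: y_def\<close>)
    from a(3)[OF this] have "e / 2 / norm a * (a \<bullet> a) \<le> a \<bullet> (x - c)"
      by (simp add: y_def inner_diff_right)
    moreover have "0 < a \<bullet> a" using a(2) by simp
    then have "0 < e / 2 / norm a * (a \<bullet> a)" using a(2) e(1) by (intro mult_pos_pos divide_pos_pos) auto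
    ultimately show ?thesis by linarith
  qed
  \<comment> \<open>If the affine function were negative at x, it would vanish on the segment to x0,
    at \<open>t = - p / (q - p)\<close>. By \<open>rint_mix\<close> that point is in the relative
    interior, where the function is positive.\<close>
  have nonneg: "0 \<le> a \<bullet> (x - c)" if "x \<in> Q" for x
  proof (rule ccontr)
    assume neg: "\<not> 0 \<le> a \<bullet> (x - c)"
    define p where "p = a \<bullet> (x - c)" define q where "q = a \<bullet> (x0 - c)"
    have q: "0 < q" using pos[OF x0] by (simp add: q_def)
    define t where "t = - p / (q - p)"
    have p: "p < 0" using neg by (simp add: p_def)
    have t: "0 < t" using p q by (simp add: t_def divide_neg_pos)
    have t1: "t \<le> 1" unfolding t_def using p q by (subst pos_divide_le_eq) auto
    have "(1 - t) *\<^sub>R x + t *\<^sub>R x0 \<in> rint n Q" using rint_mix[OF Q(4,3) that x0 t t1] .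
    from pos[OF this] have "0 < a \<bullet> ((1 - t) *\<^sub>R x + t *\<^sub>R x0 - c)" .
    also have "(1 - t) *\<^sub>R x + t *\<^sub>R x0 - c = (1 - t) *\<^sub>R (x - c) + t *\<^sub>R (x0 - c)" by (simp add: algebra_simps)
    also have "a \<bullet> \<dots> = (1 - t) * p + t * q" by (simp add: inner_add_right p_def q_def)
    also have "\<dots> = p + t * (q - p)" by (simp add: algebra_simps)
    also have "\<dots> = 0" using p q by (simp add: t_def)
    finally show False by simp
  qed
  define v where "v = measure (leb n) Q"
  have "measure (leb n) K \<le> v"
    unfolding v_def using K Q emeasure_leb_bounded[OF Q(2)]
    by (intro measure_mono_fmeasurable) (auto simp: fmeasurable_def)
  then have v: "0 < v" using K(3) by simp
  \<comment> \<open>\<open>t\<close> is taken so close to 1 that the copy has more volume than Q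
    minus K; then the copy and K cannot be almost disjoint inside Q.\<close>
  have "((\<lambda>t::real. t ^ n * v) \<longlongrightarrow> 1 ^ n * v) (at_left 1)"
    by (intro tendsto_intros)
  then have "\<forall>\<^sub>F t in at_left (1::real). v - measure (leb n) K < t ^ n * v"
    using K(3) by (intro order_tendstoD) auto
  moreover have "\<forall>\<^sub>F t in at_left (1::real). t \<in> {0<..<1}"
    by (rule eventually_at_left_real) simp
  ultimately have "\<forall>\<^sub>F t in at_left (1::real). v - measure (leb n) K < t ^ n * v \<and> t \<in> {0<..<1}"
    by (rule eventually_conj)
  then obtain t where t: "v - measure (leb n) K < t ^ n * v" "0 < t" "t < 1"
    using eventually_happens[of _ "at_left (1::real)"] by force
  define Qt where "Qt = {y. x0 + (1 / t) *\<^sub>R (y - x0) \<in> Q}"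
  have Qt: "Qt \<in> sets borel" "measure (leb n) Qt = t ^ n * v"
    unfolding Qt_def v_def by (rule measure_leb_homothety[OF Q(1,2) x0R t(2)])+
  have Qt_rint: "Qt \<subseteq> rint n Q"
  proof
    fix y assume "y \<in> Qt"
    then have "x0 + (1 / t) *\<^sub>R (y - x0) \<in> Q" by (simp add: Qt_def)
    from rint_mix[OF Q(4,3) this x0, of "1 - t"]
    have "t *\<^sub>R (x0 + (1 / t) *\<^sub>R (y - x0)) + (1 - t) *\<^sub>R x0 \<in> rint n Q" using t by simp
    also have "t *\<^sub>R (x0 + (1 / t) *\<^sub>R (y - x0)) + (1 - t) *\<^sub>R x0 = y"
      using t by (simp add: algebra_simps)
    finally show "y \<in> rint n Q" .
  qed
  have K0: "(\<integral>x. indicator K x * (a \<bullet> (x - c)) \<partial>leb n) = 0"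
    unfolding c_def using K(3) by (intro integral_inner_centroid[OF K(1) Kb KR]) simp
  obtain b where b: "\<And>x. x \<in> K \<Longrightarrow> norm x \<le> b" using Kb by (auto simp: bounded_iff)
  have "integrable (leb n) (\<lambda>x. indicator K x * (a \<bullet> (x - c)))"
  proof (rule integrable_on_bounded_leb[OF K(1) Kb])
    show "(\<lambda>x. a \<bullet> (x - c)) \<in> borel_measurable borel"
      by (intro borel_measurable_continuous_onI continuous_intros)
    fix x assume "x \<in> K"
    have "\<bar>a \<bullet> (x - c)\<bar> \<le> norm a * norm (x - c)" by (rule Cauchy_Schwarz_ineq2)
    also have "\<dots> \<le> norm a * (b + norm c)"
      using b[OF \<open>x \<in> K\<close>] norm_triangle_ineq4[of x c] by (intro mult_left_mono) auto
    finally show "\<bar>a \<bullet> (x - c)\<bar> \<le> norm a * (b + norm c)" .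
  qed
  then have "AE x in leb n. indicator K x * (a \<bullet> (x - c)) = 0"
    using K0 nonneg K(2) by (subst (asm) integral_nonneg_eq_0_iff_AE) (auto split: split_indicator)
  then have "AE x in leb n. x \<notin> K \<inter> Qt"
  proof (rule AE_mp, intro AE_I2 impI)
    fix x assume "indicator K x * (a \<bullet> (x - c)) = 0"
    then show "x \<notin> K \<inter> Qt" using pos[of x] Qt_rint by auto
  qed
  then have null: "measure (leb n) (K \<inter> Qt) = 0"
    using K(1) Qt(1) by (subst (asm) AE_iff_measurable[where N="K \<inter> Qt"]) (auto simp: measure_def)
  have QtQ: "Qt \<subseteq> Q" using Qt_rint rint_subset by blast
  have "K \<in> fmeasurable (leb n)" "Qt \<in> fmeasurable (leb n)" "Q \<in> fmeasurable (leb n)"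
    using K(1) Qt(1) Q(1) emeasure_leb_bounded[OF Kb] emeasure_leb_bounded[OF bounded_subset[OF Q(2) QtQ]]
      emeasure_leb_bounded[OF Q(2)] by (auto simp: fmeasurable_def)
  then have "measure (leb n) K + measure (leb n) Qt = measure (leb n) (K \<union> Qt)"
    using null by (simp add: measure_Un3)
  also have "\<dots> \<le> v"
    unfolding v_def using K Qt Q QtQ \<open>Q \<in> fmeasurable (leb n)\<close>
    by (intro measure_mono_fmeasurable) auto
  finally show False using t Qt by simp
qed

section \<open>Convex minimisation\<close>

lemma norm_convex_combination:
  fixes x y :: "'a::real_inner"
  shows "(norm ((1 - t) *\<^sub>R x + t *\<^sub>R y))\<^sup>2 = (1 - t) * (norm x)\<^sup>2 + t * (norm y)\<^sup>2 - t * (1 - t) * (norm (x - y))\<^sup>2"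
  unfolding power2_norm_eq_inner by (simp add: inner_simps inner_commute algebra_simps)

lemma strongly_convex_onD:
  "strongly_convex_on A \<mu> f \<Longrightarrow> x \<in> A \<Longrightarrow> y \<in> A \<Longrightarrow> 0 \<le> t \<Longrightarrow> t \<le> 1 \<Longrightarrow>
    f ((1 - t) *\<^sub>R x + t *\<^sub>R y) \<le> (1 - t) * f x + t * f y - \<mu> / 2 * t * (1 - t) * (norm (x - y))\<^sup>2"
  by (auto simp: strongly_convex_on_def)

lemma strongly_convex_on_imp_convex_on:
  assumes "strongly_convex_on A \<mu> f" "0 \<le> \<mu>"
  shows "convex_on A f"
proof (rule convex_onI)
  fix t x y assume "0 < t" "t < (1::real)" "x \<in> A" "y \<in> A"
  then have "f ((1 - t) *\<^sub>R x + t *\<^sub>R y) \<le> (1 - t) * f x + t * f y - \<mu> / 2 * t * (1 - t) * (norm (x - y))\<^sup>2"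
    using assms(1) by (intro strongly_convex_onD) auto
  moreover have "0 \<le> \<mu> / 2 * t * (1 - t) * (norm (x - y))\<^sup>2"
    using assms(2) \<open>0 < t\<close> \<open>t < 1\<close> by simp
  ultimately show "f ((1 - t) *\<^sub>R x + t *\<^sub>R y) \<le> (1 - t) * f x + t * f y" by linarith
qed (use assms in \<open>simp add: strongly_convex_on_def\<close>)

lemma convex_on_imp_strongly_convex_on: "convex_on A f \<Longrightarrow> strongly_convex_on A 0 f"
  by (auto simp: strongly_convex_on_def convex_on_imp_convex intro: convex_onD)

lemma strongly_convex_on_add:
  assumes "strongly_convex_on A \<mu> f" "strongly_convex_on A \<nu> g"
  shows "strongly_convex_on A (\<mu> + \<nu>) (\<lambda>x. f x + g x)"
  unfolding strongly_convex_on_def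
proof (intro conjI ballI)
  fix x y t assume "x \<in> A" "y \<in> A" "t \<in> {0..1::real}"
  then show "f ((1 - t) *\<^sub>R x + t *\<^sub>R y) + g ((1 - t) *\<^sub>R x + t *\<^sub>R y)
      \<le> (1 - t) * (f x + g x) + t * (f y + g y) - (\<mu> + \<nu>) / 2 * t * (1 - t) * (norm (x - y))\<^sup>2"
    using strongly_convex_onD[OF assms(1), of x y t] strongly_convex_onD[OF assms(2), of x y t]
    by (simp add: algebra_simps add_divide_distrib)
qed (use assms in \<open>simp add: strongly_convex_on_def\<close>)

lemma strongly_convex_on_cmult:
  assumes "strongly_convex_on A \<mu> f" "0 \<le> c"
  shows "strongly_convex_on A (c * \<mu>) (\<lambda>x. c * f x)"
  unfolding strongly_convex_on_def
proof (intro conjI ballI)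
  fix x y t assume "x \<in> A" "y \<in> A" "t \<in> {0..1::real}"
  then show "c * f ((1 - t) *\<^sub>R x + t *\<^sub>R y)
      \<le> (1 - t) * (c * f x) + t * (c * f y) - c * \<mu> / 2 * t * (1 - t) * (norm (x - y))\<^sup>2"
    using mult_left_mono[OF strongly_convex_onD[OF assms(1), of x y t] assms(2)]
    by (simp add: algebra_simps)
qed (use assms in \<open>simp add: strongly_convex_on_def\<close>)

lemma strongly_convex_on_norm_diff:
  assumes "convex A"
  shows "strongly_convex_on A (2 * c) (\<lambda>x. c * (norm (x - v))\<^sup>2)"
  unfolding strongly_convex_on_def
proof (intro conjI ballI assms)
  fix x y t
  have "(1 - t) *\<^sub>R x + t *\<^sub>R y - v = (1 - t) *\<^sub>R (x - v) + t *\<^sub>R (y - v)"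
    by (simp add: algebra_simps)
  then show "c * (norm ((1 - t) *\<^sub>R x + t *\<^sub>R y - v))\<^sup>2
    \<le> (1 - t) * (c * (norm (x - v))\<^sup>2) + t * (c * (norm (y - v))\<^sup>2) - 2 * c / 2 * t * (1 - t) * (norm (x - y))\<^sup>2"
    by (simp add: norm_convex_combination) (simp add: algebra_simps)
qed

lemma strongly_convex_on_inner:
  assumes "convex A"
  shows "strongly_convex_on A 0 (\<lambda>x. g \<bullet> x)"
  unfolding strongly_convex_on_def using assms by (auto simp: inner_simps)

text \<open>Compare x with the point at parameter t on the way to y and divide the strong convexity
  inequality by t. For positive t a factor 1 - t is lost; it disappears in the limit t to 0.\<close>

lemma strongly_convex_on_argmin:
  assumes f: "strongly_convex_on A \<mu> f" and x: "x \<in> A" "\<And>y. y \<in> A \<Longrightarrow> f x \<le> f y" and y: "y \<in> A"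
  shows "f x + \<mu> / 2 * (norm (y - x))\<^sup>2 \<le> f y"
proof -
  have cA: "convex A" using f by (simp add: strongly_convex_on_def)
  have *: "f x + \<mu> / 2 * (1 - t) * (norm (y - x))\<^sup>2 \<le> f y" if t: "0 < t" "t \<le> 1" for t
  proof -
    have "f x \<le> f ((1 - t) *\<^sub>R x + t *\<^sub>R y)"
      using cA x y t by (intro x(2)) (simp add: convex_alt)
    also have "\<dots> \<le> (1 - t) * f x + t * f y - \<mu> / 2 * t * (1 - t) * (norm (x - y))\<^sup>2"
      using t by (intro strongly_convex_onD[OF f] x y) auto
    finally have "t * (f x + \<mu> / 2 * (1 - t) * (norm (y - x))\<^sup>2) \<le> t * f y"
      by (simp add: algebra_simps norm_minus_commute)
    then show ?thesis using t by simp
  qed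
  have "((\<lambda>t. f x + \<mu> / 2 * (1 - t) * (norm (y - x))\<^sup>2) \<longlongrightarrow> f x + \<mu> / 2 * (1 - 0) * (norm (y - x))\<^sup>2) (at_right 0)"
    by (intro tendsto_intros)
  moreover have "\<forall>\<^sub>F t in at_right (0::real). t \<in> {0<..<1}"
    by (rule eventually_at_right_real) simp
  then have "\<forall>\<^sub>F t in at_right 0. f x + \<mu> / 2 * (1 - t) * (norm (y - x))\<^sup>2 \<le> f y"
    by eventually_elim (intro *, auto)
  ultimately show ?thesis
    using tendsto_upperbound[OF _ _ trivial_limit_at_right_real] by fastforce
qed

text \<open>Continuity gives f \<ge> f 0 - 1 near 0, and strong convexity along rays turns this into
  f \<ge> f 0 outside a ball of Rn; inside the ball compactness applies.\<close>

lemma strongly_convex_attains_inf_Rn: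
  assumes f: "strongly_convex_on (Rn m) \<mu> f" "0 < \<mu>" "continuous_on (Rn m) f"
  shows "\<exists>x. is_arg_min f (\<lambda>x. x \<in> Rn m) x"
proof -
  have "\<forall>\<^sub>F y in at 0 within Rn m. f 0 - 1 < f y"
    using f(3) by (intro order_tendstoD(1)[of f "f 0"]) (auto simp: continuous_on)
  then obtain d where d: "0 < d" "\<And>y. y \<in> Rn m \<Longrightarrow> y \<noteq> 0 \<Longrightarrow> dist y 0 < d \<Longrightarrow> f 0 - 1 < f y"
    by (auto simp: eventually_at)
  define e where "e = d / 2"
  have e: "0 < e" "\<And>y. y \<in> Rn m \<Longrightarrow> norm y \<le> e \<Longrightarrow> f 0 - 1 \<le> f y"
  proof -
    show "0 < e" using d by (simp add: e_def)
    show "f 0 - 1 \<le> f y" if "y \<in> Rn m" "norm y \<le> e" for y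
      using d(1) d(2)[of y] that by (cases "y = 0") (auto simp: e_def)
  qed
  \<comment> \<open>On the ray to y at most 1 is lost up to norm \<open>e\<close>. The quadratic
    term \<mu> / 2 * e * (norm y - e) makes up for this from norm y = R on.\<close>
  define R where "R = e + 2 / (\<mu> * e)"
  have far: "f 0 \<le> f y" if y: "y \<in> Rn m" "R \<le> norm y" for y
  proof -
    have Re: "e < R" using e f by (simp add: R_def)
    define t where "t = e / norm y"
    have ny: "0 < norm y" using Re y e by linarith
    have t: "0 < t" "t \<le> 1" using ny Re y e by (simp_all add: t_def divide_le_eq)
    have "f 0 - 1 \<le> f (t *\<^sub>R y)"
      using y ny e(1) by (intro e) (auto simp: t_def)
    also have "t *\<^sub>R y = (1 - t) *\<^sub>R 0 + t *\<^sub>R y" by simp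
    also have "f \<dots> \<le> (1 - t) * f 0 + t * f y - \<mu> / 2 * t * (1 - t) * (norm (0 - y))\<^sup>2"
      using t y by (intro strongly_convex_onD[OF f(1)]) auto
    finally have 1: "t * (f 0 - f y) \<le> 1 - t * (\<mu> / 2 * (1 - t) * (norm y)\<^sup>2)"
      by (simp add: algebra_simps)
    have "2 \<le> \<mu> * e * (norm y - e)"
    proof -
      have "2 / (\<mu> * e) \<le> norm y - e" using y by (simp add: R_def)
      then show ?thesis using f e by (simp add: pos_divide_le_eq mult.commute)
    qed
    also have "\<dots> = 2 * (t * (\<mu> / 2 * (1 - t) * (norm y)\<^sup>2))"
      using ny by (simp add: t_def power2_eq_square field_simps)
    finally have "t * (f 0 - f y) \<le> 0" using 1 by linarith
    then show ?thesis using t by (simp add: mult_le_0_iff)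
  qed
  let ?B = "Rn m \<inter> cball 0 \<bar>R\<bar>"
  have "compact ?B" by (rule compact_Rn) (auto intro: bounded_subset[OF bounded_cball])
  then obtain x where x: "x \<in> ?B" "\<And>y. y \<in> ?B \<Longrightarrow> f x \<le> f y"
  proof -
    have "0 \<in> ?B" by simp
    then have "?B \<noteq> {}" by blast
    then show ?thesis
      using continuous_attains_inf[OF \<open>compact ?B\<close> _ continuous_on_subset[OF f(3)]] that by blast
  qed
  have "f x \<le> f y" if "y \<in> Rn m" for y
  proof (cases "norm y \<le> \<bar>R\<bar>")
    case True
    then show ?thesis using that by (intro x) auto
  next
    case False
    then have "f 0 \<le> f y" using that by (intro far) auto
    moreover have "f x \<le> f 0" by (intro x) auto
    ultimately show ?thesis by linarith
  qed
  then show ?thesis using x(1) by (auto simp: is_arg_min_linorder)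
qed

text \<open>Only the two inequalities that the accelerated analysis uses are recorded, the lower one
  standing for convexity. \<open>G\<close> is just the field of vectors that the oracle returns,
  which makes affine substitution easy.\<close>

definition smooth_on :: "'a::real_inner set \<Rightarrow> ('a \<Rightarrow> 'a) \<Rightarrow> real \<Rightarrow> ('a \<Rightarrow> real) \<Rightarrow> bool" where
  "smooth_on V G M p \<longleftrightarrow> (\<forall>w\<in>V. \<forall>u\<in>V. p w + G w \<bullet> (u - w) \<le> p u \<and>
     p u \<le> p w + G w \<bullet> (u - w) + M / 2 * (norm (u - w))\<^sup>2)"

lemma smooth_onD:
  assumes "smooth_on V G M p" "w \<in> V" "u \<in> V"
  shows "p w + G w \<bullet> (u - w) \<le> p u" "p u \<le> p w + G w \<bullet> (u - w) + M / 2 * (norm (u - w))\<^sup>2"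
  using assms by (auto simp: smooth_on_def)

text \<open>The potential made of A times the excess over u and (1 + A \<beta>) / 2 times the
  squared distance from v to u does not increase. Since y' - w = (a / (A + a)) (v' - v), the
  condition \<open>M * a\<^sup>2 \<le> A + a\<close> lets the proximal term absorb the smoothness
  error. The point u is arbitrary, not only a minimiser, because sliding uses the bound at every
  u.\<close>

lemma accelerated_composite_step:
  fixes V :: "'a::real_inner set"
  assumes V: "convex V" and Q: "smooth_on V G M Q" and s: "strongly_convex_on V \<beta> s" "0 \<le> \<beta>"
    and A: "0 \<le> A" "0 < a" "M * a\<^sup>2 \<le> A + a" and mem: "y \<in> V" "v \<in> V" "v' \<in> V" "u \<in> V"
    and w: "w = (1 / (A + a)) *\<^sub>R (A *\<^sub>R y + a *\<^sub>R v)"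
    and y': "y' = (1 / (A + a)) *\<^sub>R (A *\<^sub>R y + a *\<^sub>R v')"
    and v': "\<And>x. x \<in> V \<Longrightarrow> a * (G w \<bullet> v') + a * s v' + (1 + A * \<beta>) / 2 * (norm (v' - v))\<^sup>2
      \<le> a * (G w \<bullet> x) + a * s x + (1 + A * \<beta>) / 2 * (norm (x - v))\<^sup>2"
  shows "y' \<in> V"
    and "(A + a) * (Q y' + s y' - (Q u + s u)) + (1 + (A + a) * \<beta>) / 2 * (norm (v' - u))\<^sup>2
      \<le> A * (Q y + s y - (Q u + s u)) + (1 + A * \<beta>) / 2 * (norm (v - u))\<^sup>2"
proof -
  define B where "B = A + a"
  have B: "0 < B" using A by (simp add: B_def)
  define t where "t = a / B"
  have t: "0 \<le> t" "t \<le> 1" "B * t = a" "B * (1 - t) = A"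
    using A B by (auto simp: t_def B_def field_simps)
  have t1: "1 - t = A / B" using B t by (simp add: field_simps)
  have yc: "y' = (1 - t) *\<^sub>R y + t *\<^sub>R v'"
    unfolding y' t1 by (simp add: t_def B_def scaleR_add_right)
  have wc: "w = (1 - t) *\<^sub>R y + t *\<^sub>R v"
    unfolding w t1 by (simp add: t_def B_def scaleR_add_right)
  show y'V: "y' \<in> V" unfolding yc using V mem t by (simp add: convex_alt)
  have wV: "w \<in> V" unfolding wc using V mem t by (simp add: convex_alt)
  have d: "y' - w = t *\<^sub>R (v' - v)" by (simp add: yc wc algebra_simps)
  have d2: "y' - w = (1 - t) *\<^sub>R (y - w) + t *\<^sub>R (v' - w)" by (simp add: yc algebra_simps)
  have "Q y' \<le> Q w + G w \<bullet> (y' - w) + M / 2 * (norm (y' - w))\<^sup>2"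
    by (rule smooth_onD(2)[OF Q wV y'V])
  also have "G w \<bullet> (y' - w) = (1 - t) * (G w \<bullet> (y - w)) + t * (G w \<bullet> (v' - w))"
    by (simp add: d2 inner_add_right)
  also have "(norm (y' - w))\<^sup>2 = t\<^sup>2 * (norm (v' - v))\<^sup>2"
    by (simp add: d power_mult_distrib)
  finally have Q1: "B * Q y' \<le> B * (Q w + ((1 - t) * (G w \<bullet> (y - w)) + t * (G w \<bullet> (v' - w))) + M / 2 * (t\<^sup>2 * (norm (v' - v))\<^sup>2))"
    using B by simp
  also have "\<dots> = (B * (1 - t)) * (Q w + G w \<bullet> (y - w)) + (B * t) * (Q w + G w \<bullet> (v' - w)) + (M * t * (B * t)) / 2 * (norm (v' - v))\<^sup>2"
    by (simp add: algebra_simps power2_eq_square)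
  also have "\<dots> = A * (Q w + G w \<bullet> (y - w)) + a * (Q w + G w \<bullet> (v' - w)) + (M * t * a) / 2 * (norm (v' - v))\<^sup>2"
    by (simp only: t(3,4))
  also have "\<dots> \<le> A * Q y + a * (Q w + G w \<bullet> (v' - w)) + 1 / 2 * (norm (v' - v))\<^sup>2"
  proof -
    have "M * t * a \<le> 1" using A B by (simp add: t_def B_def power2_eq_square divide_le_eq mult_ac)
    then have "(M * t * a) / 2 * (norm (v' - v))\<^sup>2 \<le> 1 / 2 * (norm (v' - v))\<^sup>2"
      by (intro mult_right_mono) auto
    moreover have "A * (Q w + G w \<bullet> (y - w)) \<le> A * Q y"
      using A by (intro mult_left_mono smooth_onD(1)[OF Q wV]) (auto simp: mem)
    ultimately show ?thesis by linarith
  qed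
  finally have Q2: "B * Q y' \<le> A * Q y + a * (Q w + G w \<bullet> (v' - w)) + 1 / 2 * (norm (v' - v))\<^sup>2" .
  have "s y' \<le> (1 - t) * s y + t * s v'"
    unfolding yc using strongly_convex_on_imp_convex_on[OF s] mem t by (intro convex_onD) auto
  then have "B * s y' \<le> B * ((1 - t) * s y + t * s v')" using B by simp
  also have "\<dots> = (B * (1 - t)) * s y + (B * t) * s v'" by (simp add: algebra_simps)
  finally have s1: "B * s y' \<le> A * s y + a * s v'" by (simp only: t(3,4))
  \<comment> \<open>The proximal objective has modulus a \<beta> + (1 + A \<beta>) = 1 + (A + a)
    \<beta>, which is exactly the distance coefficient of the new potential.\<close>
  let ?f = "\<lambda>x. a * (G w \<bullet> x) + a * s x + (1 + A * \<beta>) / 2 * (norm (x - v))\<^sup>2"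
  have "strongly_convex_on V (a * 0 + a * \<beta> + 2 * ((1 + A * \<beta>) / 2)) ?f"
    by (intro strongly_convex_on_add strongly_convex_on_cmult strongly_convex_on_inner strongly_convex_on_norm_diff V s)
       (use A in auto)
  moreover have "a * 0 + a * \<beta> + 2 * ((1 + A * \<beta>) / 2) = 1 + B * \<beta>"
    by (simp add: B_def algebra_simps)
  ultimately have "strongly_convex_on V (1 + B * \<beta>) ?f" by (simp only:)
  from strongly_convex_on_argmin[OF this mem(3) v' mem(4)]
  have 3: "?f v' + (1 + B * \<beta>) / 2 * (norm (v' - u))\<^sup>2 \<le> ?f u"
    by (simp only: norm_minus_commute[of v' u])
  have "a * (Q w + G w \<bullet> (u - w)) \<le> a * Q u"
    using A by (intro mult_left_mono smooth_onD(1)[OF Q wV mem(4)]) auto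
  moreover have "(1 / 2) * (norm (v' - v))\<^sup>2 \<le> (1 + A * \<beta>) / 2 * (norm (v' - v))\<^sup>2"
    using A s(2) by (intro mult_right_mono) auto
  moreover have "(norm (v - u))\<^sup>2 = (norm (u - v))\<^sup>2" by (simp add: norm_minus_commute)
  moreover have "B * Q u = A * Q u + a * Q u" "B * s u = A * s u + a * s u" by (simp_all add: B_def algebra_simps)
  moreover have "a * (G w \<bullet> (u - w)) = a * (G w \<bullet> u) - a * (G w \<bullet> w)"
    "a * (G w \<bullet> (v' - w)) = a * (G w \<bullet> v') - a * (G w \<bullet> w)"
    by (simp_all add: inner_diff_right algebra_simps)
  ultimately have "B * (Q y' + s y' - (Q u + s u)) + (1 + B * \<beta>) / 2 * (norm (v' - u))\<^sup>2
      \<le> A * (Q y + s y - (Q u + s u)) + (1 + A * \<beta>) / 2 * (norm (v - u))\<^sup>2"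
    using Q2 s1 3 by (simp only: distrib_left right_diff_distrib)
  then show "(A + a) * (Q y' + s y' - (Q u + s u)) + (1 + (A + a) * \<beta>) / 2 * (norm (v' - u))\<^sup>2
      \<le> A * (Q y + s y - (Q u + s u)) + (1 + A * \<beta>) / 2 * (norm (v - u))\<^sup>2"
    by (simp only: B_def)
qed

section \<open>Gradients relative to Rn\<close>

lemma has_derivative_within_Rn_representation:
  assumes "(f has_derivative D) (at y within Rn m)" "y \<in> Rn m"
  shows "(f has_derivative (\<lambda>v. rvec_of m (\<lambda>i. D (ev i)) \<bullet> v)) (at y within Rn m)"
proof -
  let ?G = "rvec_of m (\<lambda>i. D (ev i))"
  interpret D: bounded_linear D using assms(1) by (rule has_derivative_bounded_linear)
  have eq: "D v = ?G \<bullet> v" if "v \<in> Rn m" for v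
  proof -
    have "D v = D (rvec_of m (coord v))" using that by (simp add: rvec_of_coord)
    also have "\<dots> = (\<Sum>i<m. coord v i * D (ev i))"
      by (simp add: rvec_of_def D.sum D.scaleR)
    also have "\<dots> = v \<bullet> ?G"
      using that by (simp add: inner_Rn)
    finally show ?thesis by (simp add: inner_commute)
  qed
  have "((\<lambda>z. (1 / norm (z - y)) *\<^sub>R (f z - (f y + D (z - y)))) \<longlongrightarrow> 0) (at y within Rn m)"
    using assms(1) by (simp add: has_derivative_within)
  moreover have "\<forall>\<^sub>F z in at y within Rn m. (1 / norm (z - y)) *\<^sub>R (f z - (f y + D (z - y))) =
      (1 / norm (z - y)) *\<^sub>R (f z - (f y + ?G \<bullet> (z - y)))"
    using assms(2) by (auto simp: eventually_at_filter eq)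
  ultimately have "((\<lambda>z. (1 / norm (z - y)) *\<^sub>R (f z - (f y + ?G \<bullet> (z - y)))) \<longlongrightarrow> 0) (at y within Rn m)"
    by (rule Lim_transform_eventually)
  then show ?thesis
    by (simp add: has_derivative_within bounded_linear_inner_right)
qed

lemma has_derivative_along_line:
  assumes "(f has_derivative (\<lambda>v. G \<bullet> v)) (at (w + t *\<^sub>R d) within Rn m)" "w \<in> Rn m" "d \<in> Rn m"
  shows "((\<lambda>t. f (w + t *\<^sub>R d)) has_real_derivative G \<bullet> d) (at t)"
proof -
  have "((\<lambda>t. w + t *\<^sub>R d) has_derivative (\<lambda>h. h *\<^sub>R d)) (at t)"
    by (auto intro!: derivative_eq_intros)
  moreover have "(f has_derivative (\<lambda>v. G \<bullet> v)) (at (w + t *\<^sub>R d) within range (\<lambda>t. w + t *\<^sub>R d))"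
    by (rule has_derivative_subset[OF assms(1)]) (use assms in auto)
  ultimately have "((\<lambda>t. f (w + t *\<^sub>R d)) has_derivative (\<lambda>h. G \<bullet> (h *\<^sub>R d))) (at t)"
    by (rule has_derivative_in_compose)
  then show ?thesis
    by (simp add: has_field_derivative_def mult_commute_abs)
qed

text \<open>Existence comes from representing the derivative by its values on the basis. For
  uniqueness, differentiating along the line in direction G - H shows that both vectors have the
  same inner product with their difference.\<close>

lemma grad_works:
  assumes f: "f differentiable (at y within Rn m)" and y: "y \<in> Rn m"
  shows "grad m f y \<in> Rn m" "(f has_derivative (\<lambda>v. grad m f y \<bullet> v)) (at y within Rn m)"
proof -
  let ?P = "\<lambda>G. G \<in> Rn m \<and> (f has_derivative (\<lambda>v. G \<bullet> v)) (at y within Rn m)"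
  obtain D where "(f has_derivative D) (at y within Rn m)"
    using f by (auto simp: differentiable_def)
  from has_derivative_within_Rn_representation[OF this y]
  have P: "?P (rvec_of m (\<lambda>i. D (ev i)))" by simp
  have unique: "G = H" if "?P G" "?P H" for G H
  proof -
    have d: "G - H \<in> Rn m" using that by auto
    have "((\<lambda>t. f (y + t *\<^sub>R (G - H))) has_real_derivative X \<bullet> (G - H)) (at 0)" if "?P X" for X
      using that y d by (intro has_derivative_along_line) auto
    then have "G \<bullet> (G - H) = H \<bullet> (G - H)" using \<open>?P G\<close> \<open>?P H\<close> DERIV_unique by blast
    then have "(G - H) \<bullet> (G - H) = 0" by (simp add: inner_diff_left)
    then show ?thesis by simp
  qed
  have "?P (grad m f y)"
    unfolding grad_def
  proof (rule theI)
    show "G = rvec_of m (\<lambda>i. D (ev i))" if "?P G" for G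
      using that P by (rule unique)
  qed (rule P)
  then show "grad m f y \<in> Rn m" "(f has_derivative (\<lambda>v. grad m f y \<bullet> v)) (at y within Rn m)" by auto
qed

lemma grad_uminus:
  assumes f: "f differentiable (at y within Rn m)" and y: "y \<in> Rn m"
  shows "grad m (\<lambda>y. - f y) y = - grad m f y"
proof -
  have d: "((\<lambda>y. - f y) has_derivative (\<lambda>v. - grad m f y \<bullet> v)) (at y within Rn m)"
    using has_derivative_minus[OF grad_works(2)[OF f y]] by simp
  then have f': "(\<lambda>y. - f y) differentiable (at y within Rn m)" by (auto simp: differentiable_def)
  define e where "e = grad m (\<lambda>y. - f y) y - (- grad m f y)"
  have e: "e \<in> Rn m" unfolding e_def by (intro Rn_closed grad_works f f' y)
  have "((\<lambda>t. - f (y + t *\<^sub>R e)) has_real_derivative grad m (\<lambda>y. - f y) y \<bullet> e) (at 0)"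
    using grad_works(2)[OF f' y] y e by (intro has_derivative_along_line) auto
  moreover have "((\<lambda>t. - f (y + t *\<^sub>R e)) has_real_derivative (- grad m f y) \<bullet> e) (at 0)"
    using d y e by (intro has_derivative_along_line) auto
  ultimately have "grad m (\<lambda>y. - f y) y \<bullet> e = (- grad m f y) \<bullet> e" by (rule DERIV_unique)
  then have "e \<bullet> e = 0" unfolding e_def by (simp add: inner_diff_left inner_add_left)
  then have "e = 0" by simp
  then show ?thesis by (simp add: e_def eq_neg_iff_add_eq_0)
qed

text \<open>The constant \<open>2 * L\<close> comes from the mean value theorem; integration would give \<open>L\<close>.\<close>

lemma smooth_on_grad:
  assumes f: "\<And>y. y \<in> Rn m \<Longrightarrow> f differentiable (at y within Rn m)"
    and L: "L-lipschitz_on (Rn m) (grad m f)" and cvx: "convex_on (Rn m) f"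
  shows "smooth_on (Rn m) (grad m f) (2 * L) f"
  unfolding smooth_on_def
proof (intro ballI)
  fix w u assume w: "w \<in> Rn m" and u: "u \<in> Rn m"
  define d where "d = u - w"
  have d: "d \<in> Rn m" using w u by (simp add: d_def)
  have line: "w + t *\<^sub>R d \<in> Rn m" for t using w d by simp
  define \<phi> where "\<phi> = (\<lambda>t. f (w + t *\<^sub>R d))"
  have der: "(\<phi> has_real_derivative grad m f (w + t *\<^sub>R d) \<bullet> d) (at t)" for t
    unfolding \<phi>_def by (rule has_derivative_along_line[OF grad_works(2)[OF f[OF line] line] w d])
  have \<phi>01: "\<phi> 0 = f w" "\<phi> 1 = f u" by (auto simp: \<phi>_def d_def)
  have "convex_on UNIV \<phi>"
  proof (rule convex_onI)
    fix t x y :: real assume t: "0 < t" "t < 1"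
    have "w + ((1 - t) *\<^sub>R x + t *\<^sub>R y) *\<^sub>R d = (1 - t) *\<^sub>R (w + x *\<^sub>R d) + t *\<^sub>R (w + y *\<^sub>R d)"
      by (simp add: algebra_simps)
    then show "\<phi> ((1 - t) *\<^sub>R x + t *\<^sub>R y) \<le> (1 - t) * \<phi> x + t * \<phi> y"
      unfolding \<phi>_def using t convex_onD[OF cvx _ _ line line, of t x y] by simp
  qed simp
  then have "grad m f (w + 0 *\<^sub>R d) \<bullet> d * (1 - 0) \<le> \<phi> 1 - \<phi> 0"
    using der[of 0] by (intro convex_on_imp_above_tangent[of UNIV]) auto
  moreover have "\<exists>z>0. z < 1 \<and> \<phi> 1 - \<phi> 0 = (1 - 0) * (grad m f (w + z *\<^sub>R d) \<bullet> d)"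
    by (rule MVT2) (auto intro: der)
  then obtain z where z: "0 < z" "z < 1" "\<phi> 1 - \<phi> 0 = grad m f (w + z *\<^sub>R d) \<bullet> d" by auto
  moreover have "(grad m f (w + z *\<^sub>R d) - grad m f w) \<bullet> d \<le> L * (norm d)\<^sup>2"
  proof -
    have "(grad m f (w + z *\<^sub>R d) - grad m f w) \<bullet> d \<le> norm (grad m f (w + z *\<^sub>R d) - grad m f w) * norm d"
      by (rule norm_cauchy_schwarz)
    also have "norm (grad m f (w + z *\<^sub>R d) - grad m f w) \<le> L * norm (z *\<^sub>R d)"
      using lipschitz_onD[OF L line[of z] w] by (simp add: dist_norm)
    also have "\<dots> \<le> L * norm d"
      using z lipschitz_on_nonneg[OF L] by (intro mult_left_mono) (auto intro: mult_left_le_one_le)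
    finally show ?thesis by (simp add: power2_eq_square mult_right_mono mult.assoc)
  qed
  ultimately show "f w + grad m f w \<bullet> (u - w) \<le> f u \<and>
      f u \<le> f w + grad m f w \<bullet> (u - w) + 2 * L / 2 * (norm (u - w))\<^sup>2"
    unfolding \<phi>01 d_def[symmetric] by (auto simp: inner_diff_left)
qed

lemma smooth_on_mono:
  assumes "smooth_on V G M p" "M \<le> M'"
  shows "smooth_on V G M' p"
  unfolding smooth_on_def
proof (intro ballI conjI)
  fix w u assume wu: "w \<in> V" "u \<in> V"
  show "p w + G w \<bullet> (u - w) \<le> p u" by (rule smooth_onD(1)[OF assms(1) wu])
  have "M / 2 * (norm (u - w))\<^sup>2 \<le> M' / 2 * (norm (u - w))\<^sup>2"
    using assms(2) by (intro mult_right_mono) auto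
  then show "p u \<le> p w + G w \<bullet> (u - w) + M' / 2 * (norm (u - w))\<^sup>2"
    using smooth_onD(2)[OF assms(1) wu] by linarith
qed

section \<open>Query programs\<close>

text \<open>Decision trees with one branch for each conceivable answer. Unlike functions of answer
  lists they compose by \<open>bind_prog\<close>, and costs are tracked by induction on the
  tree.\<close>

datatype 'a prog = Done 'a | Query query "rvec \<Rightarrow> 'a prog"

primrec bind_prog :: "'a prog \<Rightarrow> ('a \<Rightarrow> 'b prog) \<Rightarrow> 'b prog" where
  "bind_prog (Done v) f = f v"
| "bind_prog (Query q k) f = Query q (\<lambda>a. bind_prog (k a) f)"

primrec iter_prog :: "nat \<Rightarrow> (nat \<Rightarrow> 's \<Rightarrow> 's prog) \<Rightarrow> 's \<Rightarrow> 's prog" where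
  "iter_prog 0 f s = Done s"
| "iter_prog (Suc k) f s = bind_prog (iter_prog k f s) (f k)"

primrec to_algorithm :: "(rvec \<times> rvec) prog \<Rightarrow> algorithm" where
  "to_algorithm (Done v) as = Return (fst v) (snd v)"
| "to_algorithm (Query q k) as = (case as of [] \<Rightarrow> Ask q | a # as' \<Rightarrow> to_algorithm (k a) as')"

text \<open>A Hoare-style judgement with a separate query budget for each kind. A query that has no
  correct answer must be survived for every vector, as in \<open>answered_by\<close>; so any use of
  an answer's properties requires that a correct answer exists.\<close>

primrec spec :: "(query \<Rightarrow> rvec set) \<Rightarrow> 'a prog \<Rightarrow> (query_kind \<Rightarrow> nat) \<Rightarrow> ('a \<Rightarrow> bool) \<Rightarrow> bool" where
  "spec \<O> (Done v) N P = P v"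
| "spec \<O> (Query q k) N P = (0 < N (kind q) \<and>
     (\<forall>a. (\<O> q \<noteq> {} \<longrightarrow> a \<in> \<O> q) \<longrightarrow> spec \<O> (k a) (N(kind q := N (kind q) - 1)) P))"

lemma spec_mono:
  assumes "spec \<O> p N P" "\<And>\<kappa>. N \<kappa> \<le> N' \<kappa>" "\<And>v. P v \<Longrightarrow> P' v"
  shows "spec \<O> p N' P'"
  using assms
proof (induction p arbitrary: N N')
  case (Query q k)
  have "spec \<O> (k a) (N'(kind q := N' (kind q) - 1)) P'" if a: "\<O> q \<noteq> {} \<longrightarrow> a \<in> \<O> q" for a
  proof (rule Query.IH[OF rangeI])
    show "spec \<O> (k a) (N(kind q := N (kind q) - 1)) P"
      using Query.prems(1) a by (simp only: spec.simps)
    show "(N(kind q := N (kind q) - 1)) \<kappa> \<le> (N'(kind q := N' (kind q) - 1)) \<kappa>" for \<kappa>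
      using Query.prems(2)[of \<kappa>] by (auto intro: diff_le_mono)
  qed (rule Query.prems(3))
  then show ?case
    using Query.prems(1) Query.prems(2)[of "kind q"] by auto
qed auto

lemma spec_bind:
  assumes "spec \<O> p N P" "\<And>v. P v \<Longrightarrow> spec \<O> (f v) N' R"
  shows "spec \<O> (bind_prog p f) (\<lambda>\<kappa>. N \<kappa> + N' \<kappa>) R"
  using assms
proof (induction p arbitrary: N)
  case (Done v)
  then have "spec \<O> (f v) N' R" by simp
  then show ?case by (auto intro: spec_mono)
next
  case (Query q k)
  have "spec \<O> (bind_prog (k a) f) ((\<lambda>\<kappa>. N \<kappa> + N' \<kappa>)(kind q := N (kind q) + N' (kind q) - 1)) R"
    if "\<O> q \<noteq> {} \<longrightarrow> a \<in> \<O> q" for a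
  proof -
    have "spec \<O> (k a) (N(kind q := N (kind q) - 1)) P"
      using Query.prems(1) that by (simp only: spec.simps)
    then have "spec \<O> (bind_prog (k a) f) (\<lambda>\<kappa>. (N(kind q := N (kind q) - 1)) \<kappa> + N' \<kappa>) R"
      by (rule Query.IH[OF rangeI _ Query.prems(2)])
    moreover have "(N(kind q := N (kind q) - 1)) \<kappa> + N' \<kappa> \<le> ((\<lambda>\<kappa>. N \<kappa> + N' \<kappa>)(kind q := N (kind q) + N' (kind q) - 1)) \<kappa>" for \<kappa>
      using Query.prems(1) by auto
    ultimately show ?thesis by (rule spec_mono)
  qed
  then show ?case using Query.prems(1) by auto
qed

lemma spec_iter:
  assumes "Inv 0 s" "\<And>j s. j < k \<Longrightarrow> Inv j s \<Longrightarrow> spec \<O> (f j s) N (Inv (Suc j))"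
  shows "spec \<O> (iter_prog k f s) (\<lambda>\<kappa>. k * N \<kappa>) (Inv k)"
  using assms(2)
proof (induction k)
  case 0
  then show ?case using assms(1) by simp
next
  case (Suc k)
  have "spec \<O> (bind_prog (iter_prog k f s) (f k)) (\<lambda>\<kappa>. k * N \<kappa> + N \<kappa>) (Inv (Suc k))"
    by (rule spec_bind[where P="Inv k"]) (use Suc in auto)
  then show ?case by (simp add: add.commute)
qed

text \<open>The first answer selects a branch, and the remaining ones form a correct run of that
  branch. Query indices shift by one, with index 0 as the extra query of kind
  \<open>kind q\<close>.\<close>

lemma attains_within_to_algorithm:
  assumes "spec \<O> p N (\<lambda>v. good (fst v) (snd v))"
  shows "attains_within \<O> (to_algorithm p) good (\<lambda>\<kappa>. real (N \<kappa>))"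
  unfolding attains_within_def
proof (intro allI impI)
  fix a assume "answered_by \<O> (to_algorithm p) a"
  with assms show "\<exists>K x y. (\<forall>k<K. \<exists>q. to_algorithm p (map a [0..<k]) = Ask q) \<and>
      to_algorithm p (map a [0..<K]) = Return x y \<and> good x y \<and>
      (\<forall>\<kappa>. real (card {k. k < K \<and> (\<exists>q. to_algorithm p (map a [0..<k]) = Ask q \<and> kind q = \<kappa>)}) \<le> real (N \<kappa>))"
  proof (induction p arbitrary: a N)
    case (Done v)
    then show ?case by (intro exI[of _ 0] exI[of _ "fst v"] exI[of _ "snd v"]) auto
  next
    case (Query q f)
    define b where "b = (\<lambda>k. a (Suc k))"
    have shift: "map a [0..<Suc k] = a 0 # map b [0..<k]" for k
      by (simp add: b_def upt_conv_Cons map_Suc_upt[symmetric] comp_def del: upt_Suc)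
    have step: "to_algorithm (Query q f) (map a [0..<Suc k]) = to_algorithm (f (a 0)) (map b [0..<k])" for k
      by (simp only: shift to_algorithm.simps list.case)
    have a0: "\<O> q \<noteq> {} \<longrightarrow> a 0 \<in> \<O> q"
      using Query.prems(2)[unfolded answered_by_def, rule_format, of 0 q] by auto
    have "answered_by \<O> (to_algorithm (f (a 0))) b"
      unfolding answered_by_def
    proof (intro allI impI)
      fix k q' assume "to_algorithm (f (a 0)) (map b [0..<k]) = Ask q' \<and> \<O> q' \<noteq> {}"
      then have "a (Suc k) \<in> \<O> q'"
        using Query.prems(2)[unfolded answered_by_def, rule_format, of "Suc k" q'] step by simp
      then show "b k \<in> \<O> q'" by (simp add: b_def)
    qed
    moreover have "spec \<O> (f (a 0)) (N(kind q := N (kind q) - 1)) (\<lambda>v. good (fst v) (snd v))"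
      using Query.prems(1) a0 by simp
    ultimately have "\<exists>K x y. (\<forall>k<K. \<exists>q. to_algorithm (f (a 0)) (map b [0..<k]) = Ask q) \<and>
      to_algorithm (f (a 0)) (map b [0..<K]) = Return x y \<and> good x y \<and>
      (\<forall>\<kappa>. real (card {k. k < K \<and> (\<exists>q. to_algorithm (f (a 0)) (map b [0..<k]) = Ask q \<and> kind q = \<kappa>)})
        \<le> real ((N(kind q := N (kind q) - 1)) \<kappa>))"
      by (intro Query.IH[OF rangeI])
    then obtain K x y where K: "\<And>k. k < K \<Longrightarrow> \<exists>q. to_algorithm (f (a 0)) (map b [0..<k]) = Ask q"
      "to_algorithm (f (a 0)) (map b [0..<K]) = Return x y" "good x y"
      "\<And>\<kappa>. card {k. k < K \<and> (\<exists>q. to_algorithm (f (a 0)) (map b [0..<k]) = Ask q \<and> kind q = \<kappa>)} \<le> (N(kind q := N (kind q) - 1)) \<kappa>"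
      by (simp only: of_nat_le_iff) blast
    have first: "to_algorithm (Query q f) (map a [0..<0]) = Ask q" by simp
    have "\<exists>q'. to_algorithm (Query q f) (map a [0..<k]) = Ask q'" if "k < Suc K" for k
      using that K(1) by (cases k) (simp_all only: first step, auto)
    moreover have "to_algorithm (Query q f) (map a [0..<Suc K]) = Return x y"
      using K(2) by (simp only: step)
    moreover have "card {k. k < Suc K \<and> (\<exists>q'. to_algorithm (Query q f) (map a [0..<k]) = Ask q' \<and> kind q' = \<kappa>)} \<le> N \<kappa>" for \<kappa>
    proof -
      let ?S = "{k. k < K \<and> (\<exists>q. to_algorithm (f (a 0)) (map b [0..<k]) = Ask q \<and> kind q = \<kappa>)}"
      let ?T = "{k. k < Suc K \<and> (\<exists>q'. to_algorithm (Query q f) (map a [0..<k]) = Ask q' \<and> kind q' = \<kappa>)}"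
      have sub: "?T \<subseteq> (if kind q = \<kappa> then {0} else {}) \<union> Suc ` ?S"
      proof
        fix k assume k: "k \<in> ?T"
        show "k \<in> (if kind q = \<kappa> then {0} else {}) \<union> Suc ` ?S"
        proof (cases k)
          case 0
          then show ?thesis using k first by auto
        next
          case (Suc j)
          then have "j \<in> ?S" using k step[of j] by (simp del: upt_Suc)
          then show ?thesis using Suc by blast
        qed
      qed
      have "card ?T \<le> card ((if kind q = \<kappa> then {0} else {}) \<union> Suc ` ?S)"
        by (rule card_mono[OF _ sub]) simp
      also have "\<dots> \<le> (if kind q = \<kappa> then 1 else 0) + card ?S"
        by (rule order_trans[OF card_Un_le]) (simp add: card_image)
      also have "\<dots> \<le> N \<kappa>"
        using K(4)[of \<kappa>] Query.prems(1) by (auto split: if_splits)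
      finally show ?thesis .
    qed
    ultimately show ?case
      using K(3) by (intro exI[of _ "Suc K"] exI[of _ x] exI[of _ y] conjI allI impI) (simp_all only: of_nat_le_iff)
  qed
qed

lemma attains_within_mono:
  assumes "attains_within \<O> \<A> good N" "\<And>\<kappa>. N \<kappa> \<le> N' \<kappa>"
  shows "attains_within \<O> \<A> good N'"
  unfolding attains_within_def
proof (intro allI impI)
  fix a assume "answered_by \<O> \<A> a"
  then obtain K x y where *: "\<forall>k<K. \<exists>q. \<A> (map a [0..<k]) = Ask q" "\<A> (map a [0..<K]) = Return x y" "good x y"
    "\<And>\<kappa>. real (card {k. k < K \<and> (\<exists>q. \<A> (map a [0..<k]) = Ask q \<and> kind q = \<kappa>)}) \<le> N \<kappa>"
    using assms(1) unfolding attains_within_def by blast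
  show "\<exists>K x y. (\<forall>k<K. \<exists>q. \<A> (map a [0..<k]) = Ask q) \<and> \<A> (map a [0..<K]) = Return x y \<and> good x y \<and>
      (\<forall>\<kappa>. real (card {k. k < K \<and> (\<exists>q. \<A> (map a [0..<k]) = Ask q \<and> kind q = \<kappa>)}) \<le> N' \<kappa>)"
    by (intro exI[of _ K] exI[of _ x] exI[of _ y] conjI allI * order_trans[OF *(4) assms(2)])
qed

text \<open>With A = c k (k + 1) and a = 2 c (k + 1), the sum A + a is the A of the next step, and A
  grows quadratically. The proximal step is a parameter: it is a query to h in one method and free
  in the other.\<close>

definition accelerated_step ::
  "real \<Rightarrow> real \<Rightarrow> (rvec \<Rightarrow> rvec prog) \<Rightarrow> (real \<Rightarrow> real \<Rightarrow> rvec \<Rightarrow> rvec \<Rightarrow> rvec prog) \<Rightarrow> nat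
    \<Rightarrow> rvec \<times> rvec \<Rightarrow> (rvec \<times> rvec) prog" where
  "accelerated_step c \<beta> grd prx k st =
     (let a = 2 * c * (real k + 1); A = c * real k * (real k + 1) in
      bind_prog (grd ((1 / (A + a)) *\<^sub>R (A *\<^sub>R fst st + a *\<^sub>R snd st)))
        (\<lambda>g. bind_prog (prx a (1 + A * \<beta>) g (snd st))
          (\<lambda>v'. Done ((1 / (A + a)) *\<^sub>R (A *\<^sub>R fst st + a *\<^sub>R v'), v'))))"

text \<open>At k = 0 the potential is half the squared distance to u, and it never increases. The
  bound on c gives M a^2 = 4 c M * c (k + 1)^2 \<le> c (k + 1) (k + 2) = A + a.\<close>

lemma spec_accelerated:
  assumes V: "convex V" and Q: "smooth_on V G M Q" and s: "strongly_convex_on V \<beta> s" "0 \<le> \<beta>"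
    and c: "0 < c" "4 * c * M \<le> 1"
    and grd: "\<And>w. w \<in> V \<Longrightarrow> spec \<O> (grd w) Ng (\<lambda>g. g = G w)"
    and prx: "\<And>a b w v. 0 < a \<Longrightarrow> 0 < b \<Longrightarrow> w \<in> V \<Longrightarrow> v \<in> V \<Longrightarrow>
      spec \<O> (prx a b (G w) v) Np (\<lambda>v'. v' \<in> V \<and> (\<forall>x\<in>V. a * (G w \<bullet> v') + a * s v' + b / 2 * (norm (v' - v))\<^sup>2
        \<le> a * (G w \<bullet> x) + a * s x + b / 2 * (norm (x - v))\<^sup>2))"
    and y0: "y0 \<in> V"
  shows "spec \<O> (iter_prog T (accelerated_step c \<beta> grd prx) (y0, y0)) (\<lambda>\<kappa>. T * (Ng \<kappa> + Np \<kappa>))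
    (\<lambda>(y, v). y \<in> V \<and> v \<in> V \<and> (\<forall>u\<in>V. c * real T * (real T + 1) * (Q y + s y - (Q u + s u))
       + (1 + c * real T * (real T + 1) * \<beta>) / 2 * (norm (v - u))\<^sup>2 \<le> 1 / 2 * (norm (y0 - u))\<^sup>2))"
proof (rule spec_iter[where Inv = "\<lambda>T (y, v). y \<in> V \<and> v \<in> V \<and> (\<forall>u\<in>V. c * real T * (real T + 1) * (Q y + s y - (Q u + s u))
       + (1 + c * real T * (real T + 1) * \<beta>) / 2 * (norm (v - u))\<^sup>2 \<le> 1 / 2 * (norm (y0 - u))\<^sup>2)"])
  fix k st
  assume inv: "case st of (y, v) \<Rightarrow> y \<in> V \<and> v \<in> V \<and> (\<forall>u\<in>V. c * real k * (real k + 1) * (Q y + s y - (Q u + s u))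
       + (1 + c * real k * (real k + 1) * \<beta>) / 2 * (norm (v - u))\<^sup>2 \<le> 1 / 2 * (norm (y0 - u))\<^sup>2)"
  obtain y v where st: "st = (y, v)" by (cases st)
  define a where "a = 2 * c * (real k + 1)"
  define A where "A = c * real k * (real k + 1)"
  define w where "w = (1 / (A + a)) *\<^sub>R (A *\<^sub>R y + a *\<^sub>R v)"
  have a: "0 < a" and A: "0 \<le> A" using c(1) by (auto simp: a_def A_def)
  have Aa: "A + a = c * real (Suc k) * (real (Suc k) + 1)" by (simp add: A_def a_def algebra_simps)
  have Ma: "M * a\<^sup>2 \<le> A + a"
  proof -
    have "M * a\<^sup>2 = (4 * c * M) * (c * (real k + 1)\<^sup>2)" by (simp add: a_def power2_eq_square algebra_simps)
    also have "\<dots> \<le> 1 * (c * (real k + 1)\<^sup>2)" using c by (intro mult_right_mono) auto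
    also have "\<dots> \<le> A + a" using c(1) unfolding Aa by (simp add: power2_eq_square algebra_simps)
    finally show ?thesis .
  qed
  have mem: "y \<in> V" "v \<in> V" using inv st by auto
  have IH: "A * (Q y + s y - (Q u + s u)) + (1 + A * \<beta>) / 2 * (norm (v - u))\<^sup>2 \<le> 1 / 2 * (norm (y0 - u))\<^sup>2" if "u \<in> V" for u
    using inv that by (simp add: st A_def)
  have wV: "w \<in> V"
  proof -
    have "w = (A / (A + a)) *\<^sub>R y + (a / (A + a)) *\<^sub>R v" by (simp add: w_def scaleR_add_right)
    also have "\<dots> \<in> V" using A a by (intro convexD[OF V] mem) (auto simp: add_divide_distrib[symmetric])
    finally show ?thesis .
  qed
  have b: "0 < 1 + A * \<beta>" using A s(2) by (simp add: add_pos_nonneg)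
  have "spec \<O> (bind_prog (grd w) (\<lambda>g. bind_prog (prx a (1 + A * \<beta>) g v)
          (\<lambda>v'. Done ((1 / (A + a)) *\<^sub>R (A *\<^sub>R y + a *\<^sub>R v'), v'))))
     (\<lambda>\<kappa>. Ng \<kappa> + (Np \<kappa> + 0))
     (\<lambda>(y', v'). y' \<in> V \<and> v' \<in> V \<and> (\<forall>u\<in>V. (A + a) * (Q y' + s y' - (Q u + s u))
       + (1 + (A + a) * \<beta>) / 2 * (norm (v' - u))\<^sup>2 \<le> 1 / 2 * (norm (y0 - u))\<^sup>2))"
  proof (rule spec_bind[OF grd[OF wV]], rule spec_bind)
    fix g assume "g = G w"
    then show "spec \<O> (prx a (1 + A * \<beta>) g v) Np (\<lambda>v'. v' \<in> V \<and> (\<forall>x\<in>V. a * (G w \<bullet> v') + a * s v' + (1 + A * \<beta>) / 2 * (norm (v' - v))\<^sup>2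
        \<le> a * (G w \<bullet> x) + a * s x + (1 + A * \<beta>) / 2 * (norm (x - v))\<^sup>2))"
      using prx[OF a b wV mem(2)] by simp
  next
    fix g v' assume v': "v' \<in> V \<and> (\<forall>x\<in>V. a * (G w \<bullet> v') + a * s v' + (1 + A * \<beta>) / 2 * (norm (v' - v))\<^sup>2
        \<le> a * (G w \<bullet> x) + a * s x + (1 + A * \<beta>) / 2 * (norm (x - v))\<^sup>2)"
    define y' where "y' = (1 / (A + a)) *\<^sub>R (A *\<^sub>R y + a *\<^sub>R v')"
    note step = accelerated_composite_step[OF V Q s A a Ma mem conjunct1[OF v'] _ w_def y'_def]
    have "y' \<in> V" using v' mem by (intro step(1)[of y]) auto
    moreover have "(A + a) * (Q y' + s y' - (Q u + s u)) + (1 + (A + a) * \<beta>) / 2 * (norm (v' - u))\<^sup>2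
        \<le> 1 / 2 * (norm (y0 - u))\<^sup>2" if u: "u \<in> V" for u
      using step(2)[OF u] v' IH[OF u] by (meson order_trans)
    ultimately show "spec \<O> (Done ((1 / (A + a)) *\<^sub>R (A *\<^sub>R y + a *\<^sub>R v'), v')) (\<lambda>\<kappa>. 0)
      (\<lambda>(y', v'). y' \<in> V \<and> v' \<in> V \<and> (\<forall>u\<in>V. (A + a) * (Q y' + s y' - (Q u + s u))
       + (1 + (A + a) * \<beta>) / 2 * (norm (v' - u))\<^sup>2 \<le> 1 / 2 * (norm (y0 - u))\<^sup>2))"
      using v' unfolding y'_def[symmetric] by simp
  qed
  then show "spec \<O> (accelerated_step c \<beta> grd prx k st) (\<lambda>\<kappa>. Ng \<kappa> + Np \<kappa>)
    (\<lambda>(y, v). y \<in> V \<and> v \<in> V \<and> (\<forall>u\<in>V. c * real (Suc k) * (real (Suc k) + 1) * (Q y + s y - (Q u + s u))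
       + (1 + c * real (Suc k) * (real (Suc k) + 1) * \<beta>) / 2 * (norm (v - u))\<^sup>2 \<le> 1 / 2 * (norm (y0 - u))\<^sup>2))"
    unfolding accelerated_step_def Let_def st fst_conv snd_conv A_def[symmetric] a_def[symmetric] w_def[symmetric] Aa[symmetric]
    by simp
qed (use y0 in simp)

lemma spec_restart:
  assumes "\<And>y. y \<in> V \<Longrightarrow> spec \<O> (stage y) N (\<lambda>y'. y' \<in> V \<and> \<Psi> y' \<le> 1 / 2 * \<Psi> y)" "y0 \<in> V"
  shows "spec \<O> (iter_prog R (\<lambda>_. stage) y0) (\<lambda>\<kappa>. R * N \<kappa>) (\<lambda>y. y \<in> V \<and> \<Psi> y \<le> (1 / 2) ^ R * (\<Psi> y0 :: real))"
proof (rule spec_iter[where Inv="\<lambda>R y. y \<in> V \<and> \<Psi> y \<le> (1 / 2) ^ R * \<Psi> y0"])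
  fix j y assume y: "y \<in> V \<and> \<Psi> y \<le> (1 / 2) ^ j * \<Psi> y0"
  show "spec \<O> (stage y) N (\<lambda>y. y \<in> V \<and> \<Psi> y \<le> (1 / 2) ^ Suc j * \<Psi> y0)"
    by (rule spec_mono[OF assms(1)]) (use y in auto)
qed (use assms in simp)

section \<open>Inner solvers\<close>

definition restarts :: "(rvec \<Rightarrow> (rvec \<times> rvec) prog) \<Rightarrow> nat \<Rightarrow> rvec prog" where
  "restarts stage R = iter_prog R (\<lambda>_ y. bind_prog (stage y) (\<lambda>st. Done (fst st))) 0"

text \<open>A stage leaves an excess of at most (norm (y0 - ys))^2 / (2 c), and quadratic growth
  bounds the squared distance by 2 / \<mu> times the old excess. With c at least 2 / \<mu> the
  excess is halved, however far away the start is.\<close>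

lemma spec_restarts:
  assumes stage: "\<And>y0. y0 \<in> Rn m \<Longrightarrow> spec \<O> (stage y0) N (\<lambda>(y, v). y \<in> Rn m \<and>
      (\<forall>u\<in>Rn m. c * (\<Psi> y - \<Psi> u) \<le> 1 / 2 * (norm (y0 - u))\<^sup>2))"
    and \<Psi>: "strongly_convex_on (Rn m) \<mu> \<Psi>" "0 < \<mu>" "2 / \<mu> \<le> c"
    and ys: "ys \<in> Rn m" "\<And>y. y \<in> Rn m \<Longrightarrow> \<Psi> ys \<le> \<Psi> y"
  shows "spec \<O> (restarts stage R) (\<lambda>\<kappa>. R * N \<kappa>) (\<lambda>y. y \<in> Rn m \<and> \<Psi> y - \<Psi> ys \<le> (1 / 2) ^ R * (\<Psi> 0 - \<Psi> ys))"
  unfolding restarts_def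
proof (rule spec_restart)
  fix y0 assume y0: "y0 \<in> Rn m"
  have "spec \<O> (bind_prog (stage y0) (\<lambda>st. Done (fst st))) (\<lambda>\<kappa>. N \<kappa> + 0) (\<lambda>y'. y' \<in> Rn m \<and> \<Psi> y' - \<Psi> ys \<le> 1 / 2 * (\<Psi> y0 - \<Psi> ys))"
  proof (rule spec_bind[OF stage[OF y0]])
    fix st :: "rvec \<times> rvec"
    obtain y v where st: "st = (y, v)" by (cases st)
    assume "case st of (y, v) \<Rightarrow> y \<in> Rn m \<and> (\<forall>u\<in>Rn m. c * (\<Psi> y - \<Psi> u) \<le> 1 / 2 * (norm (y0 - u))\<^sup>2)"
    then have y: "y \<in> Rn m" "c * (\<Psi> y - \<Psi> ys) \<le> 1 / 2 * (norm (y0 - ys))\<^sup>2"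
      using ys by (auto simp: st)
    have "\<Psi> ys + \<mu> / 2 * (norm (y0 - ys))\<^sup>2 \<le> \<Psi> y0"
      by (rule strongly_convex_on_argmin[OF \<Psi>(1) ys y0])
    then have "1 / 2 * (norm (y0 - ys))\<^sup>2 \<le> (\<Psi> y0 - \<Psi> ys) / \<mu>"
      using \<Psi>(2) by (simp add: field_simps)
    moreover have "2 / \<mu> * (\<Psi> y - \<Psi> ys) \<le> c * (\<Psi> y - \<Psi> ys)"
      using \<Psi>(3) ys(2)[OF y(1)] by (intro mult_right_mono) auto
    ultimately have "2 / \<mu> * (\<Psi> y - \<Psi> ys) \<le> (\<Psi> y0 - \<Psi> ys) / \<mu>" using y(2) by linarith
    then have le: "(2 * (\<Psi> y - \<Psi> ys)) / \<mu> \<le> (\<Psi> y0 - \<Psi> ys) / \<mu>" by simp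
    have "\<Psi> y - \<Psi> ys \<le> 1 / 2 * (\<Psi> y0 - \<Psi> ys)"
      using mult_left_mono[OF le, of \<mu>] \<Psi>(2) by simp
    then show "spec \<O> (Done (fst st)) (\<lambda>\<kappa>. 0) (\<lambda>y'. y' \<in> Rn m \<and> \<Psi> y' - \<Psi> ys \<le> 1 / 2 * (\<Psi> y0 - \<Psi> ys))"
      using y by (simp add: st)
  qed
  then show "spec \<O> (bind_prog (stage y0) (\<lambda>st. Done (fst st))) N (\<lambda>y'. y' \<in> Rn m \<and> \<Psi> y' - \<Psi> ys \<le> 1 / 2 * (\<Psi> y0 - \<Psi> ys))"
    by simp
qed simp

text \<open>The sign turns maximising F - h into minimising - F + h.\<close>

definition grad_F_prog :: "rvec \<Rightarrow> rvec \<Rightarrow> rvec prog" where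
  "grad_F_prog x w = Query (Grad_yF x w) (\<lambda>g. Done (- g))"

definition grad_h_prog :: "rvec \<Rightarrow> rvec prog" where
  "grad_h_prog w = Query (Grad_h w) Done"

definition only :: "query_kind \<Rightarrow> query_kind \<Rightarrow> nat" where
  "only \<kappa> \<kappa>' = (if \<kappa>' = \<kappa> then 1 else 0)"

lemma spec_grad_F_prog:
  assumes "x \<in> Qx" "w \<in> Rn m"
  shows "spec (correct_answers n m Qx r F h) (grad_F_prog x w) (only K_Grad_yF) (\<lambda>g. g = - grad m (F x) w)"
  using assms by (simp add: grad_F_prog_def only_def)

lemma spec_grad_h_prog:
  assumes "h differentiable (at w within Rn m)" "w \<in> Rn m"
  shows "spec (correct_answers n m Qx r F h) (grad_h_prog w) (only K_Grad_h) (\<lambda>g. g = grad m h w)"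
  using assms by (simp add: grad_h_prog_def only_def)

text \<open>Dividing a (g \<bullet> x) + a h(x) + b / 2 (norm (x - v))^2 by a and expanding the
  square gives problem (P), up to a constant, with these coefficients.\<close>

definition prox_h_prog :: "real \<Rightarrow> real \<Rightarrow> rvec \<Rightarrow> rvec \<Rightarrow> rvec prog" where
  "prox_h_prog a b g v = Query (Prox_h (g - (b / a) *\<^sub>R v) (b / (2 * a))) Done"

lemma spec_prox_h_prog:
  assumes h: "strongly_convex_on (Rn m) \<mu> h" "0 < \<mu>" "continuous_on (Rn m) h"
    and ab: "0 < a" "0 < b" and mem: "g \<in> Rn m" "v \<in> Rn m"
  shows "spec (correct_answers n m Qx r F h) (prox_h_prog a b g v) (only K_Prox_h)
    (\<lambda>v'. v' \<in> Rn m \<and> (\<forall>x\<in>Rn m. a * (g \<bullet> v') + a * h v' + b / 2 * (norm (v' - v))\<^sup>2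
      \<le> a * (g \<bullet> x) + a * h x + b / 2 * (norm (x - v))\<^sup>2))"
proof -
  let ?c1 = "g - (b / a) *\<^sub>R v" and ?c2 = "b / (2 * a)"
  let ?f = "\<lambda>y. ?c1 \<bullet> y + h y + ?c2 * (norm y)\<^sup>2"
  let ?k = "\<lambda>x. a * (g \<bullet> x) + a * h x + b / 2 * (norm (x - v))\<^sup>2"
  have c: "?c1 \<in> Rn m" "?c2 > 0" using mem ab by auto
  \<comment> \<open>Without a minimiser any vector could be returned as the answer; strong convexity
    and continuity supply one.\<close>
  have "strongly_convex_on (Rn m) (0 + \<mu> + 2 * ?c2) (\<lambda>y. ?c1 \<bullet> y + h y + ?c2 * (norm (y - 0))\<^sup>2)"
    by (intro strongly_convex_on_add strongly_convex_on_inner strongly_convex_on_norm_diff h convex_Rn)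
  then have "\<exists>y. is_arg_min ?f (\<lambda>y. y \<in> Rn m) y"
    using h c(2) by (intro strongly_convex_attains_inf_Rn[of m "0 + \<mu> + 2 * ?c2"]) (auto intro!: continuous_intros add_pos_pos)
  moreover have "v' \<in> Rn m \<and> (\<forall>x\<in>Rn m. ?k v' \<le> ?k x)" if "is_arg_min ?f (\<lambda>y. y \<in> Rn m) v'" for v'
  proof (intro conjI ballI)
    show "v' \<in> Rn m" using that by (simp add: is_arg_min_linorder)
    have eq: "?k x = a * ?f x + b / 2 * (norm v)\<^sup>2" for x
    proof -
      have "(norm (x - v))\<^sup>2 = (norm x)\<^sup>2 - 2 * (v \<bullet> x) + (norm v)\<^sup>2"
        by (simp add: power2_norm_eq_inner inner_simps inner_commute)
      then have "b / 2 * (norm (x - v))\<^sup>2 = b / 2 * (norm x)\<^sup>2 - b * (v \<bullet> x) + b / 2 * (norm v)\<^sup>2"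
        by (simp only:) (simp add: algebra_simps)
      moreover have "a * (?c1 \<bullet> x) = a * (g \<bullet> x) - b * (v \<bullet> x)"
        using ab by (simp add: inner_diff_left right_diff_distrib)
      moreover have "a * (?c2 * (norm x)\<^sup>2) = b / 2 * (norm x)\<^sup>2"
        using ab by simp
      ultimately show ?thesis by (simp only: distrib_left)
    qed
    fix x assume "x \<in> Rn m"
    then have "?f v' \<le> ?f x" using that by (simp add: is_arg_min_linorder)
    then have "a * ?f v' \<le> a * ?f x" using ab by (intro mult_left_mono) auto
    then show "?k v' \<le> ?k x" unfolding eq by linarith
  qed
  ultimately show ?thesis
    using c by (auto simp: prox_h_prog_def only_def)
qed

text \<open>With c = 1 / (4 L), T steps halve the excess once T (T + 1) / (4 L) \<ge> 2 / \<mu>,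
  that is T (T + 1) \<ge> 8 L / \<mu>.\<close>

definition prox_stages :: "real \<Rightarrow> real \<Rightarrow> nat" where
  "prox_stages L \<mu> = nat \<lceil>sqrt (8 * L / \<mu>)\<rceil>"

definition prox_solver :: "real \<Rightarrow> real \<Rightarrow> nat \<Rightarrow> rvec \<Rightarrow> rvec prog" where
  "prox_solver L \<mu> R x = restarts (\<lambda>y0. iter_prog (prox_stages L \<mu>)
     (accelerated_step (1 / (4 * L)) \<mu> (grad_F_prog x) prox_h_prog) (y0, y0)) R"

lemma ceiling_sqrt_square:
  assumes "0 \<le> z"
  shows "z \<le> real (nat \<lceil>sqrt z\<rceil>) * (real (nat \<lceil>sqrt z\<rceil>) + 1)"
proof -
  have *: "sqrt z \<le> real (nat \<lceil>sqrt z\<rceil>)" by (rule real_nat_ceiling_ge)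
  have "z = sqrt z * sqrt z" using assms by simp
  also have "\<dots> \<le> real (nat \<lceil>sqrt z\<rceil>) * (real (nat \<lceil>sqrt z\<rceil>) + 1)"
    using * real_sqrt_ge_zero[OF assms] by (intro mult_mono) linarith+
  finally show ?thesis .
qed

lemma spec_prox_solver:
  assumes x: "x \<in> Qx" and F: "smooth_on (Rn m) (\<lambda>y. - grad m (F x) y) L (\<lambda>y. - F x y)" "0 < L"
    "convex_on (Rn m) (\<lambda>y. - F x y)" "\<And>y. y \<in> Rn m \<Longrightarrow> grad m (F x) y \<in> Rn m"
    and h: "strongly_convex_on (Rn m) \<mu> h" "0 < \<mu>" "continuous_on (Rn m) h"
    and ys: "ys \<in> Rn m" "\<And>y. y \<in> Rn m \<Longrightarrow> - F x ys + h ys \<le> - F x y + h y"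
  shows "spec (correct_answers n m Qx r F h) (prox_solver L \<mu> R x)
    (\<lambda>\<kappa>. R * (prox_stages L \<mu> * (only K_Grad_yF \<kappa> + only K_Prox_h \<kappa>)))
    (\<lambda>y. y \<in> Rn m \<and> (- F x y + h y) - (- F x ys + h ys) \<le> (1 / 2) ^ R * ((- F x 0 + h 0) - (- F x ys + h ys)))"
  unfolding prox_solver_def
proof (rule spec_restarts[where c="1 / (4 * L) * real (prox_stages L \<mu>) * (real (prox_stages L \<mu>) + 1)"])
  have "strongly_convex_on (Rn m) (0 + \<mu>) (\<lambda>y. - F x y + h y)"
    by (intro strongly_convex_on_add convex_on_imp_strongly_convex_on F h)
  then show "strongly_convex_on (Rn m) \<mu> (\<lambda>y. - F x y + h y)" by simp
  have "8 * L / \<mu> \<le> real (prox_stages L \<mu>) * (real (prox_stages L \<mu>) + 1)"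
    unfolding prox_stages_def using F h by (intro ceiling_sqrt_square) auto
  then have "1 / (4 * L) * (8 * L / \<mu>) \<le> 1 / (4 * L) * (real (prox_stages L \<mu>) * (real (prox_stages L \<mu>) + 1))"
    using F(2) by (intro mult_left_mono) auto
  then show "2 / \<mu> \<le> 1 / (4 * L) * real (prox_stages L \<mu>) * (real (prox_stages L \<mu>) + 1)"
    using F(2) by (simp add: mult.assoc)
next
  fix y0 assume y0: "y0 \<in> Rn m"
  show "spec (correct_answers n m Qx r F h)
    (iter_prog (prox_stages L \<mu>) (accelerated_step (1 / (4 * L)) \<mu> (grad_F_prog x) prox_h_prog) (y0, y0))
    (\<lambda>\<kappa>. prox_stages L \<mu> * (only K_Grad_yF \<kappa> + only K_Prox_h \<kappa>))
    (\<lambda>(y, v). y \<in> Rn m \<and> (\<forall>u\<in>Rn m. 1 / (4 * L) * real (prox_stages L \<mu>) * (real (prox_stages L \<mu>) + 1) *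
      ((- F x y + h y) - (- F x u + h u)) \<le> 1 / 2 * (norm (y0 - u))\<^sup>2))"
  proof (rule spec_mono[OF spec_accelerated[OF convex_Rn F(1) h(1)]])
    fix a b :: real and w v assume "0 < a" "0 < b" "w \<in> Rn m" "v \<in> Rn m"
    then show "spec (correct_answers n m Qx r F h) (prox_h_prog a b (- grad m (F x) w) v) (only K_Prox_h)
      (\<lambda>v'. v' \<in> Rn m \<and> (\<forall>xa\<in>Rn m. a * (- grad m (F x) w \<bullet> v') + a * h v' + b / 2 * (norm (v' - v))\<^sup>2
        \<le> a * (- grad m (F x) w \<bullet> xa) + a * h xa + b / 2 * (norm (xa - v))\<^sup>2))"
      using F(4) by (intro spec_prox_h_prog[OF h]) auto
  next
    fix st :: "rvec \<times> rvec"
    obtain y v where st: "st = (y, v)" by (cases st)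
    assume *: "case st of (y, v) \<Rightarrow> y \<in> Rn m \<and> v \<in> Rn m \<and> (\<forall>u\<in>Rn m.
      1 / (4 * L) * real (prox_stages L \<mu>) * (real (prox_stages L \<mu>) + 1) * (- F x y + h y - (- F x u + h u)) +
      (1 + 1 / (4 * L) * real (prox_stages L \<mu>) * (real (prox_stages L \<mu>) + 1) * \<mu>) / 2 * (norm (v - u))\<^sup>2
      \<le> 1 / 2 * (norm (y0 - u))\<^sup>2)"
    have nonneg: "0 \<le> (1 + 1 / (4 * L) * real (prox_stages L \<mu>) * (real (prox_stages L \<mu>) + 1) * \<mu>) / 2 * (norm (v - u))\<^sup>2" for u
      using F(2) h(2) by (intro mult_nonneg_nonneg divide_nonneg_nonneg add_nonneg_nonneg) auto
    show "case st of (y, v) \<Rightarrow> y \<in> Rn m \<and> (\<forall>u\<in>Rn m.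
      1 / (4 * L) * real (prox_stages L \<mu>) * (real (prox_stages L \<mu>) + 1) * (- F x y + h y - (- F x u + h u))
      \<le> 1 / 2 * (norm (y0 - u))\<^sup>2)"
      unfolding st prod.case
    proof (intro conjI ballI)
      show "y \<in> Rn m" using * by (simp add: st)
      fix u assume "u \<in> Rn m"
      then have "1 / (4 * L) * real (prox_stages L \<mu>) * (real (prox_stages L \<mu>) + 1) * (- F x y + h y - (- F x u + h u)) +
        (1 + 1 / (4 * L) * real (prox_stages L \<mu>) * (real (prox_stages L \<mu>) + 1) * \<mu>) / 2 * (norm (v - u))\<^sup>2
        \<le> 1 / 2 * (norm (y0 - u))\<^sup>2"
        using *[unfolded st prod.case] by blast
      then show "1 / (4 * L) * real (prox_stages L \<mu>) * (real (prox_stages L \<mu>) + 1) * (- F x y + h y - (- F x u + h u))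
        \<le> 1 / 2 * (norm (y0 - u))\<^sup>2"
        using nonneg[of u] by linarith
    qed
  qed (use F h y0 x in \<open>auto intro: spec_grad_F_prog\<close>)
qed (use h ys in auto)

section \<open>Gradient sliding for two smooth terms\<close>

definition quadratic_argmin_prog :: "nat \<Rightarrow> (rvec \<Rightarrow> real) \<Rightarrow> real \<Rightarrow> real \<Rightarrow> rvec \<Rightarrow> rvec \<Rightarrow> rvec prog" where
  "quadratic_argmin_prog m s a b g v =
     Done (SOME v'. is_arg_min (\<lambda>x. a * (g \<bullet> x) + a * s x + b / 2 * (norm (x - v))\<^sup>2) (\<lambda>x. x \<in> Rn m) v')"

text \<open>The function \<open>s\<close> is known to the algorithm, so the minimiser is selected
  without a query.\<close>

lemma spec_quadratic_argmin_prog: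
  assumes s: "strongly_convex_on (Rn m) \<beta> s" "0 \<le> \<beta>" "continuous_on (Rn m) s" and ab: "0 < a" "0 < b"
  shows "spec \<O> (quadratic_argmin_prog m s a b g v) (\<lambda>_. 0)
    (\<lambda>v'. v' \<in> Rn m \<and> (\<forall>x\<in>Rn m. a * (g \<bullet> v') + a * s v' + b / 2 * (norm (v' - v))\<^sup>2
      \<le> a * (g \<bullet> x) + a * s x + b / 2 * (norm (x - v))\<^sup>2))"
proof -
  let ?f = "\<lambda>x. a * (g \<bullet> x) + a * s x + b / 2 * (norm (x - v))\<^sup>2"
  have "strongly_convex_on (Rn m) (a * 0 + a * \<beta> + 2 * (b / 2)) ?f"
    by (intro strongly_convex_on_add strongly_convex_on_cmult strongly_convex_on_inner strongly_convex_on_norm_diff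
        s convex_Rn) (use ab in auto)
  then have "\<exists>v'. is_arg_min ?f (\<lambda>x. x \<in> Rn m) v'"
    by (rule strongly_convex_attains_inf_Rn) (use ab s in \<open>auto intro!: continuous_intros add_nonneg_pos\<close>)
  then have "is_arg_min ?f (\<lambda>x. x \<in> Rn m) (SOME v'. is_arg_min ?f (\<lambda>x. x \<in> Rn m) v')"
    by (rule someI_ex)
  then show ?thesis
    unfolding quadratic_argmin_prog_def spec.simps is_arg_min_linorder by blast
qed

text \<open>Substitution contributes (a / B)^2 to the constant and scaling contributes B. In
  sliding, Lp a^2 \<le> B / 2 then makes the constant at most Lq / (2 Lp), uniformly in the outer
  step.\<close>

lemma smooth_on_affine:
  assumes q: "smooth_on V G M q" and V: "\<And>u. u \<in> V \<Longrightarrow> (1 / B) *\<^sub>R (c + a *\<^sub>R u) \<in> V" and B: "0 < (B::real)"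
  shows "smooth_on V (\<lambda>u. a *\<^sub>R G ((1 / B) *\<^sub>R (c + a *\<^sub>R u))) (M * a\<^sup>2 / B) (\<lambda>u. B * q ((1 / B) *\<^sub>R (c + a *\<^sub>R u)))"
  unfolding smooth_on_def
proof (intro ballI)
  fix w u assume wu: "w \<in> V" "u \<in> V"
  define w' u' where "w' = (1 / B) *\<^sub>R (c + a *\<^sub>R w)" and "u' = (1 / B) *\<^sub>R (c + a *\<^sub>R u)"
  have d: "u' - w' = (a / B) *\<^sub>R (u - w)" by (simp add: u'_def w'_def algebra_simps)
  have i: "B * (G w' \<bullet> (u' - w')) = (a *\<^sub>R G w') \<bullet> (u - w)"
    using B by (simp add: d)
  have n: "B * (M / 2 * (norm (u' - w'))\<^sup>2) = M * a\<^sup>2 / B / 2 * (norm (u - w))\<^sup>2"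
  proof -
    have "(norm (u' - w'))\<^sup>2 = (a / B)\<^sup>2 * (norm (u - w))\<^sup>2" by (simp add: d power_mult_distrib power_divide)
    then show ?thesis using B by (simp only:) (simp add: power2_eq_square)
  qed
  have "B * (q w' + G w' \<bullet> (u' - w')) \<le> B * q u'"
    using B smooth_onD(1)[OF q V[OF wu(1)] V[OF wu(2)]] unfolding w'_def u'_def by (intro mult_left_mono) auto
  moreover have "B * q u' \<le> B * (q w' + G w' \<bullet> (u' - w') + M / 2 * (norm (u' - w'))\<^sup>2)"
    using B smooth_onD(2)[OF q V[OF wu(1)] V[OF wu(2)]] unfolding w'_def u'_def by (intro mult_left_mono) auto
  ultimately show "B * q w' + (a *\<^sub>R G w') \<bullet> (u - w) \<le> B * q u' \<and>
      B * q u' \<le> B * q w' + (a *\<^sub>R G w') \<bullet> (u - w) + M * a\<^sup>2 / B / 2 * (norm (u - w))\<^sup>2"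
    by (simp only: distrib_left i n)
qed

text \<open>
  Gradient sliding: an accelerated method on the term \<open>p\<close> with the smaller constant, whose proximal
  step on \<open>q\<close> is only approximated by \<open>T\<close> accelerated steps. The inner method starts at the outer
  prox centre \<open>z\<close> and hands back its own prox centre \<open>z'\<close>; its guarantee then has exactly the form
  of the three-point inequality of an exact proximal step, so that the errors telescope and no
  extra logarithm is lost.
\<close>

definition sliding_step ::
  "nat \<Rightarrow> (rvec \<Rightarrow> rvec prog) \<Rightarrow> (rvec \<Rightarrow> rvec prog) \<Rightarrow> real \<Rightarrow> nat \<Rightarrow> nat \<Rightarrow> rvec \<times> rvec \<Rightarrow> (rvec \<times> rvec) prog" where
  "sliding_step m gp gq Lp T k st =
     (let a = (real k + 1) / (4 * Lp); A = real k * (real k + 1) / (8 * Lp); c = A *\<^sub>R fst st; z = snd st in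
      bind_prog (gp ((1 / (A + a)) *\<^sub>R (c + a *\<^sub>R z)))
        (\<lambda>g. bind_prog
          (iter_prog T (accelerated_step (2 / (real T * (real T + 1))) (1 / 2)
            (\<lambda>u. bind_prog (gq ((1 / (A + a)) *\<^sub>R (c + a *\<^sub>R u))) (\<lambda>g'. Done (a *\<^sub>R g')))
            (quadratic_argmin_prog m (\<lambda>u. a * (g \<bullet> u) + 1 / 4 * (norm (u - z))\<^sup>2))) (z, z))
          (\<lambda>st'. Done ((1 / (A + a)) *\<^sub>R (c + a *\<^sub>R fst st'), snd st'))))"

text \<open>The inner weights are scaled so that \<gamma> T (T + 1) = 2. As s has modulus 1 / 2,
  half of the inner guarantee bounds the inner excess plus 1/2 (norm (z' - u))^2 by 1/4 (norm (z -
  u))^2. The value of s at u adds another 1/4 (norm (z - u))^2, so the total 1/2 is exactly what the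
  invariant of the previous step provides.\<close>

lemma spec_sliding_step:
  assumes p: "smooth_on (Rn m) Gp Lp p" and q: "smooth_on (Rn m) Gq Lq q" and cvx: "convex_on (Rn m) q"
    and L: "0 < Lp" "0 \<le> Lq" and T: "0 < T" "4 * Lq / Lp \<le> real T * (real T + 1)"
    and gp: "\<And>w. w \<in> Rn m \<Longrightarrow> spec \<O> (gp w) Np (\<lambda>g. g = Gp w)" "\<And>w. w \<in> Rn m \<Longrightarrow> Gp w \<in> Rn m"
    and gq: "\<And>w. w \<in> Rn m \<Longrightarrow> spec \<O> (gq w) Nq (\<lambda>g. g = Gq w)"
    and mem: "xb \<in> Rn m" "z \<in> Rn m"
    and inv: "\<And>u. u \<in> Rn m \<Longrightarrow> real k * (real k + 1) / (8 * Lp) * ((p xb + q xb) - (p u + q u)) + 1 / 2 * (norm (z - u))\<^sup>2 \<le> W u"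
  shows "spec \<O> (sliding_step m gp gq Lp T k (xb, z)) (\<lambda>\<kappa>. Np \<kappa> + T * Nq \<kappa>)
    (\<lambda>(x', z'). x' \<in> Rn m \<and> z' \<in> Rn m \<and> (\<forall>u\<in>Rn m.
      real (Suc k) * (real (Suc k) + 1) / (8 * Lp) * ((p x' + q x') - (p u + q u)) + 1 / 2 * (norm (z' - u))\<^sup>2 \<le> W u))"
proof -
  define a where "a = (real k + 1) / (4 * Lp)"
  define A where "A = real k * (real k + 1) / (8 * Lp)"
  define B where "B = A + a"
  have a: "0 < a" and A: "0 \<le> A" using L by (auto simp: a_def A_def)
  have B: "0 < B" using a A by (simp add: B_def)
  have Bk: "B = real (Suc k) * (real (Suc k) + 1) / (8 * Lp)"
    using L by (simp add: B_def A_def a_def field_simps)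
  \<comment> \<open>The factor 1 / 2 leaves a smoothness error of p of at most 1/4 (norm (y - z))^2,
    which the quadratic part of \<open>s\<close> pays for.\<close>
  have Lpa: "Lp * a\<^sup>2 \<le> 1 / 2 * B"
  proof -
    have "Lp * a\<^sup>2 = (real k + 1)\<^sup>2 / (16 * Lp)" using L by (simp add: a_def power2_eq_square)
    also have "\<dots> \<le> ((real k + 1) * (real k + 2)) / (16 * Lp)"
      using L by (intro divide_right_mono) (auto simp: power2_eq_square)
    also have "\<dots> = 1 / 2 * B" using L by (simp add: Bk add.commute)
    finally show ?thesis .
  qed
  define c where "c = A *\<^sub>R xb"
  define cmb where "cmb = (\<lambda>u. (1 / B) *\<^sub>R (c + a *\<^sub>R u))"
  have cmb: "cmb u \<in> Rn m" if "u \<in> Rn m" for u using that mem by (simp add: cmb_def c_def)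
  define t where "t = a / B"
  have t: "0 \<le> t" "t \<le> 1" "B * t = a" "B * (1 - t) = A"
    using A a B by (auto simp: t_def B_def field_simps)
  have cmb_t: "cmb u = (1 - t) *\<^sub>R xb + t *\<^sub>R u" for u
  proof -
    have "1 - t = A / B" using B t by (simp add: field_simps)
    then show ?thesis by (simp add: cmb_def c_def t_def scaleR_add_right)
  qed
  define w where "w = cmb z"
  have wR: "w \<in> Rn m" using cmb mem by (simp add: w_def)
  define g where "g = Gp w"
  define s where "s = (\<lambda>u. a * (g \<bullet> u) + 1 / 4 * (norm (u - z))\<^sup>2)"
  define Q where "Q = (\<lambda>u. B * q (cmb u))"
  define \<gamma> where "\<gamma> = 2 / (real T * (real T + 1))"
  have \<gamma>: "0 < \<gamma>" "\<gamma> * real T * (real T + 1) = 2"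
  proof -
    have X: "real T * (real T + 1) \<noteq> 0" using T(1) by simp
    show "0 < \<gamma>" using T(1) by (simp add: \<gamma>_def)
    have "\<gamma> * (real T * (real T + 1)) = 2" using nonzero_eq_divide_eq[OF X, of \<gamma> 2] \<gamma>_def by blast
    then show "\<gamma> * real T * (real T + 1) = 2" by (simp only: mult.assoc)
  qed
  have s_sc: "strongly_convex_on (Rn m) (1 / 2) s"
  proof -
    have "strongly_convex_on (Rn m) (a * 0 + 2 * (1 / 4)) s"
      unfolding s_def using a
      by (intro strongly_convex_on_add strongly_convex_on_cmult strongly_convex_on_inner strongly_convex_on_norm_diff convex_Rn) auto
    then show ?thesis by simp
  qed
  have s_cont: "continuous_on (Rn m) s" unfolding s_def by (intro continuous_intros)
  have Q_smooth: "smooth_on (Rn m) (\<lambda>u. a *\<^sub>R Gq (cmb u)) (Lq * a\<^sup>2 / B) Q"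
    unfolding Q_def cmb_def by (rule smooth_on_affine[OF q _ B]) (use cmb in \<open>simp add: cmb_def\<close>)
  \<comment> \<open>This determines T: the inner problem has constant at most Lq / (2 Lp), and 4
    \<gamma> times this bound is 4 Lq / Lp divided by T (T + 1).\<close>
  have \<gamma>M: "4 * \<gamma> * (Lq * a\<^sup>2 / B) \<le> 1"
  proof -
    have "Lp * (Lq * a\<^sup>2 / B) = Lq * (Lp * a\<^sup>2 / B)" by simp
    also have "\<dots> \<le> Lq * (1 / 2)"
      using Lpa B L by (intro mult_left_mono) (auto simp: divide_le_eq)
    finally have "Lq * a\<^sup>2 / B \<le> Lq / Lp / 2" using L by (simp add: field_simps)
    then have "8 * (Lq * a\<^sup>2 / B) \<le> 8 * (Lq / Lp / 2)" by (rule mult_left_mono) simp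
    also have "\<dots> = 4 * Lq / Lp" by simp
    also note T(2)
    finally have "8 * (Lq * a\<^sup>2 / B) \<le> real T * (real T + 1)" .
    moreover have pos: "0 < real T * (real T + 1)" using T(1) by simp
    ultimately have "8 * (Lq * a\<^sup>2 / B) / (real T * (real T + 1)) \<le> 1"
      by (simp only: pos_divide_le_eq[OF pos] mult_1)
    moreover have "4 * \<gamma> * (Lq * a\<^sup>2 / B) = 8 * (Lq * a\<^sup>2 / B) / (real T * (real T + 1))"
      by (simp add: \<gamma>_def)
    ultimately show ?thesis by (simp only:)
  qed
  let ?inner = "\<lambda>g. iter_prog T (accelerated_step \<gamma> (1 / 2)
            (\<lambda>u. bind_prog (gq (cmb u)) (\<lambda>g'. Done (a *\<^sub>R g')))
            (quadratic_argmin_prog m (\<lambda>u. a * (g \<bullet> u) + 1 / 4 * (norm (u - z))\<^sup>2))) (z, z)"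
  have inner: "spec \<O> (?inner g) (\<lambda>\<kappa>. T * (Nq \<kappa> + 0))
    (\<lambda>(y, v). y \<in> Rn m \<and> v \<in> Rn m \<and> (\<forall>u\<in>Rn m. \<gamma> * real T * (real T + 1) * (Q y + s y - (Q u + s u))
       + (1 + \<gamma> * real T * (real T + 1) * (1 / 2)) / 2 * (norm (v - u))\<^sup>2 \<le> 1 / 2 * (norm (z - u))\<^sup>2))"
    unfolding s_def[symmetric]
  proof (rule spec_accelerated[OF convex_Rn Q_smooth s_sc _ \<gamma>(1) \<gamma>M])
    fix u assume "u \<in> Rn m"
    have "spec \<O> (bind_prog (gq (cmb u)) (\<lambda>g'. Done (a *\<^sub>R g'))) (\<lambda>\<kappa>. Nq \<kappa> + 0) (\<lambda>g. g = a *\<^sub>R Gq (cmb u))"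
      by (rule spec_bind[OF gq[OF cmb[OF \<open>u \<in> Rn m\<close>]]]) simp
    then show "spec \<O> (bind_prog (gq (cmb u)) (\<lambda>g'. Done (a *\<^sub>R g'))) Nq (\<lambda>g. g = a *\<^sub>R Gq (cmb u))" by simp
  next
    fix a' b :: real and w' v assume "0 < a'" "0 < b" "w' \<in> Rn m" "v \<in> Rn m"
    then show "spec \<O> (quadratic_argmin_prog m s a' b (a *\<^sub>R Gq (cmb w')) v) (\<lambda>_. 0)
      (\<lambda>v'. v' \<in> Rn m \<and> (\<forall>x\<in>Rn m. a' * ((a *\<^sub>R Gq (cmb w')) \<bullet> v') + a' * s v' + b / 2 * (norm (v' - v))\<^sup>2
        \<le> a' * ((a *\<^sub>R Gq (cmb w')) \<bullet> x) + a' * s x + b / 2 * (norm (x - v))\<^sup>2))"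
      by (intro spec_quadratic_argmin_prog[OF s_sc _ s_cont]) auto
  qed (use mem in auto)
  have "spec \<O> (bind_prog (gp w) (\<lambda>g. bind_prog (?inner g) (\<lambda>st'. Done (cmb (fst st'), snd st'))))
    (\<lambda>\<kappa>. Np \<kappa> + (T * (Nq \<kappa> + 0) + 0))
    (\<lambda>(x', z'). x' \<in> Rn m \<and> z' \<in> Rn m \<and> (\<forall>u\<in>Rn m.
      B * ((p x' + q x') - (p u + q u)) + 1 / 2 * (norm (z' - u))\<^sup>2 \<le> W u))"
  proof (rule spec_bind[OF gp(1)[OF wR]], goal_cases)
    case (1 g')
    then have "g' = g" by (simp add: g_def)
    show ?case
      unfolding \<open>g' = g\<close>
    proof (rule spec_bind[OF inner])
      fix st :: "rvec \<times> rvec"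
      obtain y v where st: "st = (y, v)" by (cases st)
      assume "case st of (y, v) \<Rightarrow> y \<in> Rn m \<and> v \<in> Rn m \<and> (\<forall>u\<in>Rn m. \<gamma> * real T * (real T + 1) * (Q y + s y - (Q u + s u))
         + (1 + \<gamma> * real T * (real T + 1) * (1 / 2)) / 2 * (norm (v - u))\<^sup>2 \<le> 1 / 2 * (norm (z - u))\<^sup>2)"
      then have y: "y \<in> Rn m" and v: "v \<in> Rn m" and yv: "\<And>u. u \<in> Rn m \<Longrightarrow>
          2 * (Q y + s y - (Q u + s u)) + (norm (v - u))\<^sup>2 \<le> 1 / 2 * (norm (z - u))\<^sup>2"
        unfolding st \<gamma>(2) by auto
      define x' where "x' = cmb y"
      have x': "x' \<in> Rn m" using cmb y by (simp add: x'_def)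
      have "B * ((p x' + q x') - (p u + q u)) + 1 / 2 * (norm (v - u))\<^sup>2 \<le> W u" if u: "u \<in> Rn m" for u
      proof -
        have d: "x' - w = t *\<^sub>R (y - z)" by (simp add: x'_def w_def cmb_t algebra_simps)
        have d2: "x' - w = (1 - t) *\<^sub>R (xb - w) + t *\<^sub>R (y - w)" by (simp add: x'_def cmb_t algebra_simps)
        have "p x' \<le> p w + g \<bullet> (x' - w) + Lp / 2 * (norm (x' - w))\<^sup>2"
          unfolding g_def by (rule smooth_onD(2)[OF p wR x'])
        also have "g \<bullet> (x' - w) = (1 - t) * (g \<bullet> (xb - w)) + t * (g \<bullet> (y - w))"
          by (simp add: d2 inner_add_right)
        also have "(norm (x' - w))\<^sup>2 = t\<^sup>2 * (norm (y - z))\<^sup>2" by (simp add: d power_mult_distrib)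
        finally have "B * p x' \<le> B * (p w + ((1 - t) * (g \<bullet> (xb - w)) + t * (g \<bullet> (y - w))) + Lp / 2 * (t\<^sup>2 * (norm (y - z))\<^sup>2))"
          using B by simp
        also have "\<dots> = (B * (1 - t)) * (p w + g \<bullet> (xb - w)) + (B * t) * (p w + g \<bullet> (y - w)) + (Lp * t * (B * t)) / 2 * (norm (y - z))\<^sup>2"
          by (simp add: algebra_simps power2_eq_square)
        also have "\<dots> = A * (p w + g \<bullet> (xb - w)) + a * (p w + g \<bullet> (y - w)) + (Lp * t * a) / 2 * (norm (y - z))\<^sup>2"
          by (simp only: t(3,4))
        also have "\<dots> \<le> A * p xb + a * (p w + g \<bullet> (y - w)) + 1 / 4 * (norm (y - z))\<^sup>2"
        proof -
          have "Lp * t * a = Lp * a\<^sup>2 / B" by (simp add: t_def power2_eq_square)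
          also have "\<dots> \<le> 1 / 2" using Lpa by (simp only: pos_divide_le_eq[OF B])
          finally have "Lp * t * a \<le> 1 / 2" .
          from divide_right_mono[OF this, of 2] have "(Lp * t * a) / 2 \<le> 1 / 4" by (simp only: divide_divide_eq_left) simp
          then have "(Lp * t * a) / 2 * (norm (y - z))\<^sup>2 \<le> 1 / 4 * (norm (y - z))\<^sup>2"
            by (rule mult_right_mono) simp
          moreover have "A * (p w + g \<bullet> (xb - w)) \<le> A * p xb"
            unfolding g_def using A by (intro mult_left_mono smooth_onD(1)[OF p wR]) (auto simp: mem)
          ultimately show ?thesis by linarith
        qed
        finally have p1: "B * p x' \<le> A * p xb + a * (p w + g \<bullet> (y - w)) + 1 / 4 * (norm (y - z))\<^sup>2" .
        have p2: "a * (p w + g \<bullet> (u - w)) \<le> a * p u"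
          unfolding g_def using a by (intro mult_left_mono smooth_onD(1)[OF p wR u]) auto
        \<comment> \<open>The inner method compares with \<open>Q u = B * q (cmb u)\<close>;
          convexity of q splits this into the shares A at xb and a at u.\<close>
        have "q (cmb u) \<le> (1 - t) * q xb + t * q u"
          unfolding cmb_t using t mem u by (intro convex_onD[OF cvx]) auto
        then have "B * q (cmb u) \<le> B * ((1 - t) * q xb + t * q u)" using B by simp
        also have "\<dots> = (B * (1 - t)) * q xb + (B * t) * q u" by (simp add: algebra_simps)
        finally have q1: "B * q (cmb u) \<le> A * q xb + a * q u" by (simp only: t(3,4))
        have e: "Q y = B * q x'" "s y = a * (g \<bullet> y) + 1 / 4 * (norm (y - z))\<^sup>2"
          "Q u = B * q (cmb u)" "s u = a * (g \<bullet> u) + 1 / 4 * (norm (u - z))\<^sup>2"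
          by (simp_all add: Q_def s_def x'_def)
        have p1': "B * p x' \<le> A * p xb + (a * p w + a * (g \<bullet> y) - a * (g \<bullet> w)) + 1 / 4 * (norm (y - z))\<^sup>2"
          using p1 by (simp only: inner_diff_right distrib_left right_diff_distrib add_diff_eq)
        have p2': "a * p w + a * (g \<bullet> u) - a * (g \<bullet> w) \<le> a * p u"
          using p2 by (simp only: inner_diff_right distrib_left right_diff_distrib add_diff_eq)
        have inv': "A * p xb + A * q xb - (A * p u + A * q u) + 1 / 2 * (norm (z - u))\<^sup>2 \<le> W u"
          using inv[OF u, folded A_def] by (simp only: distrib_left right_diff_distrib)
        have "(B * q x' + (a * (g \<bullet> y) + 1 / 4 * (norm (y - z))\<^sup>2)) - (B * q (cmb u) + (a * (g \<bullet> u) + 1 / 4 * (norm (z - u))\<^sup>2))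
            + 1 / 2 * (norm (v - u))\<^sup>2 \<le> 1 / 4 * (norm (z - u))\<^sup>2"
        proof -
          have halve: "X + 1 / 2 * Y \<le> 1 / 4 * Z" if "2 * X + Y \<le> 1 / 2 * Z" for X Y Z :: real
            using that by simp
          show ?thesis
            by (rule halve) (use yv[OF u] in \<open>simp only: e norm_minus_commute[of u z]\<close>)
        qed
        moreover have "B * p u = A * p u + a * p u" "B * q u = A * q u + a * q u"
          by (simp_all only: B_def distrib_right)
        ultimately have "B * p x' + B * q x' - (B * p u + B * q u) + 1 / 2 * (norm (v - u))\<^sup>2 \<le> W u"
        proof -
          have comb: "BP + BQ - (BPu + BQu) + V \<le> W"
            if "BP \<le> AP + (apw + agy - agw) + Y" "apw + agu - agw \<le> apu" "AP + AQ - (APu + AQu) + Z2 \<le> W"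
              "BQ + (agy + Y) - (BQc + (agu + Z4)) + V \<le> Z4" "BQc \<le> AQ + aqu"
              "BPu = APu + apu" "BQu = AQu + aqu" "Z2 = 2 * Z4"
            for AP AQ APu AQu BP BQ BPu BQu BQc Y V W Z2 Z4 agu agw agy apu apw aqu :: real
            using that by linarith
          assume h: "B * q x' + (a * (g \<bullet> y) + 1 / 4 * (norm (y - z))\<^sup>2) - (B * q (cmb u) + (a * (g \<bullet> u) + 1 / 4 * (norm (z - u))\<^sup>2))
            + 1 / 2 * (norm (v - u))\<^sup>2 \<le> 1 / 4 * (norm (z - u))\<^sup>2" "B * p u = A * p u + a * p u" "B * q u = A * q u + a * q u"
          show ?thesis by (rule comb[OF p1' p2' inv' h(1) q1 h(2,3)]) simp
        qed
        then show ?thesis by (simp only: distrib_left right_diff_distrib)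
      qed
      then show "spec \<O> (Done (cmb (fst st), snd st)) (\<lambda>_. 0) (\<lambda>(x', z'). x' \<in> Rn m \<and> z' \<in> Rn m \<and> (\<forall>u\<in>Rn m.
          B * ((p x' + q x') - (p u + q u)) + 1 / 2 * (norm (z' - u))\<^sup>2 \<le> W u))"
        using x' v by (simp add: st x'_def)
    qed
  qed
  moreover have "sliding_step m gp gq Lp T k (xb, z) =
      bind_prog (gp w) (\<lambda>g. bind_prog (?inner g) (\<lambda>st'. Done (cmb (fst st'), snd st')))"
    unfolding sliding_step_def Let_def fst_conv snd_conv A_def[symmetric] a_def[symmetric] B_def[symmetric]
      c_def[symmetric] \<gamma>_def[symmetric] w_def cmb_def by (rule refl)
  ultimately show ?thesis by (simp only: Bk add_0_right)
qed

text \<open>Halving by a restart needs k (k + 1) / (8 Lp) \<ge> 2 / \<mu> after k outer steps,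
  whence the 16.\<close>

definition sliding_outer :: "real \<Rightarrow> real \<Rightarrow> nat" where
  "sliding_outer Lp \<mu> = nat \<lceil>sqrt (16 * Lp / \<mu>)\<rceil>"

definition sliding_inner :: "real \<Rightarrow> real \<Rightarrow> nat" where
  "sliding_inner Lp Lq = nat \<lceil>sqrt (4 * Lq / Lp)\<rceil>"

definition sliding_solver ::
  "nat \<Rightarrow> (rvec \<Rightarrow> rvec prog) \<Rightarrow> (rvec \<Rightarrow> rvec prog) \<Rightarrow> real \<Rightarrow> real \<Rightarrow> real \<Rightarrow> nat \<Rightarrow> rvec prog" where
  "sliding_solver m gp gq Lp Lq \<mu> R = restarts (\<lambda>y0. iter_prog (sliding_outer Lp \<mu>)
     (sliding_step m gp gq Lp (sliding_inner Lp Lq)) (y0, y0)) R"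

lemma spec_sliding_solver:
  assumes p: "smooth_on (Rn m) Gp Lp p" and q: "smooth_on (Rn m) Gq Lq q" and cvx: "convex_on (Rn m) q"
    and L: "0 < Lp" "0 < Lq"
    and \<Psi>: "strongly_convex_on (Rn m) \<mu> (\<lambda>y. p y + q y)" "0 < \<mu>"
    and gp: "\<And>w. w \<in> Rn m \<Longrightarrow> spec \<O> (gp w) Np (\<lambda>g. g = Gp w)" "\<And>w. w \<in> Rn m \<Longrightarrow> Gp w \<in> Rn m"
    and gq: "\<And>w. w \<in> Rn m \<Longrightarrow> spec \<O> (gq w) Nq (\<lambda>g. g = Gq w)"
    and ys: "ys \<in> Rn m" "\<And>y. y \<in> Rn m \<Longrightarrow> p ys + q ys \<le> p y + q y"
  shows "spec \<O> (sliding_solver m gp gq Lp Lq \<mu> R)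
    (\<lambda>\<kappa>. R * (sliding_outer Lp \<mu> * (Np \<kappa> + sliding_inner Lp Lq * Nq \<kappa>)))
    (\<lambda>y. y \<in> Rn m \<and> (p y + q y) - (p ys + q ys) \<le> (1 / 2) ^ R * ((p 0 + q 0) - (p ys + q ys)))"
  unfolding sliding_solver_def
proof (rule spec_restarts[where c="real (sliding_outer Lp \<mu>) * (real (sliding_outer Lp \<mu>) + 1) / (8 * Lp)", OF _ \<Psi>])
  have "16 * Lp / \<mu> \<le> real (sliding_outer Lp \<mu>) * (real (sliding_outer Lp \<mu>) + 1)"
    unfolding sliding_outer_def using L \<Psi> by (intro ceiling_sqrt_square) auto
  then have "16 * Lp / \<mu> / (8 * Lp) \<le> real (sliding_outer Lp \<mu>) * (real (sliding_outer Lp \<mu>) + 1) / (8 * Lp)"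
    using L by (intro divide_right_mono) auto
  then show "2 / \<mu> \<le> real (sliding_outer Lp \<mu>) * (real (sliding_outer Lp \<mu>) + 1) / (8 * Lp)"
    using L by simp
next
  fix y0 assume y0: "y0 \<in> Rn m"
  let ?N = "\<lambda>\<kappa>. Np \<kappa> + sliding_inner Lp Lq * Nq \<kappa>"
  have T: "0 < sliding_inner Lp Lq" "4 * Lq / Lp \<le> real (sliding_inner Lp Lq) * (real (sliding_inner Lp Lq) + 1)"
    unfolding sliding_inner_def using L by (simp, intro ceiling_sqrt_square, simp)
  have "spec \<O> (iter_prog (sliding_outer Lp \<mu>) (sliding_step m gp gq Lp (sliding_inner Lp Lq)) (y0, y0))
    (\<lambda>\<kappa>. sliding_outer Lp \<mu> * ?N \<kappa>)
    (\<lambda>(y, z). y \<in> Rn m \<and> z \<in> Rn m \<and> (\<forall>u\<in>Rn m.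
      real (sliding_outer Lp \<mu>) * (real (sliding_outer Lp \<mu>) + 1) / (8 * Lp) * ((p y + q y) - (p u + q u))
        + 1 / 2 * (norm (z - u))\<^sup>2 \<le> 1 / 2 * (norm (y0 - u))\<^sup>2))"
  proof (rule spec_iter[where Inv="\<lambda>k (y, z). y \<in> Rn m \<and> z \<in> Rn m \<and> (\<forall>u\<in>Rn m.
      real k * (real k + 1) / (8 * Lp) * ((p y + q y) - (p u + q u)) + 1 / 2 * (norm (z - u))\<^sup>2 \<le> 1 / 2 * (norm (y0 - u))\<^sup>2)"])
    fix k :: nat and st :: "rvec \<times> rvec"
    obtain y z where st: "st = (y, z)" by (cases st)
    assume *: "case st of (y, z) \<Rightarrow> y \<in> Rn m \<and> z \<in> Rn m \<and> (\<forall>u\<in>Rn m.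
      real k * (real k + 1) / (8 * Lp) * ((p y + q y) - (p u + q u)) + 1 / 2 * (norm (z - u))\<^sup>2 \<le> 1 / 2 * (norm (y0 - u))\<^sup>2)"
    note * = *[unfolded st prod.case]
    show "spec \<O> (sliding_step m gp gq Lp (sliding_inner Lp Lq) k st) ?N
      (\<lambda>(y, z). y \<in> Rn m \<and> z \<in> Rn m \<and> (\<forall>u\<in>Rn m.
        real (Suc k) * (real (Suc k) + 1) / (8 * Lp) * ((p y + q y) - (p u + q u)) + 1 / 2 * (norm (z - u))\<^sup>2
          \<le> 1 / 2 * (norm (y0 - u))\<^sup>2))"
      unfolding st
      by (rule spec_sliding_step[OF p q cvx L(1) less_imp_le[OF L(2)] T gp gq]) (use * in blast)+
  qed (use y0 in auto)
  then show "spec \<O> (iter_prog (sliding_outer Lp \<mu>) (sliding_step m gp gq Lp (sliding_inner Lp Lq)) (y0, y0))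
    (\<lambda>\<kappa>. sliding_outer Lp \<mu> * ?N \<kappa>)
    (\<lambda>(y, z). y \<in> Rn m \<and> (\<forall>u\<in>Rn m.
      real (sliding_outer Lp \<mu>) * (real (sliding_outer Lp \<mu>) + 1) / (8 * Lp) * ((p y + q y) - (p u + q u))
        \<le> 1 / 2 * (norm (y0 - u))\<^sup>2))"
  proof (rule spec_mono)
    fix st :: "rvec \<times> rvec"
    obtain y z where st: "st = (y, z)" by (cases st)
    assume *: "case st of (y, z) \<Rightarrow> y \<in> Rn m \<and> z \<in> Rn m \<and> (\<forall>u\<in>Rn m.
      real (sliding_outer Lp \<mu>) * (real (sliding_outer Lp \<mu>) + 1) / (8 * Lp) * ((p y + q y) - (p u + q u))
        + 1 / 2 * (norm (z - u))\<^sup>2 \<le> 1 / 2 * (norm (y0 - u))\<^sup>2)"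
    have drop: "X \<le> Z" if "X + 1 / 2 * (norm (z - u))\<^sup>2 \<le> Z" for X Z u
      using that zero_le_power2[of "norm (z - u)"] by linarith
    show "case st of (y, z) \<Rightarrow> y \<in> Rn m \<and> (\<forall>u\<in>Rn m.
      real (sliding_outer Lp \<mu>) * (real (sliding_outer Lp \<mu>) + 1) / (8 * Lp) * ((p y + q y) - (p u + q u))
        \<le> 1 / 2 * (norm (y0 - u))\<^sup>2)"
      using *[unfolded st prod.case] drop unfolding st prod.case by blast
  qed simp
qed (use ys in auto)

section \<open>Consequences of the hypotheses on the saddle problem\<close>

context saddle_problem
begin

abbreviation "S x y \<equiv> F x y - h y"
abbreviation "Smax x \<equiv> (SUP y\<in>Rn m. S x y)"
abbreviation "g \<equiv> outer_objective m r F h"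

lemma F_differentiable: "x \<in> Qx \<Longrightarrow> y \<in> Rn m \<Longrightarrow> F x differentiable (at y within Rn m)"
  using F_neighbourhood by blast

lemma F_concave: assumes "x \<in> Qx" shows "convex_on (Rn m) (\<lambda>y. - F x y)"
proof -
  obtain U where U: "Qx \<times> Rn m \<subseteq> U" "\<forall>x B. convex B \<and> {x} \<times> B \<subseteq> U \<longrightarrow> concave_on B (\<lambda>y. F x y)"
    using F_neighbourhood by blast
  have "{x} \<times> Rn m \<subseteq> U" using U(1) assms by blast
  with U(2) show ?thesis by (auto simp: concave_on_def)
qed

lemma F_convex: assumes "y \<in> Rn m" shows "convex_on Qx (\<lambda>x. F x y)"
proof -
  obtain U where U: "Qx \<times> Rn m \<subseteq> U" "\<forall>y A. convex A \<and> A \<times> {y} \<subseteq> U \<longrightarrow> convex_on A (\<lambda>x. F x y)"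
    using F_neighbourhood by blast
  have "Qx \<times> {y} \<subseteq> U" using U(1) assms by blast
  with U(2) Qx_convex show ?thesis by blast
qed

lemma grad_F_in_Rn: "x \<in> Qx \<Longrightarrow> y \<in> Rn m \<Longrightarrow> grad m (F x) y \<in> Rn m"
  by (rule grad_works[OF F_differentiable])

lemma smooth_F:
  assumes x: "x \<in> Qx"
  shows "smooth_on (Rn m) (\<lambda>y. - grad m (F x) y) (2 * Lyy) (\<lambda>y. - F x y)"
proof -
  have eq: "grad m (\<lambda>y. - F x y) y = - grad m (F x) y" if "y \<in> Rn m" for y
    by (rule grad_uminus[OF F_differentiable[OF x that] that])
  have "smooth_on (Rn m) (grad m (\<lambda>y. - F x y)) (2 * Lyy) (\<lambda>y. - F x y)"
  proof (rule smooth_on_grad[OF _ _ F_concave[OF x]])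
    show "(\<lambda>y. - F x y) differentiable (at y within Rn m)" if "y \<in> Rn m" for y
      by (intro differentiable_minus F_differentiable x that)
    show "Lyy-lipschitz_on (Rn m) (grad m (\<lambda>y. - F x y))"
    proof (rule lipschitz_onI)
      fix y z assume "y \<in> Rn m" "z \<in> Rn m"
      then show "dist (grad m (\<lambda>y. - F x y) y) (grad m (\<lambda>y. - F x y) z) \<le> Lyy * dist y z"
        using lipschitz_onD[OF F_grad_lipschitz[OF x], of y z] by (simp add: eq dist_minus)
    qed (rule lipschitz_on_nonneg[OF F_grad_lipschitz[OF x]])
  qed
  then show ?thesis by (simp add: smooth_on_def eq)
qed

text \<open>F contributes concavity with modulus 0; the modulus \<open>\<mu>y\<close> of the bounds
  is that of h.\<close>

lemma S_strongly_concave_mu: "x \<in> Qx \<Longrightarrow> strongly_convex_on (Rn m) \<mu>y (\<lambda>y. - F x y + h y)"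
  using strongly_convex_on_add[OF convex_on_imp_strongly_convex_on[OF F_concave] h_strongly_convex] by simp

lemma S_continuous_y: assumes x: "x \<in> Qx" shows "continuous_on (Rn m) (\<lambda>y. - F x y + h y)"
proof -
  have "continuous_on (Rn m) (\<lambda>y. (\<lambda>(x, y). F x y - h y) (x, y))"
    by (rule continuous_on_compose2[OF S_continuous]) (use x in \<open>auto intro!: continuous_intros\<close>)
  from continuous_on_minus[OF this] show ?thesis by simp
qed

lemma Smax_attained:
  assumes x: "x \<in> Qx"
  obtains ys where "ys \<in> Rn m" "\<And>y. y \<in> Rn m \<Longrightarrow> S x y \<le> S x ys" "Smax x = S x ys"
proof -
  obtain ys where "is_arg_min (\<lambda>y. - F x y + h y) (\<lambda>y. y \<in> Rn m) ys"
    using strongly_convex_attains_inf_Rn[OF S_strongly_concave_mu[OF x] mu_pos(2) S_continuous_y[OF x]] by blast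
  then have ys: "ys \<in> Rn m" "\<And>y. y \<in> Rn m \<Longrightarrow> S x y \<le> S x ys"
    by (auto simp: is_arg_min_linorder)
  moreover have "Smax x = S x ys" by (rule cSup_eq_maximum) (use ys in auto)
  ultimately show ?thesis using that by blast
qed

lemma S_le_Smax: "x \<in> Qx \<Longrightarrow> y \<in> Rn m \<Longrightarrow> S x y \<le> Smax x"
  by (metis Smax_attained)

lemma g_eq: "g x = r x + Smax x"
  by (simp add: outer_objective_def)

text \<open>The maximiser y at the mixture is kept fixed: F(., y) is convex, and at both end points
  S(., y) is at most Smax. The modulus comes from r.\<close>

lemma g_strongly_convex: "strongly_convex_on Qx \<mu>x g"
  unfolding strongly_convex_on_def
proof (intro conjI ballI Qx_convex)
  fix x1 x2 t assume x: "x1 \<in> Qx" "x2 \<in> Qx" and t: "t \<in> {0..1::real}"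
  define x where "x = (1 - t) *\<^sub>R x1 + t *\<^sub>R x2"
  have xQ: "x \<in> Qx" using Qx_convex x t by (simp add: x_def convex_alt)
  obtain y where y: "y \<in> Rn m" "Smax x = S x y" using Smax_attained[OF xQ] by blast
  have "F x y \<le> (1 - t) * F x1 y + t * F x2 y"
    unfolding x_def using t x by (intro convex_onD[OF F_convex[OF y(1)]]) auto
  then have "S x y \<le> (1 - t) * S x1 y + t * S x2 y" by (simp add: algebra_simps)
  also have "\<dots> \<le> (1 - t) * Smax x1 + t * Smax x2"
    using t x y by (intro add_mono mult_left_mono S_le_Smax) auto
  finally have "Smax x \<le> (1 - t) * Smax x1 + t * Smax x2" using y(2) by simp
  moreover have "r x \<le> (1 - t) * r x1 + t * r x2 - \<mu>x / 2 * t * (1 - t) * (norm (x1 - x2))\<^sup>2"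
    unfolding x_def using t x by (intro strongly_convex_onD[OF r_strongly_convex]) auto
  ultimately show "g ((1 - t) *\<^sub>R x1 + t *\<^sub>R x2) \<le> (1 - t) * g x1 + t * g x2 - \<mu>x / 2 * t * (1 - t) * (norm (x1 - x2))\<^sup>2"
    unfolding x_def[symmetric] g_eq by (simp add: distrib_left)
qed

lemma rint_Qx: "rint n Qx \<noteq> {}"
  using Qx_interior interior_of_subset_rint by blast

lemma g_minimum: obtains xs where "xs \<in> Qx" "\<And>x. x \<in> Qx \<Longrightarrow> g xs \<le> g x"
  using continuous_attains_inf[OF Qx_compact _ g_continuous] rint_Qx rint_subset by blast

lemma g_oscillation: obtains B where "0 \<le> B" "\<And>x w. x \<in> Qx \<Longrightarrow> w \<in> Qx \<Longrightarrow> g w - g x \<le> B"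
proof -
  have ne: "Qx \<noteq> {}" using rint_Qx rint_subset by blast
  obtain a where a: "a \<in> Qx" "\<And>x. x \<in> Qx \<Longrightarrow> g a \<le> g x"
    using continuous_attains_inf[OF Qx_compact ne g_continuous] by blast
  obtain b where b: "b \<in> Qx" "\<And>x. x \<in> Qx \<Longrightarrow> g x \<le> g b"
    using continuous_attains_sup[OF Qx_compact ne g_continuous] by blast
  show ?thesis
  proof (rule that)
    show "0 \<le> g b - g a" using a(2)[OF b(1)] by simp
    show "g w - g x \<le> g b - g a" if "x \<in> Qx" "w \<in> Qx" for x w
      using a(2)[OF that(1)] b(2)[OF that(2)] by linarith
  qed
qed

text \<open>Every inner solve starts at 0, so one bound on the initial excess must serve all query
  points. Here Smax = g - r, where g is bounded above by compactness and r below by its affine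
  minorant at an interior point; S(., 0) is continuous.\<close>

lemma initial_gap_bounded: obtains D where "0 \<le> D" "\<And>x. x \<in> Qx \<Longrightarrow> Smax x - S x 0 \<le> D"
proof -
  have ne: "Qx \<noteq> {}" using rint_Qx rint_subset by blast
  obtain b where b: "\<And>x. x \<in> Qx \<Longrightarrow> g x \<le> g b"
    using continuous_attains_sup[OF Qx_compact ne g_continuous] by blast
  have "continuous_on Qx (\<lambda>x. (\<lambda>(x, y). F x y - h y) (x, 0))"
    by (rule continuous_on_compose2[OF S_continuous]) (auto intro!: continuous_intros)
  then have "continuous_on Qx (\<lambda>x. S x 0)" by simp
  then obtain c where c: "\<And>x. x \<in> Qx \<Longrightarrow> S c 0 \<le> S x 0"
    using continuous_attains_inf[OF Qx_compact ne] by blast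
  obtain x0 where x0: "x0 \<in> rint n Qx" using rint_Qx by blast
  have "convex_on Qx r" using r_strongly_convex mu_pos by (intro strongly_convex_on_imp_convex_on) auto
  then obtain \<nu> where \<nu>: "\<nu> \<in> subgradients_on n Qx r x0"
    using subgradients_on_rint_nonempty[OF _ Qx_subset x0] by blast
  have "continuous_on Qx (\<lambda>x. r x0 + \<nu> \<bullet> (x - x0))" by (intro continuous_intros)
  then obtain d where d: "\<And>x. x \<in> Qx \<Longrightarrow> r x0 + \<nu> \<bullet> (d - x0) \<le> r x0 + \<nu> \<bullet> (x - x0)"
    using continuous_attains_inf[OF Qx_compact ne] by blast
  define D where "D = \<bar>g b - S c 0 - (r x0 + \<nu> \<bullet> (d - x0))\<bar>"
  show ?thesis
  proof (rule that)
    fix x assume x: "x \<in> Qx"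
    have "r x0 + \<nu> \<bullet> (x - x0) \<le> r x" using \<nu> x by (simp add: subgradients_on_def)
    then show "Smax x - S x 0 \<le> D" using b[OF x] c[OF x] d[OF x] g_eq[of x] unfolding D_def by linarith
  qed (simp add: D_def)
qed

text \<open>The assumption \<open>sub\<close> speaks of r + F(., y i) and is not weakened to a
  statement on g, because it is S(xs, y i) that concavity averages into S(xs, yh). The factor 2 in
  the last two assumptions inverts the \<mu> / 2 of quadratic growth.\<close>

lemma approximate_saddle_point:
  assumes I: "finite I" "\<And>i. i \<in> I \<Longrightarrow> 0 \<le> w i" "sum w I = 1"
    and x: "\<And>i. i \<in> I \<Longrightarrow> x i \<in> Qx" and y: "\<And>i. i \<in> I \<Longrightarrow> y i \<in> Rn m"
    and gap: "\<And>i. i \<in> I \<Longrightarrow> Smax (x i) - S (x i) (y i) \<le> \<delta>"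
    and sub: "\<And>i z. i \<in> I \<Longrightarrow> z \<in> Qx \<Longrightarrow> r (x i) + F (x i) (y i) + \<nu> i \<bullet> (z - x i) \<le> r z + F z (y i)"
    and cert: "\<And>z. z \<in> Qx \<Longrightarrow> (\<Sum>i\<in>I. w i * (\<nu> i \<bullet> (x i - z))) \<le> \<eta>"
    and \<epsilon>: "0 < \<epsilon>" "2 * (\<delta> + \<eta>) \<le> \<mu>x * \<epsilon>\<^sup>2" "2 * (\<delta> + \<eta>) \<le> \<mu>y * \<epsilon>\<^sup>2"
  shows "eps_solution m Qx r F h \<epsilon> (\<Sum>i\<in>I. w i *\<^sub>R x i) (\<Sum>i\<in>I. w i *\<^sub>R y i)"
proof -
  define xh where "xh = (\<Sum>i\<in>I. w i *\<^sub>R x i)"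
  define yh where "yh = (\<Sum>i\<in>I. w i *\<^sub>R y i)"
  have xh: "xh \<in> Qx" unfolding xh_def using I x by (intro convex_sum Qx_convex) auto
  have yh: "yh \<in> Rn m" unfolding yh_def using I y by (intro convex_sum convex_Rn) auto
  obtain xs where xs: "xs \<in> Qx" "\<And>x. x \<in> Qx \<Longrightarrow> g xs \<le> g x" by (rule g_minimum) blast
  obtain ys where ys: "ys \<in> Rn m" "\<And>y. y \<in> Rn m \<Longrightarrow> S xs y \<le> S xs ys" "Smax xs = S xs ys"
    using Smax_attained[OF xs(1)] by blast
  have ne: "I \<noteq> {}" using I(3) by auto
  have "g xh \<le> (\<Sum>i\<in>I. w i * g (x i))"
    unfolding xh_def
    by (rule convex_on_sum[OF I(1) ne strongly_convex_on_imp_convex_on[OF g_strongly_convex]]) (use I x mu_pos in auto)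
  also have "\<dots> \<le> (\<Sum>i\<in>I. w i * (r xs + S xs (y i) + \<nu> i \<bullet> (x i - xs) + \<delta>))"
  proof (rule sum_mono, rule mult_left_mono)
    fix i assume i: "i \<in> I"
    have "\<nu> i \<bullet> (x i - xs) = - (\<nu> i \<bullet> (xs - x i))" by (simp add: inner_diff_right)
    then show "g (x i) \<le> r xs + S xs (y i) + \<nu> i \<bullet> (x i - xs) + \<delta>"
      using gap[OF i] sub[OF i xs(1)] unfolding g_eq by linarith
  qed (use I in auto)
  also have "\<dots> = (\<Sum>i\<in>I. w i) * (r xs + \<delta>) + (\<Sum>i\<in>I. w i * S xs (y i)) + (\<Sum>i\<in>I. w i * (\<nu> i \<bullet> (x i - xs)))"
  proof -
    have "w i * (r xs + S xs (y i) + \<nu> i \<bullet> (x i - xs) + \<delta>) =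
        w i * (r xs + \<delta>) + w i * S xs (y i) + w i * (\<nu> i \<bullet> (x i - xs))" for i
      by (simp add: distrib_left)
    then show ?thesis by (simp only: sum.distrib sum_distrib_right)
  qed
  also have "\<dots> \<le> r xs + \<delta> + (\<Sum>i\<in>I. w i * S xs (y i)) + \<eta>"
    using cert[OF xs(1)] I(3) by simp
  also have "(\<Sum>i\<in>I. w i * S xs (y i)) \<le> S xs yh"
  proof -
    have "- F xs yh + h yh \<le> (\<Sum>i\<in>I. w i * (- F xs (y i) + h (y i)))"
      unfolding yh_def
      by (rule convex_on_sum[OF I(1) ne strongly_convex_on_imp_convex_on[OF S_strongly_concave_mu[OF xs(1)]]])
         (use I y mu_pos in auto)
    also have "\<dots> = - (\<Sum>i\<in>I. w i * S xs (y i))" by (simp add: sum_negf[symmetric] algebra_simps)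
    finally show ?thesis by simp
  qed
  finally have main: "g xh \<le> r xs + S xs yh + (\<delta> + \<eta>)" by simp
  have gx: "g xs + \<mu>x / 2 * (norm (xh - xs))\<^sup>2 \<le> g xh"
    by (rule strongly_convex_on_argmin[OF g_strongly_convex xs xh])
  have gy: "(- F xs ys + h ys) + \<mu>y / 2 * (norm (yh - ys))\<^sup>2 \<le> - F xs yh + h yh"
    by (rule strongly_convex_on_argmin[OF S_strongly_concave_mu[OF xs(1)] ys(1) _ yh]) (use ys in force)
  have gs: "g xs = r xs + S xs ys" unfolding g_eq ys(3) by simp
  \<comment> \<open>Subtracting g xs = r xs + S xs ys from \<open>main\<close> leaves the growth of
    g on the left and minus the growth of - S(xs, .) on the right.\<close>
  have sum: "\<mu>x / 2 * (norm (xh - xs))\<^sup>2 + \<mu>y / 2 * (norm (yh - ys))\<^sup>2 \<le> \<delta> + \<eta>"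
    using main gx gy gs by linarith
  have nn: "0 \<le> \<mu>x / 2 * (norm (xh - xs))\<^sup>2" "0 \<le> \<mu>y / 2 * (norm (yh - ys))\<^sup>2" using mu_pos by auto
  have "\<mu>x * (norm (xh - xs))\<^sup>2 \<le> \<mu>x * \<epsilon>\<^sup>2" "\<mu>y * (norm (yh - ys))\<^sup>2 \<le> \<mu>y * \<epsilon>\<^sup>2"
  proof -
    have two: "a * X \<le> Z" if "a / 2 * X \<le> Y" "2 * Y \<le> Z" for a X Y Z :: real
      using that by simp
    have "X \<le> Z" "Y \<le> Z" if "X + Y \<le> Z" "0 \<le> X" "0 \<le> Y" for X Y Z :: real
      using that by linarith+
    from two[OF this(1)[OF sum nn] \<epsilon>(2)] two[OF this(2)[OF sum nn] \<epsilon>(3)]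
    show "\<mu>x * (norm (xh - xs))\<^sup>2 \<le> \<mu>x * \<epsilon>\<^sup>2" "\<mu>y * (norm (yh - ys))\<^sup>2 \<le> \<mu>y * \<epsilon>\<^sup>2" .
  qed
  then have "(norm (xh - xs))\<^sup>2 \<le> \<epsilon>\<^sup>2" "(norm (yh - ys))\<^sup>2 \<le> \<epsilon>\<^sup>2"
    using mu_pos by simp_all
  then have "norm (xh - xs) \<le> \<epsilon>" "norm (yh - ys) \<le> \<epsilon>"
    using \<epsilon>(1) by (auto intro: power2_le_imp_le)
  then have "max (norm (xh - xs)) (norm (yh - ys)) \<le> \<epsilon>" by simp
  moreover have "exact_solution m Qx r F h xs ys"
    using xs ys by (auto simp: exact_solution_def is_arg_min_linorder is_arg_max_linorder)
  ultimately show ?thesis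
    using xh yh unfolding eps_solution_def xh_def[symmetric] yh_def[symmetric] by blast
qed

end

section \<open>The center-of-gravity method\<close>

lemma nonneg_if_nonneg_perturbed:
  fixes c d :: real
  assumes "\<And>t. 0 < t \<Longrightarrow> t \<le> 1 \<Longrightarrow> 0 \<le> c + t * d" "0 \<le> d"
  shows "0 \<le> c"
proof (rule ccontr)
  assume c: "\<not> 0 \<le> c"
  define t where "t = min 1 (- c / (2 * (d + 1)))"
  have t: "0 < t" "t \<le> 1" using c assms(2) by (auto simp: t_def divide_pos_pos divide_neg_pos)
  have "t * d \<le> - c / (2 * (d + 1)) * (d + 1)"
    unfolding t_def using c assms(2) by (intro mult_mono) (auto simp: divide_nonpos_pos)
  also have "\<dots> = - c / 2" using assms(2) by (simp add: field_simps)
  finally show False using assms(1)[OF t] c by linarith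
qed

text \<open>
  The weights are the positive parts of the affine functions at a point minimising the sum of
  their squares; this replaces the minimax theorem.
\<close>

lemma certificate_exists:
  fixes \<nu> x :: "'i \<Rightarrow> 'a::real_inner"
  assumes Q: "compact Q" "convex Q" "Q \<noteq> {}" and I: "finite I"
    and sep: "\<And>z. z \<in> Q \<Longrightarrow> \<exists>i\<in>I. \<nu> i \<bullet> (x i - z) < \<eta>"
  shows "\<exists>w. (\<forall>i\<in>I. 0 \<le> w i) \<and> sum w I = 1 \<and> (\<forall>z\<in>Q. (\<Sum>i\<in>I. w i * (\<nu> i \<bullet> (x i - z))) \<le> \<eta>)"
proof -
  \<comment> \<open>\<open>a i\<close> is the slack of the i-th inequality; the separation
    hypothesis says that at every z some slack is positive.\<close>
  define a where "a = (\<lambda>i z. \<eta> - \<nu> i \<bullet> (x i - z))"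
  define \<psi> where "\<psi> = (\<lambda>z. \<Sum>i\<in>I. (max 0 (a i z))\<^sup>2)"
  have "continuous_on Q \<psi>" unfolding \<psi>_def a_def by (intro continuous_intros)
  then obtain z0 where z0: "z0 \<in> Q" "\<And>z. z \<in> Q \<Longrightarrow> \<psi> z0 \<le> \<psi> z"
    using continuous_attains_inf[OF Q(1,3)] by blast
  define l where "l = (\<lambda>i. max 0 (a i z0))"
  have l_nonneg: "0 \<le> l i" for i by (simp add: l_def)
  obtain i0 where i0: "i0 \<in> I" "0 < a i0 z0" using sep[OF z0(1)] by (auto simp: a_def)
  have "0 < l i0" using i0 by (simp add: l_def)
  also have "l i0 \<le> sum l I" by (rule member_le_sum[OF i0(1) _ I]) (rule l_nonneg)
  finally have sl: "0 < sum l I" .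
  have key: "0 \<le> (\<Sum>i\<in>I. l i * a i z)" if z: "z \<in> Q" for z
  proof -
    define b where "b = (\<lambda>i. a i z - a i z0)"
    have "0 \<le> 2 * (\<Sum>i\<in>I. l i * b i) + t * (\<Sum>i\<in>I. (b i)\<^sup>2)" if t: "0 < t" "t \<le> 1" for t
    proof -
      define zt where "zt = (1 - t) *\<^sub>R z0 + t *\<^sub>R z"
      have zt: "zt \<in> Q" using Q(2) z0(1) z t by (simp add: zt_def convex_alt)
      have azt: "a i zt = a i z0 + t * b i" for i
        by (simp add: zt_def a_def b_def inner_simps algebra_simps)
      \<comment> \<open>For reals p, q the absolute value of max 0 (p + q) is at most that of max 0
        p + q. So squared positive parts have their first-order expansion as an upper bound, and no
        derivative is taken.\<close>
      have pt: "(max 0 (a i zt))\<^sup>2 \<le> (l i)\<^sup>2 + (2 * (t * (l i * b i)) + t * (t * (b i)\<^sup>2))" for i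
      proof -
        have "\<bar>max 0 (a i zt)\<bar> \<le> \<bar>l i + t * b i\<bar>" unfolding azt l_def by linarith
        then have "(max 0 (a i zt))\<^sup>2 \<le> (l i + t * b i)\<^sup>2" by (simp only: abs_le_square_iff)
        then show ?thesis by (simp add: power2_sum power2_eq_square algebra_simps)
      qed
      have "\<psi> z0 \<le> \<psi> zt" by (rule z0(2)[OF zt])
      also have "\<dots> \<le> (\<Sum>i\<in>I. (l i)\<^sup>2 + (2 * (t * (l i * b i)) + t * (t * (b i)\<^sup>2)))"
        unfolding \<psi>_def by (rule sum_mono) (rule pt)
      also have "\<dots> = \<psi> z0 + (2 * (t * (\<Sum>i\<in>I. l i * b i)) + t * (t * (\<Sum>i\<in>I. (b i)\<^sup>2)))"
        by (simp add: \<psi>_def l_def sum.distrib sum_distrib_left)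
      finally have "0 \<le> t * (2 * (\<Sum>i\<in>I. l i * b i) + t * (\<Sum>i\<in>I. (b i)\<^sup>2))" by (simp add: algebra_simps)
      then show ?thesis using t by (simp add: zero_le_mult_iff)
    qed
    then have "0 \<le> 2 * (\<Sum>i\<in>I. l i * b i)" by (rule nonneg_if_nonneg_perturbed) (auto intro: sum_nonneg)
    then have "0 \<le> (\<Sum>i\<in>I. l i * b i)" by simp
    also have "\<dots> = (\<Sum>i\<in>I. l i * a i z) - (\<Sum>i\<in>I. l i * a i z0)"
      by (simp add: b_def right_diff_distrib sum_subtractf)
    finally have "(\<Sum>i\<in>I. l i * a i z0) \<le> (\<Sum>i\<in>I. l i * a i z)" by simp
    moreover have "0 \<le> (\<Sum>i\<in>I. l i * a i z0)" by (rule sum_nonneg) (auto simp: l_def max_def)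
    ultimately show ?thesis by linarith
  qed
  define w where "w = (\<lambda>i. l i / sum l I)"
  have sw: "sum w I = 1" using sl by (simp add: w_def sum_divide_distrib[symmetric])
  have "(\<Sum>i\<in>I. w i * (\<nu> i \<bullet> (x i - z))) \<le> \<eta>" if z: "z \<in> Q" for z
  proof -
    have "0 \<le> (\<Sum>i\<in>I. l i * a i z) / sum l I" using key[OF z] sl by simp
    also have "\<dots> = (\<Sum>i\<in>I. w i * a i z)" by (simp add: w_def sum_divide_distrib)
    also have "\<dots> = (\<Sum>i\<in>I. w i * \<eta>) - (\<Sum>i\<in>I. w i * (\<nu> i \<bullet> (x i - z)))"
      by (simp add: a_def right_diff_distrib sum_subtractf)
    also have "(\<Sum>i\<in>I. w i * \<eta>) = \<eta>" using sw by (simp add: sum_distrib_right[symmetric])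
    finally show ?thesis by simp
  qed
  moreover have "0 \<le> w i" for i using l_nonneg sl by (simp add: w_def)
  ultimately show ?thesis using sw by blast
qed

section \<open>Cuts, localizers and certificates\<close>

type_synonym cut = "rvec \<times> rvec \<times> rvec"

text \<open>With open half-spaces a cut by \<open>\<nu> = 0\<close> leaves nothing, so this case needs no separate treatment.\<close>

definition localizer :: "rvec set \<Rightarrow> cut list \<Rightarrow> rvec set" where
  "localizer Q cs = Q \<inter> {z. \<forall>(x, y, \<nu>)\<in>set cs. \<nu> \<bullet> (z - x) < 0}"

lemma localizer_Nil [simp]: "localizer Q [] = Q"
  by (simp add: localizer_def)

lemma localizer_Cons: "localizer Q ((x, y, \<nu>) # cs) = localizer Q cs \<inter> {z. \<nu> \<bullet> (z - x) < 0}"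
  by (auto simp: localizer_def)

lemma localizer_subset: "localizer Q cs \<subseteq> Q"
  by (auto simp: localizer_def)

lemma borel_localizer: "Q \<in> sets borel \<Longrightarrow> localizer Q cs \<in> sets borel"
proof (induction cs)
  case (Cons c cs)
  then show ?case
    using borel_open_halfspace by (cases c) (simp add: localizer_Cons sets.Int)
qed simp

lemma convex_localizer: "convex Q \<Longrightarrow> convex (localizer Q cs)"
proof (induction cs)
  case (Cons c cs)
  obtain x y \<nu> where c: "c = (x, y, \<nu>)" by (cases c)
  have "{z. \<nu> \<bullet> (z - x) < 0} = {z. \<nu> \<bullet> z < \<nu> \<bullet> x}" by (simp add: inner_diff_right)
  then show ?case
    using Cons by (simp add: c localizer_Cons convex_Int convex_halfspace_lt)
qed simp

text \<open>
  The centroid is meaningless once the localizer is a null set; the fallback keeps the query point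
  in the relative interior, where subgradients exist.
\<close>

definition next_point :: "nat \<Rightarrow> rvec set \<Rightarrow> cut list \<Rightarrow> rvec" where
  "next_point n Q cs = (let c = centroid n (localizer Q cs) in if c \<in> rint n Q then c else SOME x. x \<in> rint n Q)"

definition cut_step :: "nat \<Rightarrow> rvec set \<Rightarrow> (rvec \<Rightarrow> rvec prog) \<Rightarrow> cut list \<Rightarrow> cut list prog" where
  "cut_step n Q solver cs = (let x = next_point n Q cs in
     bind_prog (solver x) (\<lambda>y. Query (Sub_xF x y) (\<lambda>a. Query (Sub_r x) (\<lambda>b. Done ((x, y, a + b) # cs)))))"

definition certificate :: "rvec set \<Rightarrow> real \<Rightarrow> cut list \<Rightarrow> (nat \<Rightarrow> real) \<Rightarrow> bool" where
  "certificate Q \<eta> cs w \<longleftrightarrow> (\<forall>i<length cs. 0 \<le> w i) \<and> (\<Sum>i<length cs. w i) = 1 \<and>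
     (\<forall>z\<in>Q. (\<Sum>i<length cs. w i * (snd (snd (cs ! i)) \<bullet> (fst (cs ! i) - z))) \<le> \<eta>)"

text \<open>Being a certificate depends only on Q, \<eta> and the recorded cuts, all known to the
  algorithm, so choosing the weights costs no query.\<close>

definition certified_point :: "rvec set \<Rightarrow> real \<Rightarrow> cut list \<Rightarrow> rvec \<times> rvec" where
  "certified_point Q \<eta> cs = (let w = SOME w. certificate Q \<eta> cs w in
     (\<Sum>i<length cs. w i *\<^sub>R fst (cs ! i), \<Sum>i<length cs. w i *\<^sub>R fst (snd (cs ! i))))"

definition center_of_gravity_method ::
  "nat \<Rightarrow> rvec set \<Rightarrow> (rvec \<Rightarrow> rvec prog) \<Rightarrow> real \<Rightarrow> nat \<Rightarrow> (rvec \<times> rvec) prog" where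
  "center_of_gravity_method n Q solver \<eta> K =
     bind_prog (iter_prog K (\<lambda>_. cut_step n Q solver) []) (\<lambda>cs. Done (certified_point Q \<eta> cs))"

section \<open>The outer loop on a saddle problem\<close>

context saddle_problem
begin

lemma Qx_borel: "Qx \<in> sets borel"
  using Qx_compact by (intro borel_closed compact_imp_closed)

lemma Qx_bounded: "bounded Qx"
  using Qx_compact by (rule compact_imp_bounded)

lemma measure_Qx_pos: "0 < measure (leb n) Qx"
proof -
  obtain x0 where "x0 \<in> rint n Qx" using rint_Qx by blast
  then have "0 < emeasure (leb n) Qx" by (rule emeasure_leb_pos[OF Qx_borel])
  then show ?thesis
    using emeasure_leb_bounded[OF Qx_bounded] by (simp add: measure_def enn2real_positive_iff)
qed

lemma next_point_rint: "next_point n Qx cs \<in> rint n Qx"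
  using rint_Qx by (auto simp: next_point_def Let_def intro: someI_ex)

lemma measure_localizer_next_point:
  "measure (leb n) (localizer Qx cs \<inter> {z. \<nu> \<bullet> (z - next_point n Qx cs) < 0}) \<le> 9 / 10 * measure (leb n) (localizer Qx cs)"
proof -
  let ?K = "localizer Qx cs"
  have K: "?K \<in> sets borel" "bounded ?K" "?K \<subseteq> Rn n" "convex ?K"
    using borel_localizer[OF Qx_borel] bounded_subset[OF Qx_bounded localizer_subset] localizer_subset[of Qx cs]
      Qx_subset convex_localizer[OF Qx_convex] by auto
  show ?thesis
  proof (cases "measure (leb n) ?K = 0")
    case True
    have "measure (leb n) (?K \<inter> {z. \<nu> \<bullet> (z - next_point n Qx cs) < 0}) \<le> measure (leb n) ?K"
      using K emeasure_leb_bounded[OF K(2)] borel_open_halfspace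
      by (intro measure_mono_fmeasurable) (auto simp: fmeasurable_def)
    with True show ?thesis by simp
  next
    case False
    then have "0 < measure (leb n) ?K" by (simp add: zero_less_measure_iff)
    then have "centroid n ?K \<in> rint n Qx"
      by (intro centroid_in_rint Qx_borel Qx_bounded Qx_subset Qx_convex rint_Qx dims K(1) localizer_subset)
    then have "next_point n Qx cs = centroid n ?K" by (simp add: next_point_def Let_def)
    then show ?thesis using measure_cut_at_centroid[OF K] by simp
  qed
qed

text \<open>Together these conditions make \<nu> a \<delta>-subgradient of g at x: h y cancels, S(z,
  y) is at most Smax z, and S(x, y) falls short of Smax x by at most \<delta>. The response y stays
  in the record because the final dual point is built from it.\<close>

definition good_cut :: "real \<Rightarrow> cut \<Rightarrow> bool" where
  "good_cut \<delta> c \<longleftrightarrow> (case c of (x, y, \<nu>) \<Rightarrow> x \<in> Qx \<and> y \<in> Rn m \<and> Smax x - S x y \<le> \<delta> \<and>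
     (\<forall>z\<in>Qx. r x + F x y + \<nu> \<bullet> (z - x) \<le> r z + F z y))"

lemma spec_cut_step:
  assumes solver: "\<And>x. x \<in> Qx \<Longrightarrow> spec (correct_answers n m Qx r F h) (solver x) N (\<lambda>y. y \<in> Rn m \<and> Smax x - S x y \<le> \<delta>)"
    and cs: "length cs = k" "\<forall>c\<in>set cs. good_cut \<delta> c" "measure (leb n) (localizer Qx cs) \<le> (9 / 10) ^ k * measure (leb n) Qx"
  shows "spec (correct_answers n m Qx r F h) (cut_step n Qx solver cs) (\<lambda>\<kappa>. N \<kappa> + (only K_Sub_xF \<kappa> + only K_Sub_r \<kappa>))
    (\<lambda>cs. length cs = Suc k \<and> (\<forall>c\<in>set cs. good_cut \<delta> c) \<and>
      measure (leb n) (localizer Qx cs) \<le> (9 / 10) ^ Suc k * measure (leb n) Qx)"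
proof -
  let ?O = "correct_answers n m Qx r F h"
  define x where "x = next_point n Qx cs"
  have x: "x \<in> rint n Qx" "x \<in> Qx" using next_point_rint rint_subset by (auto simp: x_def)
  have r_cvx: "convex_on Qx r" using r_strongly_convex mu_pos by (intro strongly_convex_on_imp_convex_on) auto
  show ?thesis
    unfolding cut_step_def Let_def x_def[symmetric]
  proof (rule spec_bind[OF solver[OF x(2)]])
    fix y assume y: "y \<in> Rn m \<and> Smax x - S x y \<le> \<delta>"
    \<comment> \<open>The query point is in the relative interior, so both subgradient queries have
      correct answers and cannot be answered arbitrarily.\<close>
    have ne: "?O (Sub_xF x y) \<noteq> {}" "?O (Sub_r x) \<noteq> {}"
      using y subgradients_on_rint_nonempty[OF F_convex[of y] Qx_subset x(1)]
        subgradients_on_rint_nonempty[OF r_cvx Qx_subset x(1)] by auto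
    have "length ((x, y, a + b) # cs) = Suc k \<and> (\<forall>c\<in>set ((x, y, a + b) # cs). good_cut \<delta> c) \<and>
      measure (leb n) (localizer Qx ((x, y, a + b) # cs)) \<le> (9 / 10) ^ Suc k * measure (leb n) Qx"
      if ab: "a \<in> ?O (Sub_xF x y)" "b \<in> ?O (Sub_r x)" for a b
    proof -
      have a: "F x y + a \<bullet> (z - x) \<le> F z y" if "z \<in> Qx" for z
        using ab(1) y that by (auto simp: subgradients_on_def)
      have b: "r x + b \<bullet> (z - x) \<le> r z" if "z \<in> Qx" for z
        using ab(2) that by (auto simp: subgradients_on_def)
      have "good_cut \<delta> (x, y, a + b)"
        using x(2) y a b unfolding good_cut_def prod.case inner_add_left by (smt (verit))
      moreover have "measure (leb n) (localizer Qx ((x, y, a + b) # cs)) \<le> 9 / 10 * measure (leb n) (localizer Qx cs)"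
        unfolding localizer_Cons x_def by (rule measure_localizer_next_point)
      ultimately show ?thesis using cs by auto
    qed
    then show "spec ?O (Query (Sub_xF x y) (\<lambda>a. Query (Sub_r x) (\<lambda>b. Done ((x, y, a + b) # cs))))
      (\<lambda>\<kappa>. only K_Sub_xF \<kappa> + only K_Sub_r \<kappa>)
      (\<lambda>cs. length cs = Suc k \<and> (\<forall>c\<in>set cs. good_cut \<delta> c) \<and>
      measure (leb n) (localizer Qx cs) \<le> (9 / 10) ^ Suc k * measure (leb n) Qx)"
      using ne by (simp add: only_def)
  qed
qed

text \<open>The removed point z + \<theta> (w - z) is in Qx, so it violates some cut. Affinity gives
  (1 - \<theta>) (\<nu> \<bullet> (x - z)) \<le> \<theta> (\<nu> \<bullet> (w - x)), and \<nu>
  \<bullet> (w - x) \<le> B + \<delta> because \<nu> is a \<delta>-subgradient of g.\<close>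

lemma good_cuts_separate:
  assumes cs: "\<forall>c\<in>set cs. good_cut \<delta> c" "measure (leb n) (localizer Qx cs) < \<theta> ^ n * measure (leb n) Qx"
    and B: "\<And>x w. x \<in> Qx \<Longrightarrow> w \<in> Qx \<Longrightarrow> g w - g x \<le> B" and \<theta>: "0 < \<theta>" "\<theta> < 1" "\<theta> * (B + \<delta>) < \<eta> * (1 - \<theta>)"
    and z: "z \<in> Qx"
  shows "\<exists>i<length cs. snd (snd (cs ! i)) \<bullet> (fst (cs ! i) - z) < \<eta>"
proof -
  have "z \<in> Rn n" using z Qx_subset by blast
  from small_set_misses_homothety[OF Qx_borel Qx_bounded this \<theta>(1) borel_localizer[OF Qx_borel]
      bounded_subset[OF Qx_bounded localizer_subset] cs(2)]
  obtain w where w: "w \<in> Qx" "z + \<theta> *\<^sub>R (w - z) \<notin> localizer Qx cs" by blast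
  have eq: "z + \<theta> *\<^sub>R (w - z) = (1 - \<theta>) *\<^sub>R z + \<theta> *\<^sub>R w" by (simp add: algebra_simps)
  have "z + \<theta> *\<^sub>R (w - z) \<in> Qx" unfolding eq using Qx_convex z w \<theta> by (simp add: convex_alt)
  with w obtain c where c: "c \<in> set cs" "\<not> (case c of (x, y, \<nu>) \<Rightarrow> \<nu> \<bullet> (z + \<theta> *\<^sub>R (w - z) - x) < 0)"
    by (auto simp: localizer_def)
  obtain x y \<nu> where xy: "c = (x, y, \<nu>)" by (cases c)
  have "z + \<theta> *\<^sub>R (w - z) - x = (1 - \<theta>) *\<^sub>R (z - x) + \<theta> *\<^sub>R (w - x)" by (simp add: algebra_simps)
  then have 1: "0 \<le> (1 - \<theta>) * (\<nu> \<bullet> (z - x)) + \<theta> * (\<nu> \<bullet> (w - x))"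
    using c(2) by (simp add: xy inner_add_right)
  have good: "x \<in> Qx" "y \<in> Rn m" "Smax x - S x y \<le> \<delta>" "r x + F x y + \<nu> \<bullet> (w - x) \<le> r w + F w y"
    using cs(1) c(1) w(1) by (auto simp: good_cut_def xy)
  have "\<nu> \<bullet> (w - x) \<le> B + \<delta>"
    using good B[OF good(1) w(1)] S_le_Smax[OF w(1) good(2)] unfolding g_eq by linarith
  then have "\<theta> * (\<nu> \<bullet> (w - x)) \<le> \<theta> * (B + \<delta>)" using \<theta> by (intro mult_left_mono) auto
  also note \<theta>(3)
  finally have "(1 - \<theta>) * (- (\<nu> \<bullet> (z - x))) < (1 - \<theta>) * \<eta>" using 1 by (simp add: mult.commute)
  then have "- (\<nu> \<bullet> (z - x)) < \<eta>" using \<theta>(2) by (simp only: mult_less_cancel_left_pos diff_gt_0_iff_gt)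
  then have "\<nu> \<bullet> (x - z) < \<eta>" by (simp add: inner_diff_right)
  moreover obtain i where "i < length cs" "cs ! i = c" using c(1) by (auto simp: in_set_conv_nth)
  ultimately show ?thesis using xy by (intro exI[of _ i]) simp
qed

lemma spec_center_of_gravity_method:
  assumes solver: "\<And>x. x \<in> Qx \<Longrightarrow> spec (correct_answers n m Qx r F h) (solver x) N (\<lambda>y. y \<in> Rn m \<and> Smax x - S x y \<le> \<delta>)"
    and B: "\<And>x w. x \<in> Qx \<Longrightarrow> w \<in> Qx \<Longrightarrow> g w - g x \<le> B"
    and \<theta>: "0 < \<theta>" "\<theta> < 1" "\<theta> * (B + \<delta>) < \<eta> * (1 - \<theta>)" "(9 / 10) ^ K < \<theta> ^ n"
    and \<epsilon>: "0 < \<epsilon>" "2 * (\<delta> + \<eta>) \<le> \<mu>x * \<epsilon>\<^sup>2" "2 * (\<delta> + \<eta>) \<le> \<mu>y * \<epsilon>\<^sup>2"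
  shows "spec (correct_answers n m Qx r F h) (center_of_gravity_method n Qx solver \<eta> K)
    (\<lambda>\<kappa>. K * (N \<kappa> + (only K_Sub_xF \<kappa> + only K_Sub_r \<kappa>)))
    (\<lambda>v. eps_solution m Qx r F h \<epsilon> (fst v) (snd v))"
proof -
  let ?Inv = "\<lambda>k cs. length cs = k \<and> (\<forall>c\<in>set cs. good_cut \<delta> c) \<and>
      measure (leb n) (localizer Qx cs) \<le> (9 / 10) ^ k * measure (leb n) Qx"
  have "spec (correct_answers n m Qx r F h) (iter_prog K (\<lambda>_. cut_step n Qx solver) [])
    (\<lambda>\<kappa>. K * (N \<kappa> + (only K_Sub_xF \<kappa> + only K_Sub_r \<kappa>))) (?Inv K)"
    by (rule spec_iter[where Inv="?Inv"]) (simp, intro spec_cut_step solver, auto)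
  then have "spec (correct_answers n m Qx r F h) (center_of_gravity_method n Qx solver \<eta> K)
    (\<lambda>\<kappa>. K * (N \<kappa> + (only K_Sub_xF \<kappa> + only K_Sub_r \<kappa>)) + 0)
    (\<lambda>v. eps_solution m Qx r F h \<epsilon> (fst v) (snd v))"
    unfolding center_of_gravity_method_def
  proof (rule spec_bind)
    fix cs assume cs: "?Inv K cs"
    have "(9 / 10) ^ K * measure (leb n) Qx < \<theta> ^ n * measure (leb n) Qx"
      using \<theta>(4) measure_Qx_pos by simp
    then have small: "measure (leb n) (localizer Qx cs) < \<theta> ^ n * measure (leb n) Qx"
      using cs by linarith
    have "\<exists>w. certificate Qx \<eta> cs w"
    proof -
      have "\<exists>w. (\<forall>i\<in>{..<length cs}. 0 \<le> w i) \<and> sum w {..<length cs} = 1 \<and>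
          (\<forall>z\<in>Qx. (\<Sum>i<length cs. w i * (snd (snd (cs ! i)) \<bullet> (fst (cs ! i) - z))) \<le> \<eta>)"
      proof (rule certificate_exists[OF Qx_compact Qx_convex])
        show "Qx \<noteq> {}" using rint_Qx rint_subset by blast
        fix z assume "z \<in> Qx"
        then show "\<exists>i\<in>{..<length cs}. snd (snd (cs ! i)) \<bullet> (fst (cs ! i) - z) < \<eta>"
          using good_cuts_separate[OF _ small B \<theta>(1-3)] cs by blast
      qed simp
      then show ?thesis by (simp add: certificate_def Ball_def)
    qed
    then have "certificate Qx \<eta> cs (SOME w. certificate Qx \<eta> cs w)" by (rule someI_ex)
    then obtain w where w: "certificate Qx \<eta> cs w" "w = (SOME w. certificate Qx \<eta> cs w)" by blast
    have good: "fst (cs ! i) \<in> Qx" "fst (snd (cs ! i)) \<in> Rn m"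
      "Smax (fst (cs ! i)) - S (fst (cs ! i)) (fst (snd (cs ! i))) \<le> \<delta>"
      "\<And>z. z \<in> Qx \<Longrightarrow> r (fst (cs ! i)) + F (fst (cs ! i)) (fst (snd (cs ! i))) + snd (snd (cs ! i)) \<bullet> (z - fst (cs ! i))
        \<le> r z + F z (fst (snd (cs ! i)))"
      if "i < length cs" for i
    proof -
      have "good_cut \<delta> (cs ! i)" using cs that by auto
      then show "fst (cs ! i) \<in> Qx" "fst (snd (cs ! i)) \<in> Rn m"
        "Smax (fst (cs ! i)) - S (fst (cs ! i)) (fst (snd (cs ! i))) \<le> \<delta>"
        "\<And>z. z \<in> Qx \<Longrightarrow> r (fst (cs ! i)) + F (fst (cs ! i)) (fst (snd (cs ! i))) + snd (snd (cs ! i)) \<bullet> (z - fst (cs ! i))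
          \<le> r z + F z (fst (snd (cs ! i)))"
        by (auto simp: good_cut_def split: prod.splits)
    qed
    have "eps_solution m Qx r F h \<epsilon> (\<Sum>i<length cs. w i *\<^sub>R fst (cs ! i)) (\<Sum>i<length cs. w i *\<^sub>R fst (snd (cs ! i)))"
      by (rule approximate_saddle_point[where \<delta>=\<delta> and \<eta>=\<eta> and \<nu>="\<lambda>i. snd (snd (cs ! i))"])
         (use w(1) good \<epsilon> in \<open>auto simp: certificate_def\<close>)
    then show "spec (correct_answers n m Qx r F h) (Done (certified_point Qx \<eta> cs)) (\<lambda>_. 0)
      (\<lambda>v. eps_solution m Qx r F h \<epsilon> (fst v) (snd v))"
      by (simp add: certified_point_def Let_def w(2)[symmetric])
  qed
  then show ?thesis by simp
qed

end

section \<open>Query counts\<close>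

text \<open>
  The parameters of the method are \<open>\<theta> = \<epsilon> ^ 4\<close> and \<open>\<delta> = \<eta> = \<epsilon> ^ 3\<close>: the spare factor \<open>\<epsilon>\<close> absorbs all
  constants that depend on \<open>r\<close>, \<open>F\<close> and \<open>h\<close>, which the algorithm does not know.
\<close>

definition outer_count :: "nat \<Rightarrow> real \<Rightarrow> nat" where
  "outer_count n \<epsilon> = nat \<lceil>real n * 4 * ln (1 / \<epsilon>) / ln (10 / 9)\<rceil> + 1"

text \<open>R halvings reach \<epsilon> ^ 4; one of the four powers pays for the unknown initial
  excess, leaving \<delta> = \<epsilon> ^ 3.\<close>

definition restart_count :: "real \<Rightarrow> nat" where
  "restart_count \<epsilon> = nat \<lceil>4 * ln (1 / \<epsilon>) / ln 2\<rceil>"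

lemma restart_count_accuracy:
  assumes "0 < \<epsilon>" "\<epsilon> < 1"
  shows "(1 / 2) ^ restart_count \<epsilon> \<le> \<epsilon> ^ 4"
proof -
  have "4 * ln (1 / \<epsilon>) / ln 2 \<le> real (restart_count \<epsilon>)"
    unfolding restart_count_def by (rule real_nat_ceiling_ge)
  then have "4 * ln (1 / \<epsilon>) \<le> real (restart_count \<epsilon>) * ln 2"
    by (simp add: pos_divide_le_eq)
  then have "exp (- (real (restart_count \<epsilon>) * ln 2)) \<le> exp (- (4 * ln (1 / \<epsilon>)))" by simp
  also have "exp (- (4 * ln (1 / \<epsilon>))) = exp (real 4 * ln \<epsilon>)"
    using assms by (simp add: ln_div)
  also have "\<dots> = \<epsilon> ^ 4" using assms by (simp only: exp_of_nat_mult exp_ln)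
  also have "exp (- (real (restart_count \<epsilon>) * ln 2)) = (1 / 2) ^ restart_count \<epsilon>"
    by (simp add: exp_minus exp_of_nat_mult power_divide inverse_eq_divide)
  finally show ?thesis .
qed

text \<open>Each cut keeps at most 9/10 of the volume, whence ln (10 / 9). The \<open>+ 1\<close> in
  the count makes the inequality strict, as the volume comparison requires.\<close>

lemma outer_count_volume:
  assumes "0 < \<epsilon>" "\<epsilon> < 1"
  shows "(9 / 10) ^ outer_count n \<epsilon> < (\<epsilon> ^ 4) ^ n"
proof -
  have l: "0 < ln (10 / 9 :: real)" by simp
  have "real n * 4 * ln (1 / \<epsilon>) / ln (10 / 9) < real (outer_count n \<epsilon>)"
    using real_nat_ceiling_ge[of "real n * 4 * ln (1 / \<epsilon>) / ln (10 / 9)"] unfolding outer_count_def by linarith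
  then have "real n * 4 * ln (1 / \<epsilon>) < real (outer_count n \<epsilon>) * ln (10 / 9)"
    by (simp only: pos_divide_less_eq[OF l])
  then have "exp (- (real (outer_count n \<epsilon>) * ln (10 / 9))) < exp (- (real n * 4 * ln (1 / \<epsilon>)))" by simp
  also have "- (real n * 4 * ln (1 / \<epsilon>)) = real n * (real 4 * ln \<epsilon>)"
    using assms by (simp add: ln_div)
  also have "exp \<dots> = (\<epsilon> ^ 4) ^ n" using assms by (simp only: exp_of_nat_mult exp_ln)
  also have "exp (- (real (outer_count n \<epsilon>) * ln (10 / 9))) = (9 / 10) ^ outer_count n \<epsilon>"
    by (simp add: exp_minus exp_of_nat_mult power_divide inverse_eq_divide)
  finally show ?thesis .
qed

section \<open>Numerical constants of the counts\<close>

lemma one_minus_inverse_le_ln: "0 < x \<Longrightarrow> 1 - 1 / x \<le> ln (x :: real)"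
  using ln_le_minus_one[of "1 / x"] by (simp add: ln_div)

lemma nat_ceiling_le: "0 \<le> z \<Longrightarrow> real (nat \<lceil>z\<rceil>) \<le> z + 1"
  by linarith

lemma ln_inverse_ge_1:
  assumes "0 < \<epsilon>" "\<epsilon> < 1 / 3"
  shows "1 \<le> ln (1 / \<epsilon> :: real)"
proof -
  have "3 \<le> 1 / \<epsilon>" using assms by (simp add: field_simps)
  then have "exp 1 \<le> 1 / \<epsilon>" using exp_le by linarith
  then show ?thesis using assms by (simp add: ln_ge_iff)
qed

text \<open>From ln 2 \<ge> 1 / 2 the count is at most 8 ln (1 / \<epsilon>) plus 1 for rounding,
  and ln (1 / \<epsilon>) \<ge> 1 swallows the 1.\<close>

lemma restart_count_le:
  assumes "0 < \<epsilon>" "\<epsilon> < 1 / 3"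
  shows "real (restart_count \<epsilon>) \<le> 9 * ln (1 / \<epsilon>)"
proof -
  define L where "L = ln (1 / \<epsilon>)"
  have L: "1 \<le> L" using ln_inverse_ge_1[OF assms] by (simp add: L_def)
  have l: "1 / 2 \<le> ln (2::real)" using one_minus_inverse_le_ln[of 2] by simp
  have "4 * L / ln 2 \<le> 4 * L / (1 / 2)" using L l by (intro divide_left_mono) auto
  then have "4 * L / ln 2 \<le> 8 * L" by simp
  moreover have "real (restart_count \<epsilon>) \<le> 4 * L / ln 2 + 1"
    unfolding restart_count_def L_def[symmetric] using L by (intro nat_ceiling_le) simp
  ultimately show ?thesis using L unfolding L_def[symmetric] by linarith
qed

text \<open>From ln (10 / 9) \<ge> 1 / 10 comes 40; the ceiling and the extra step add 2.\<close>

lemma outer_count_le: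
  assumes "0 < \<epsilon>" "\<epsilon> < 1 / 3" "1 \<le> n"
  shows "real (outer_count n \<epsilon>) \<le> 42 * (real n * ln (1 / \<epsilon>))"
proof -
  define L where "L = real n * ln (1 / \<epsilon>)"
  have "1 * 1 \<le> L" unfolding L_def using ln_inverse_ge_1[OF assms(1,2)] assms(3) by (intro mult_mono) auto
  then have L: "1 \<le> L" by simp
  have l: "1 / 10 \<le> ln (10 / 9 :: real)" using one_minus_inverse_le_ln[of "10 / 9"] by simp
  have "4 * L / ln (10 / 9) \<le> 4 * L / (1 / 10)" using L l by (intro divide_left_mono) auto
  then have "4 * L / ln (10 / 9) \<le> 40 * L" by simp
  moreover have "real (outer_count n \<epsilon>) \<le> 4 * L / ln (10 / 9) + 1 + 1"
  proof -
    have eq: "real n * 4 * ln (1 / \<epsilon>) = 4 * L" by (simp add: L_def)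
    have "0 \<le> 4 * L / ln (10 / 9)" using L by simp
    from nat_ceiling_le[OF this] show ?thesis
      unfolding outer_count_def eq by linarith
  qed
  ultimately show ?thesis using L unfolding L_def[symmetric] by linarith
qed

lemma outer_count_le_ln:
  assumes "0 < \<epsilon>" "\<epsilon> < 1 / 3" "1 \<le> n"
  shows "real (outer_count n \<epsilon>) \<le> 42 * (real n * ln (real n / \<epsilon>))"
proof -
  have "1 / \<epsilon> \<le> real n / \<epsilon>" using assms by (intro divide_right_mono) auto
  then have "ln (1 / \<epsilon>) \<le> ln (real n / \<epsilon>)" using assms by simp
  then have "real n * ln (1 / \<epsilon>) \<le> real n * ln (real n / \<epsilon>)" by (intro mult_left_mono) auto
  then show ?thesis using outer_count_le[OF assms] by linarith
qed

lemma outer_count_le_12000: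
  assumes "0 < \<epsilon>" "\<epsilon> < 1 / 3" "1 \<le> n"
  shows "real (outer_count n \<epsilon>) \<le> 12000 * (real n * ln (real n / \<epsilon>))"
  using outer_count_le_ln[OF assms] of_nat_0_le_iff[of "outer_count n \<epsilon>", where 'a = real] by linarith

text \<open>The common constant: 42 for the cuts, 9 for the restarts and 30 for a stage multiply to
  11340, rounded up to 12000.\<close>

lemma outer_times_inner_count_le:
  assumes \<epsilon>: "0 < \<epsilon>" "\<epsilon> < 1 / 3" "1 \<le> n" and T: "real T \<le> 30 * c"
  shows "real (outer_count n \<epsilon> * (restart_count \<epsilon> * T)) \<le> 12000 * (real n * c * ln (real n / \<epsilon>) * ln (1 / \<epsilon>))"
proof -
  have c: "0 \<le> c" using T of_nat_0_le_iff[of T] by linarith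
  have L: "0 \<le> ln (1 / \<epsilon>)" using ln_inverse_ge_1[OF \<epsilon>(1,2)] by linarith
  have "0 \<le> 42 * (real n * ln (real n / \<epsilon>))" using outer_count_le_ln[OF \<epsilon>] by (rule order_trans[rotated]) simp
  then have nL: "0 \<le> real n * ln (real n / \<epsilon>)" by simp
  then have nL': "0 \<le> ln (real n / \<epsilon>)" using \<epsilon>(3) by (simp add: zero_le_mult_iff)
  have "real (outer_count n \<epsilon> * (restart_count \<epsilon> * T)) = real (outer_count n \<epsilon>) * (real (restart_count \<epsilon>) * real T)" by simp
  also have "\<dots> \<le> (42 * (real n * ln (real n / \<epsilon>))) * ((9 * ln (1 / \<epsilon>)) * (30 * c))"
    using restart_count_le[OF \<epsilon>(1,2)] outer_count_le_ln[OF \<epsilon>] T L nL nL' c by (intro mult_mono) auto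
  also have "\<dots> = 11340 * ((real n * ln (real n / \<epsilon>)) * (ln (1 / \<epsilon>) * c))" by simp
  also have "\<dots> \<le> 12000 * ((real n * ln (real n / \<epsilon>)) * (ln (1 / \<epsilon>) * c))"
    using nL' L c by (intro mult_right_mono mult_nonneg_nonneg) auto
  finally show ?thesis by (simp add: mult_ac)
qed

text \<open>The smoothness constant \<open>2 * max Lyy \<mu>\<close> is positive even for Lyy = 0
  and never below \<mu>, so rounding up costs only a constant factor: 4 is sqrt 16, and the fifth
  unit is the rounding.\<close>

lemma prox_stages_le:
  assumes "0 < \<mu>"
  shows "real (prox_stages (2 * max Lyy \<mu>) \<mu>) \<le> 5 * sqrt (max 1 (Lyy / \<mu>))"
proof -
  let ?k = "max 1 (Lyy / \<mu>)"
  have "8 * (2 * max Lyy \<mu>) / \<mu> = 16 * ?k"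
    using assms by (simp add: max_def field_simps)
  then have "real (prox_stages (2 * max Lyy \<mu>) \<mu>) \<le> sqrt (16 * ?k) + 1"
    unfolding prox_stages_def by (simp only:) (rule nat_ceiling_le, simp)
  also have "sqrt (16 * ?k) = 4 * sqrt ?k" by (simp only: real_sqrt_mult) simp
  finally show ?thesis
    using real_sqrt_ge_one[of ?k] by linarith
qed

lemma sliding_outer_le:
  assumes "0 < \<mu>" "\<mu> \<le> Lp"
  shows "real (sliding_outer Lp \<mu>) \<le> 5 * sqrt (Lp / \<mu>)"
proof -
  have "real (sliding_outer Lp \<mu>) \<le> sqrt (16 * Lp / \<mu>) + 1"
    unfolding sliding_outer_def using assms by (intro nat_ceiling_le) simp
  also have "sqrt (16 * Lp / \<mu>) = 4 * sqrt (Lp / \<mu>)" by (simp add: real_sqrt_mult real_sqrt_divide)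
  finally have "real (sliding_outer Lp \<mu>) \<le> 4 * sqrt (Lp / \<mu>) + 1" .
  moreover have "1 \<le> Lp / \<mu>" using assms by simp
  then have "1 \<le> sqrt (Lp / \<mu>)" by (rule real_sqrt_ge_one)
  ultimately show ?thesis by linarith
qed

text \<open>The two square roots multiply to sqrt (Lq / \<mu>), free of Lp. The order \<mu> \<le> Lp
  \<le> Lq keeps both of them at least 1, so rounding costs only the constants in 5 * 3.\<close>

lemma sliding_outer_inner_le:
  assumes "0 < \<mu>" "\<mu> \<le> Lp" "Lp \<le> Lq"
  shows "real (sliding_outer Lp \<mu> * sliding_inner Lp Lq) \<le> 15 * sqrt (Lq / \<mu>)"
proof -
  have "real (sliding_inner Lp Lq) \<le> sqrt (4 * Lq / Lp) + 1"
    unfolding sliding_inner_def using assms by (intro nat_ceiling_le) simp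
  also have "sqrt (4 * Lq / Lp) = 2 * sqrt (Lq / Lp)" by (simp add: real_sqrt_mult real_sqrt_divide)
  finally have "real (sliding_inner Lp Lq) \<le> 2 * sqrt (Lq / Lp) + 1" .
  moreover have "1 \<le> Lq / Lp" using assms by simp
  then have "1 \<le> sqrt (Lq / Lp)" by (rule real_sqrt_ge_one)
  ultimately have "real (sliding_inner Lp Lq) \<le> 3 * sqrt (Lq / Lp)" by linarith
  then have "real (sliding_outer Lp \<mu>) * real (sliding_inner Lp Lq) \<le> (5 * sqrt (Lp / \<mu>)) * (3 * sqrt (Lq / Lp))"
    using sliding_outer_le[OF assms(1,2)] assms by (intro mult_mono) auto
  also have "\<dots> = 15 * sqrt ((Lp / \<mu>) * (Lq / Lp))"
  proof -
    have "(5 * a) * (3 * b) = 15 * (a * b)" for a b :: real by simp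
    then show ?thesis by (simp only: real_sqrt_mult)
  qed
  also have "(Lp / \<mu>) * (Lq / Lp) = Lq / \<mu>" using assms by simp
  finally show ?thesis by simp
qed

lemma sqrt_2_times_le: "0 \<le> z \<Longrightarrow> sqrt (2 * z) \<le> 2 * sqrt z"
proof -
  assume "0 \<le> z"
  then have "sqrt (2 * z) \<le> sqrt (4 * z)" by simp
  also have "\<dots> = 2 * sqrt z" by (simp only: real_sqrt_mult) simp
  finally show ?thesis .
qed

text \<open>The term with the smaller constant is made the outer one, since its gradient is taken
  once per outer step and the other gradient once per inner step. Either way each gradient is used
  about as often per stage as the square root of its own condition number.\<close>

definition sliding_solver_F_h :: "nat \<Rightarrow> real \<Rightarrow> real \<Rightarrow> real \<Rightarrow> nat \<Rightarrow> rvec \<Rightarrow> rvec prog" where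
  "sliding_solver_F_h m LF LH \<mu> R x =
     (if LF \<le> LH then sliding_solver m (grad_F_prog x) grad_h_prog LF LH \<mu> R
      else sliding_solver m grad_h_prog (grad_F_prog x) LH LF \<mu> R)"

definition sliding_counts :: "real \<Rightarrow> real \<Rightarrow> real \<Rightarrow> query_kind \<Rightarrow> nat" where
  "sliding_counts LF LH \<mu> \<kappa> =
     (if LF \<le> LH then sliding_outer LF \<mu> * (only K_Grad_yF \<kappa> + sliding_inner LF LH * only K_Grad_h \<kappa>)
      else sliding_outer LH \<mu> * (only K_Grad_h \<kappa> + sliding_inner LH LF * only K_Grad_yF \<kappa>))"

text \<open>The smoothness constants are twice the Lipschitz constants; sqrt (2 z) \<le> 2 sqrt z
  turns 15 into 30.\<close>

lemma sliding_counts_le: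
  assumes \<mu>: "0 < \<mu>" "\<mu> \<le> 2 * Lh"
  shows "real (sliding_counts (2 * max Lyy \<mu>) (2 * Lh) \<mu> K_Grad_yF) \<le> 30 * sqrt (max 1 (Lyy / \<mu>))"
    and "real (sliding_counts (2 * max Lyy \<mu>) (2 * Lh) \<mu> K_Grad_h) \<le> 30 * sqrt (Lh / \<mu>)"
    and "sliding_counts (2 * max Lyy \<mu>) (2 * Lh) \<mu> K_Sub_xF = 0"
    and "sliding_counts (2 * max Lyy \<mu>) (2 * Lh) \<mu> K_Sub_r = 0"
    and "sliding_counts (2 * max Lyy \<mu>) (2 * Lh) \<mu> K_Prox_h = 0"
proof -
  let ?LF = "2 * max Lyy \<mu>" and ?LH = "2 * Lh"
  have LF: "\<mu> \<le> ?LF" using \<mu> by auto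
  have "?LF / \<mu> = 2 * max 1 (Lyy / \<mu>)" using \<mu>(1) by (simp add: max_def field_simps)
  then have F: "sqrt (?LF / \<mu>) \<le> 2 * sqrt (max 1 (Lyy / \<mu>))"
    by (simp only:) (rule sqrt_2_times_le, simp)
  have "?LH / \<mu> = 2 * (Lh / \<mu>)" by simp
  then have H: "sqrt (?LH / \<mu>) \<le> 2 * sqrt (Lh / \<mu>)"
    using \<mu> by (simp only:) (rule sqrt_2_times_le, simp)
  have s: "0 \<le> sqrt (max 1 (Lyy / \<mu>))" "0 \<le> sqrt (Lh / \<mu>)" using \<mu> by auto
  show "real (sliding_counts ?LF ?LH \<mu> K_Grad_yF) \<le> 30 * sqrt (max 1 (Lyy / \<mu>))"
  proof (cases "?LF \<le> ?LH")
    case True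
    then have "sliding_counts ?LF ?LH \<mu> K_Grad_yF = sliding_outer ?LF \<mu>" by (simp only: sliding_counts_def if_True if_False) (simp add: only_def)
    then show ?thesis using sliding_outer_le[OF \<mu>(1) LF] F s by linarith
  next
    case False
    then have "sliding_counts ?LF ?LH \<mu> K_Grad_yF = sliding_outer ?LH \<mu> * sliding_inner ?LH ?LF"
      by (simp only: sliding_counts_def if_True if_False) (simp add: only_def)
    then show ?thesis using sliding_outer_inner_le[OF \<mu>, of ?LF] False F s by linarith
  qed
  show "real (sliding_counts ?LF ?LH \<mu> K_Grad_h) \<le> 30 * sqrt (Lh / \<mu>)"
  proof (cases "?LF \<le> ?LH")
    case True
    then have "sliding_counts ?LF ?LH \<mu> K_Grad_h = sliding_outer ?LF \<mu> * sliding_inner ?LF ?LH"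
      by (simp only: sliding_counts_def if_True if_False) (simp add: only_def)
    then show ?thesis using sliding_outer_inner_le[OF \<mu>(1) LF True] H s by linarith
  next
    case False
    then have "sliding_counts ?LF ?LH \<mu> K_Grad_h = sliding_outer ?LH \<mu>" by (simp only: sliding_counts_def if_True if_False) (simp add: only_def)
    then show ?thesis using sliding_outer_le[OF \<mu>] H s by linarith
  qed
qed (simp_all add: sliding_counts_def only_def)

section \<open>Inner and outer counts combined\<close>

context saddle_problem
begin

lemma smooth_F': "x \<in> Qx \<Longrightarrow> smooth_on (Rn m) (\<lambda>y. - grad m (F x) y) (2 * max Lyy \<mu>y) (\<lambda>y. - F x y)"
  by (rule smooth_on_mono[OF smooth_F]) auto

lemma gap_eq: "(- F x y + h y) - (- F x y' + h y') = S x y' - S x y" "(h y + - F x y) - (h y' + - F x y') = S x y' - S x y"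
  by simp_all

lemma spec_prox_solver_gap:
  assumes x: "x \<in> Qx"
  shows "spec (correct_answers n m Qx r F h) (prox_solver (2 * max Lyy \<mu>y) \<mu>y R x)
    (\<lambda>\<kappa>. R * (prox_stages (2 * max Lyy \<mu>y) \<mu>y * (only K_Grad_yF \<kappa> + only K_Prox_h \<kappa>)))
    (\<lambda>y. y \<in> Rn m \<and> Smax x - S x y \<le> (1 / 2) ^ R * (Smax x - S x 0))"
proof -
  obtain ys where ys: "ys \<in> Rn m" "\<And>y. y \<in> Rn m \<Longrightarrow> S x y \<le> S x ys" "Smax x = S x ys"
    by (rule Smax_attained[OF x]) blast
  have "spec (correct_answers n m Qx r F h) (prox_solver (2 * max Lyy \<mu>y) \<mu>y R x)
    (\<lambda>\<kappa>. R * (prox_stages (2 * max Lyy \<mu>y) \<mu>y * (only K_Grad_yF \<kappa> + only K_Prox_h \<kappa>)))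
    (\<lambda>y. y \<in> Rn m \<and> (- F x y + h y) - (- F x ys + h ys) \<le> (1 / 2) ^ R * ((- F x 0 + h 0) - (- F x ys + h ys)))"
  proof (rule spec_prox_solver[OF x])
    show "- F x ys + h ys \<le> - F x y + h y" if "y \<in> Rn m" for y using ys(2)[OF that] by simp
    show "0 < 2 * max Lyy \<mu>y" using mu_pos by auto
  qed (intro smooth_F'[OF x] F_concave[OF x] grad_F_in_Rn[OF x] h_strongly_convex mu_pos(2) h_continuous ys(1); assumption)+
  then show ?thesis by (simp only: gap_eq ys(3))
qed

text \<open>At the minimiser of h quadratic growth meets the smoothness bound, and using both
  \<open>y0 + ev 0\<close> and \<open>y0 - ev 0\<close> cancels the gradient term. This keeps Lh /
  \<mu>y away from 0, so the count for h needs no maximum with 1.\<close>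

lemma strong_convexity_le_lipschitz:
  assumes h: "lipschitz_gradient m Lh h"
  shows "\<mu>y \<le> 2 * Lh"
proof -
  have cvx: "convex_on (Rn m) h" using h_strongly_convex mu_pos by (intro strongly_convex_on_imp_convex_on) auto
  have sm: "smooth_on (Rn m) (grad m h) (2 * Lh) h"
    using h cvx unfolding lipschitz_gradient_def by (intro smooth_on_grad) auto
  obtain y0 where "is_arg_min h (\<lambda>y. y \<in> Rn m) y0"
    using strongly_convex_attains_inf_Rn[OF h_strongly_convex mu_pos(2) h_continuous] by blast
  then have y0: "y0 \<in> Rn m" "\<And>y. y \<in> Rn m \<Longrightarrow> h y0 \<le> h y" by (auto simp: is_arg_min_linorder)
  have e: "ev 0 \<in> Rn m" using dims by (intro ev_in_Rn) auto
  have u: "y0 + ev 0 \<in> Rn m" "y0 - ev 0 \<in> Rn m" using y0(1) e by auto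
  have lo: "h y0 + \<mu>y / 2 * (norm (u - y0))\<^sup>2 \<le> h u" if "u \<in> Rn m" for u
    by (rule strongly_convex_on_argmin[OF h_strongly_convex y0 that])
  note up = smooth_onD(2)[OF sm y0(1)]
  show ?thesis
    using lo[OF u(1)] lo[OF u(2)] up[OF u(1)] up[OF u(2)] by simp
qed

lemma spec_sliding_solver_gap:
  assumes x: "x \<in> Qx" and h: "lipschitz_gradient m Lh h"
  shows "spec (correct_answers n m Qx r F h) (sliding_solver_F_h m (2 * max Lyy \<mu>y) (2 * Lh) \<mu>y R x)
    (\<lambda>\<kappa>. R * sliding_counts (2 * max Lyy \<mu>y) (2 * Lh) \<mu>y \<kappa>)
    (\<lambda>y. y \<in> Rn m \<and> Smax x - S x y \<le> (1 / 2) ^ R * (Smax x - S x 0))"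
proof -
  let ?LF = "2 * max Lyy \<mu>y" and ?LH = "2 * Lh" and ?O = "correct_answers n m Qx r F h"
  obtain ys where ys: "ys \<in> Rn m" "\<And>y. y \<in> Rn m \<Longrightarrow> S x y \<le> S x ys" "Smax x = S x ys"
    by (rule Smax_attained[OF x]) blast
  have L: "0 < ?LF" "0 < ?LH" using mu_pos strong_convexity_le_lipschitz[OF h] by auto
  have h_diff: "\<And>y. y \<in> Rn m \<Longrightarrow> h differentiable (at y within Rn m)" using h by (auto simp: lipschitz_gradient_def)
  have h_cvx: "convex_on (Rn m) h" using h_strongly_convex mu_pos by (intro strongly_convex_on_imp_convex_on) auto
  have h_sm: "smooth_on (Rn m) (grad m h) ?LH h"
    using h h_cvx unfolding lipschitz_gradient_def by (intro smooth_on_grad) auto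
  have gF: "spec ?O (grad_F_prog x w) (only K_Grad_yF) (\<lambda>g. g = - grad m (F x) w)" "- grad m (F x) w \<in> Rn m" if "w \<in> Rn m" for w
    using that x grad_F_in_Rn by (auto intro: spec_grad_F_prog)
  have gh: "spec ?O (grad_h_prog w) (only K_Grad_h) (\<lambda>g. g = grad m h w)" "grad m h w \<in> Rn m" if "w \<in> Rn m" for w
    using that h_diff by (auto intro: spec_grad_h_prog grad_works(1))
  have sc: "strongly_convex_on (Rn m) \<mu>y (\<lambda>y. - F x y + h y)" by (rule S_strongly_concave_mu[OF x])
  then have sc': "strongly_convex_on (Rn m) \<mu>y (\<lambda>y. h y + - F x y)" by (simp add: add.commute)
  show ?thesis
  proof (cases "?LF \<le> ?LH")
    case True
    have "spec ?O (sliding_solver m (grad_F_prog x) grad_h_prog ?LF ?LH \<mu>y R)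
      (\<lambda>\<kappa>. R * (sliding_outer ?LF \<mu>y * (only K_Grad_yF \<kappa> + sliding_inner ?LF ?LH * only K_Grad_h \<kappa>)))
      (\<lambda>y. y \<in> Rn m \<and> (- F x y + h y) - (- F x ys + h ys) \<le> (1 / 2) ^ R * ((- F x 0 + h 0) - (- F x ys + h ys)))"
      by (rule spec_sliding_solver[OF smooth_F'[OF x] h_sm h_cvx L sc mu_pos(2) gF gh(1) ys(1)]) (use ys in force)+
    then have "spec ?O (sliding_solver m (grad_F_prog x) grad_h_prog ?LF ?LH \<mu>y R)
      (\<lambda>\<kappa>. R * (sliding_outer ?LF \<mu>y * (only K_Grad_yF \<kappa> + sliding_inner ?LF ?LH * only K_Grad_h \<kappa>)))
      (\<lambda>y. y \<in> Rn m \<and> Smax x - S x y \<le> (1 / 2) ^ R * (Smax x - S x 0))"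
      by (simp only: gap_eq ys(3))
    then show ?thesis using True by (simp only: sliding_solver_F_h_def sliding_counts_def if_True)
  next
    case False
    have "spec ?O (sliding_solver m grad_h_prog (grad_F_prog x) ?LH ?LF \<mu>y R)
      (\<lambda>\<kappa>. R * (sliding_outer ?LH \<mu>y * (only K_Grad_h \<kappa> + sliding_inner ?LH ?LF * only K_Grad_yF \<kappa>)))
      (\<lambda>y. y \<in> Rn m \<and> (h y + - F x y) - (h ys + - F x ys) \<le> (1 / 2) ^ R * ((h 0 + - F x 0) - (h ys + - F x ys)))"
      by (rule spec_sliding_solver[OF h_sm smooth_F'[OF x] F_concave[OF x] L(2,1) sc' mu_pos(2) gh gF(1) ys(1)]) (use ys in force)+
    then have "spec ?O (sliding_solver m grad_h_prog (grad_F_prog x) ?LH ?LF \<mu>y R)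
      (\<lambda>\<kappa>. R * (sliding_outer ?LH \<mu>y * (only K_Grad_h \<kappa> + sliding_inner ?LH ?LF * only K_Grad_yF \<kappa>)))
      (\<lambda>y. y \<in> Rn m \<and> Smax x - S x y \<le> (1 / 2) ^ R * (Smax x - S x 0))"
      by (simp only: gap_eq ys(3))
    then show ?thesis using False by (simp only: sliding_solver_F_h_def sliding_counts_def if_False)
  qed
qed

text \<open>B and D depend on r, F and h, so they may only influence how small \<epsilon> has to be,
  never the algorithm or its counts.\<close>

lemma eventually_attains:
  assumes sol: "\<And>R x. x \<in> Qx \<Longrightarrow> spec (correct_answers n m Qx r F h) (sol R x) (\<lambda>\<kappa>. R * T \<kappa>)
      (\<lambda>y. y \<in> Rn m \<and> Smax x - S x y \<le> (1 / 2) ^ R * (Smax x - S x 0))"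
    and N: "\<And>\<epsilon> \<kappa>. 0 < \<epsilon> \<Longrightarrow> \<epsilon> < 1 / 3 \<Longrightarrow>
      real (outer_count n \<epsilon> * (restart_count \<epsilon> * T \<kappa> + (only K_Sub_xF \<kappa> + only K_Sub_r \<kappa>))) \<le> N \<epsilon> \<kappa>"
  shows "\<forall>\<^sub>F \<epsilon> in at_right 0. attains_within (correct_answers n m Qx r F h)
    (to_algorithm (center_of_gravity_method n Qx (sol (restart_count \<epsilon>)) (\<epsilon> ^ 3) (outer_count n \<epsilon>)))
    (eps_solution m Qx r F h \<epsilon>) (N \<epsilon>)"
proof -
  obtain D where D: "0 \<le> D" "\<And>x. x \<in> Qx \<Longrightarrow> Smax x - S x 0 \<le> D" by (rule initial_gap_bounded) blast
  obtain B where B: "0 \<le> B" "\<And>x w. x \<in> Qx \<Longrightarrow> w \<in> Qx \<Longrightarrow> g w - g x \<le> B" by (rule g_oscillation) blast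
  \<comment> \<open>In this order: ln (1 / \<epsilon>) \<ge> 1 in the counts; \<epsilon> ^ 4 * D
    \<le> \<epsilon> ^ 3 for the inner accuracy; the inequality between \<theta> and \<eta>; and
    twice 2 (\<delta> + \<eta>) = 4 \<epsilon> ^ 3 \<le> \<mu> \<epsilon>^2.\<close>
  define \<epsilon>0 where "\<epsilon>0 = Min {1 / 3, 1 / (D + 1), 1 / (2 * (B + 1)), \<mu>x / 4, \<mu>y / 4}"
  have "0 < \<epsilon>0" using D(1) B(1) mu_pos by (simp add: \<epsilon>0_def)
  then have "\<forall>\<^sub>F \<epsilon> in at_right 0. \<epsilon> \<in> {0<..<\<epsilon>0}" by (rule eventually_at_right_real)
  then show ?thesis
  proof eventually_elim
    fix \<epsilon> assume "\<epsilon> \<in> {0<..<\<epsilon>0}"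
    then have \<epsilon>: "0 < \<epsilon>" "\<epsilon> < 1 / 3" "\<epsilon> < 1 / (D + 1)" "\<epsilon> < 1 / (2 * (B + 1))" "\<epsilon> < \<mu>x / 4" "\<epsilon> < \<mu>y / 4"
      by (auto simp: \<epsilon>0_def)
    have \<epsilon>1: "\<epsilon> < 1" using \<epsilon> by simp
    have "\<epsilon> * (D + 1) < 1" using \<epsilon>(3) D(1) by (simp add: pos_less_divide_eq)
    then have "\<epsilon> * D \<le> 1" using \<epsilon>(1) by (simp add: distrib_left)
    then have "\<epsilon> ^ 3 * (\<epsilon> * D) \<le> \<epsilon> ^ 3 * 1" using \<epsilon>(1) by (intro mult_left_mono) auto
    then have gap: "\<epsilon> ^ 4 * D \<le> \<epsilon> ^ 3" by (simp add: power_Suc[symmetric] eval_nat_numeral mult_ac)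
    have "\<epsilon> * (2 * (B + 1)) < 1" using \<epsilon>(4) B(1) by (simp add: pos_less_divide_eq)
    then have "\<epsilon> * (B + 1) < 1 / 2" by (simp add: algebra_simps)
    moreover have "\<epsilon> * (B + \<epsilon> ^ 3) \<le> \<epsilon> * (B + 1)"
      using \<epsilon>(1) \<epsilon>1 by (intro mult_left_mono add_left_mono power_le_one) auto
    moreover have "\<epsilon> ^ 4 \<le> 1 / 3"
    proof -
      have "\<epsilon> * \<epsilon> ^ 3 \<le> \<epsilon>" using \<epsilon>(1) \<epsilon>1 by (intro mult_left_le power_le_one) auto
      then show ?thesis using \<epsilon>(2) by (simp add: eval_nat_numeral)
    qed
    ultimately have "\<epsilon> * (B + \<epsilon> ^ 3) < 1 - \<epsilon> ^ 4" by linarith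
    then have "\<epsilon> ^ 3 * (\<epsilon> * (B + \<epsilon> ^ 3)) < \<epsilon> ^ 3 * (1 - \<epsilon> ^ 4)" using \<epsilon>(1) by (intro mult_strict_left_mono) auto
    moreover have "\<epsilon> ^ 3 * (\<epsilon> * (B + \<epsilon> ^ 3)) = \<epsilon> ^ 4 * (B + \<epsilon> ^ 3)" by (simp add: eval_nat_numeral mult_ac)
    ultimately have \<eta>: "\<epsilon> ^ 4 * (B + \<epsilon> ^ 3) < \<epsilon> ^ 3 * (1 - \<epsilon> ^ 4)" by simp
    have cube: "2 * (\<epsilon> ^ 3 + \<epsilon> ^ 3) \<le> \<mu> * \<epsilon>\<^sup>2" if "\<epsilon> < \<mu> / 4" for \<mu>
    proof -
      have "4 * \<epsilon> * \<epsilon>\<^sup>2 \<le> \<mu> * \<epsilon>\<^sup>2" using that \<epsilon>(1) by (intro mult_right_mono) auto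
      then show ?thesis by (simp add: power2_eq_square power3_eq_cube)
    qed
    have "spec (correct_answers n m Qx r F h) (sol (restart_count \<epsilon>) x) (\<lambda>\<kappa>. restart_count \<epsilon> * T \<kappa>)
        (\<lambda>y. y \<in> Rn m \<and> Smax x - S x y \<le> \<epsilon> ^ 3)" if x: "x \<in> Qx" for x
    proof (rule spec_mono[OF sol[OF x]])
      have "(1 / 2) ^ restart_count \<epsilon> * (Smax x - S x 0) \<le> \<epsilon> ^ 4 * D"
        using restart_count_accuracy[OF \<epsilon>(1) \<epsilon>1] D(2)[OF x] S_le_Smax[OF x, of 0] \<epsilon>(1) by (intro mult_mono) auto
      then show "y \<in> Rn m \<and> Smax x - S x y \<le> \<epsilon> ^ 3"
        if "y \<in> Rn m \<and> Smax x - S x y \<le> (1 / 2) ^ restart_count \<epsilon> * (Smax x - S x 0)" for y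
        using that gap by linarith
    qed simp
    from spec_center_of_gravity_method[OF this B(2) _ _ \<eta> outer_count_volume[OF \<epsilon>(1) \<epsilon>1] \<epsilon>(1) cube[OF \<epsilon>(5)] cube[OF \<epsilon>(6)]]
    have "spec (correct_answers n m Qx r F h) (center_of_gravity_method n Qx (sol (restart_count \<epsilon>)) (\<epsilon> ^ 3) (outer_count n \<epsilon>))
      (\<lambda>\<kappa>. outer_count n \<epsilon> * (restart_count \<epsilon> * T \<kappa> + (only K_Sub_xF \<kappa> + only K_Sub_r \<kappa>)))
      (\<lambda>v. eps_solution m Qx r F h \<epsilon> (fst v) (snd v))"
      using \<epsilon>(1) \<epsilon>1 by (simp add: power_less_one_iff)
    from attains_within_mono[OF attains_within_to_algorithm[OF this] N[OF \<epsilon>(1,2)]]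
    show "attains_within (correct_answers n m Qx r F h)
      (to_algorithm (center_of_gravity_method n Qx (sol (restart_count \<epsilon>)) (\<epsilon> ^ 3) (outer_count n \<epsilon>)))
      (eps_solution m Qx r F h \<epsilon>) (N \<epsilon>)" .
  qed
qed

lemma eventually_attains_prox:
  shows "\<forall>\<^sub>F \<epsilon> in at_right 0. attains_within (correct_answers n m Qx r F h)
    (to_algorithm (center_of_gravity_method n Qx (prox_solver (2 * max Lyy \<mu>y) \<mu>y (restart_count \<epsilon>)) (\<epsilon> ^ 3) (outer_count n \<epsilon>)))
    (eps_solution m Qx r F h \<epsilon>) (\<lambda>\<kappa>. case \<kappa> of
        K_Sub_xF \<Rightarrow> 12000 * (real n * ln (real n / \<epsilon>))
      | K_Sub_r \<Rightarrow> 12000 * (real n * ln (real n / \<epsilon>))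
      | K_Grad_yF \<Rightarrow> 12000 * (real n * sqrt (max 1 (Lyy / \<mu>y)) * ln (real n / \<epsilon>) * ln (1 / \<epsilon>))
      | K_Prox_h \<Rightarrow> 12000 * (real n * sqrt (max 1 (Lyy / \<mu>y)) * ln (real n / \<epsilon>) * ln (1 / \<epsilon>))
      | K_Grad_h \<Rightarrow> 0)"
  (is "\<forall>\<^sub>F \<epsilon> in _. attains_within _ _ _ (?N \<epsilon>)")
proof -
  let ?T = "\<lambda>\<kappa>. prox_stages (2 * max Lyy \<mu>y) \<mu>y * (only K_Grad_yF \<kappa> + only K_Prox_h \<kappa>)"
  show ?thesis
  proof (rule eventually_attains[where T="?T"])
    fix \<epsilon> :: real and \<kappa> assume \<epsilon>: "0 < \<epsilon>" "\<epsilon> < 1 / 3"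
    have o: "real (outer_count n \<epsilon>) \<le> 12000 * (real n * ln (real n / \<epsilon>))"
      by (rule outer_count_le_12000[OF \<epsilon> dims(1)])
    have "real (prox_stages (2 * max Lyy \<mu>y) \<mu>y) \<le> 30 * sqrt (max 1 (Lyy / \<mu>y))"
      by (rule order_trans[OF prox_stages_le[OF mu_pos(2)]]) simp
    from outer_times_inner_count_le[OF \<epsilon> dims(1) this] o
    show "real (outer_count n \<epsilon> * (restart_count \<epsilon> * ?T \<kappa> + (only K_Sub_xF \<kappa> + only K_Sub_r \<kappa>))) \<le> ?N \<epsilon> \<kappa>"
      by (cases \<kappa>) (simp_all add: only_def)
  qed (rule spec_prox_solver_gap)
qed

lemma eventually_attains_sliding:
  assumes h: "lipschitz_gradient m Lh h"
  shows "\<forall>\<^sub>F \<epsilon> in at_right 0. attains_within (correct_answers n m Qx r F h)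
    (to_algorithm (center_of_gravity_method n Qx (sliding_solver_F_h m (2 * max Lyy \<mu>y) (2 * Lh) \<mu>y (restart_count \<epsilon>)) (\<epsilon> ^ 3) (outer_count n \<epsilon>)))
    (eps_solution m Qx r F h \<epsilon>) (\<lambda>\<kappa>. case \<kappa> of
        K_Sub_xF \<Rightarrow> 12000 * (real n * ln (real n / \<epsilon>))
      | K_Sub_r \<Rightarrow> 12000 * (real n * ln (real n / \<epsilon>))
      | K_Grad_yF \<Rightarrow> 12000 * (real n * sqrt (max 1 (Lyy / \<mu>y)) * ln (real n / \<epsilon>) * ln (1 / \<epsilon>))
      | K_Prox_h \<Rightarrow> 0
      | K_Grad_h \<Rightarrow> 12000 * (real n * sqrt (Lh / \<mu>y) * ln (real n / \<epsilon>) * ln (1 / \<epsilon>)))"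
  (is "\<forall>\<^sub>F \<epsilon> in _. attains_within _ _ _ (?N \<epsilon>)")
proof (rule eventually_attains[where T="sliding_counts (2 * max Lyy \<mu>y) (2 * Lh) \<mu>y"])
  fix \<epsilon> :: real and \<kappa> assume \<epsilon>: "0 < \<epsilon>" "\<epsilon> < 1 / 3"
  have o: "real (outer_count n \<epsilon>) \<le> 12000 * (real n * ln (real n / \<epsilon>))"
    by (rule outer_count_le_12000[OF \<epsilon> dims(1)])
  note T = sliding_counts_le[OF mu_pos(2) strong_convexity_le_lipschitz[OF h], of Lyy]
  from outer_times_inner_count_le[OF \<epsilon> dims(1) T(1)] outer_times_inner_count_le[OF \<epsilon> dims(1) T(2)] o
  show "real (outer_count n \<epsilon> * (restart_count \<epsilon> * sliding_counts (2 * max Lyy \<mu>y) (2 * Lh) \<mu>y \<kappa> + (only K_Sub_xF \<kappa> + only K_Sub_r \<kappa>)))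
      \<le> ?N \<epsilon> \<kappa>"
    using T(3-5) by (cases \<kappa>) (simp_all add: only_def)
qed (rule spec_sliding_solver_gap[OF _ h])

end

theorem mainTheorem1:
  shows "\<exists>C>0::real.
    (\<forall>(n::nat) (m::nat) Qx \<mu>x \<mu>y Lyy.
      \<exists>\<A> :: real \<Rightarrow> algorithm.
        \<forall>r F h. saddle_problem n m Qx r F h \<mu>x \<mu>y Lyy \<longrightarrow>
          (\<forall>\<^sub>F \<epsilon> in at_right 0.
            attains_within (correct_answers n m Qx r F h) (\<A> \<epsilon>) (eps_solution m Qx r F h \<epsilon>)
              (\<lambda>\<kappa>. case \<kappa> of
                  K_Sub_xF \<Rightarrow> C * (n * ln (n / \<epsilon>))
                | K_Sub_r \<Rightarrow> C * (n * ln (n / \<epsilon>))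
                | K_Grad_yF \<Rightarrow> C * (n * sqrt (max 1 (Lyy / \<mu>y)) * ln (n / \<epsilon>) * ln (1 / \<epsilon>))
                | K_Prox_h \<Rightarrow> C * (n * sqrt (max 1 (Lyy / \<mu>y)) * ln (n / \<epsilon>) * ln (1 / \<epsilon>))
                | K_Grad_h \<Rightarrow> 0))) \<and>
    (\<forall>(n::nat) (m::nat) Qx \<mu>x \<mu>y Lyy Lh.
      \<exists>\<A> :: real \<Rightarrow> algorithm.
        \<forall>r F h. saddle_problem n m Qx r F h \<mu>x \<mu>y Lyy \<and> lipschitz_gradient m Lh h \<longrightarrow>
          (\<forall>\<^sub>F \<epsilon> in at_right 0.
            attains_within (correct_answers n m Qx r F h) (\<A> \<epsilon>) (eps_solution m Qx r F h \<epsilon>)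
              (\<lambda>\<kappa>. case \<kappa> of
                  K_Sub_xF \<Rightarrow> C * (n * ln (n / \<epsilon>))
                | K_Sub_r \<Rightarrow> C * (n * ln (n / \<epsilon>))
                | K_Grad_yF \<Rightarrow> C * (n * sqrt (max 1 (Lyy / \<mu>y)) * ln (n / \<epsilon>) * ln (1 / \<epsilon>))
                | K_Prox_h \<Rightarrow> 0
                | K_Grad_h \<Rightarrow> C * (n * sqrt (Lh / \<mu>y) * ln (n / \<epsilon>) * ln (1 / \<epsilon>)))))"
proof (intro exI[of _ "12000 :: real"] conjI allI, goal_cases)
  case (2 n m Qx \<mu>x \<mu>y Lyy)
  \<comment> \<open>The algorithm stays schematic until the last rule; since it is introduced before
    r, F and h, it cannot mention them.\<close>
  show ?case
    by (rule exI, intro allI impI, rule saddle_problem.eventually_attains_prox)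
next
  case (3 n m Qx \<mu>x \<mu>y Lyy Lh)
  show ?case
    by (rule exI, intro allI impI, elim conjE, rule saddle_problem.eventually_attains_sliding)
qed simp

end
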